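(* Let $(b_n)_{n\ge 1}$ be a sequence of positive reals with $b_n=1-\frac{\mathrm{w}}{n^2}+\mathcal{O}\left(\frac{1}{n^{2+\zeta}}\right)$ as $n\to\infty$, for some $\mathrm{w}\in\mathbb{R}$ and $\zeta>0$. Let $b_0^c\in(0,\infty]$ be the critical value and, for $b_0>0$, let $m(b_0)$ be the density of returns to the origin (both defined in the context). Then: (i) For any $0<b_0<b_0^c$, $m(b_0)>0$. (ii) If $b_0^c<\infty$ and $b_0>b_0^c$, then $m(b_0)=0$. (iii) If $b_0^c<\infty$ and $-3/8\le \mathrm{w}<1/8$, then $\lim_{b_0\nearrow b_0^c}m(b_0)=0$. (iv) If $b_0^c<\infty$ and $\mathrm{w}<-3/8$, then $\lim_{b_0\nearrow b_0^c}m(b_0)>0$.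
   Context: The numbers $b_n>0$, $n\ge1$, are fixed and $b_0>0$ is a parameter. SOS model: for $N\ge1$, configurations are $(X_0,\dots,X_N)$ with $X_0=0$, $X_i\in\mathbb{Z}_+=\{0,1,2,\dots\}$, $|X_{i+1}-X_i|=1$, with probability $\mathbf{P}^{\mathrm{SOS}}(X_1,\dots,X_N)=Z_N^{-1}\,2^{-N}\prod_{n=0}^{N}b_{X_n}^{-1}$, $Z_N$ being the normalization (free boundary condition). The bridge (zero boundary condition) is this measure with length $2N$ conditioned on $X_{2N}=0$. Density of returns: $m(b_0)$ is the common value of the limits $\lim_{N\to\infty}\frac{1}{2N-1}\sum_{l=1}^{2N-1}\mathbf{P}^{\mathrm{SOS}}(X_l=0\mid X_{2N}=0)$ and $\lim_{N\to\infty}\frac1N\sum_{l=1}^N\mathbf{P}^{\mathrm{SOS}}(X_l=0)$ (lengths $2N$ and $N$ respectively). Matrix $R$: for sequences $w=(w_p)_{p\ge1}$, $(Rw)_1=\frac{w_2}{2\sqrt{b_1b_2}}$ and $(Rw)_p=\frac{w_{p+1}}{2\sqrt{b_pb_{p+1}}}+\frac{w_{p-1}}{2\sqrt{b_pb_{p-1}}}$ for $p>1$. Put $\rho_*(R)=\lim_{n\to\infty}(R^{2n}_{i,j})^{1/(2n)}$ ($i-j$ even; the limit exists and does not depend on $i,j$), and $\mathfrak{w}_1(\rho)=\inf\{w_1: w_p>0\ \forall p\ge 1,\ (Rw)_p=\rho w_p-\mathbf{1}_{p=1}\ \forall p\ge1\}$, with $\inf\emptyset=\infty$. The critical value is $b_0^c=\lim_{\rho\searrow\rho_*(R)}\frac{\mathfrak{w}_1(\rho)}{4b_1\rho}\in(0,\infty]$.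 *)

theory Defs
  imports "HOL-Probability.Probability" "HOL-Library.Landau_Symbols"
begin

text \<open>
  A sequence \<open>b :: nat \<Rightarrow> real\<close> carries the weights. Everything concerning the matrix \<open>R\<close> and the
  critical value only reads \<open>b n\<close> for \<open>n \<ge> 1\<close>; the SOS model with parameter \<open>b\<^sub>0\<close> is the one for the
  updated sequence \<open>b(0 := b0)\<close>.
\<close>

text \<open>A configuration \<open>(X\<^sub>0, \<dots>, X\<^sub>N)\<close> is the list \<open>X\<close> of length \<open>N + 1\<close>, so that \<open>X\<^sub>i\<close> is \<open>X ! i\<close>.\<close>

definition SOS_paths :: "nat \<Rightarrow> nat list set" where
  "SOS_paths N = {X. length X = Suc N \<and> X ! 0 = 0 \<and>
     (\<forall>i<N. \<bar>int (X ! Suc i) - int (X ! i)\<bar> = 1)}"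

definition SOS_weight :: "(nat \<Rightarrow> real) \<Rightarrow> nat \<Rightarrow> nat list \<Rightarrow> real" where
  "SOS_weight b N X = (1 / 2 ^ N) * (\<Prod>n=0..N. inverse (b (X ! n)))"

definition SOS_Z :: "(nat \<Rightarrow> real) \<Rightarrow> nat \<Rightarrow> real" where
  "SOS_Z b N = (\<Sum>X\<in>SOS_paths N. SOS_weight b N X)"

definition SOS :: "(nat \<Rightarrow> real) \<Rightarrow> nat \<Rightarrow> nat list pmf" where
  "SOS b N = embed_pmf (\<lambda>X. if X \<in> SOS_paths N then SOS_weight b N X / SOS_Z b N else 0)"

definition SOS_bridge :: "(nat \<Rightarrow> real) \<Rightarrow> nat \<Rightarrow> nat list pmf" where
  "SOS_bridge b N = cond_pmf (SOS b (2 * N)) {X. X ! (2 * N) = 0}"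

definition bridge_returns :: "(nat \<Rightarrow> real) \<Rightarrow> nat \<Rightarrow> real" where
  "bridge_returns b N =
     (\<Sum>l=1..2 * N - 1. measure_pmf.prob (SOS_bridge b N) {X. X ! l = 0}) / real (2 * N - 1)"

definition free_returns :: "(nat \<Rightarrow> real) \<Rightarrow> nat \<Rightarrow> real" where
  "free_returns b N =
     (\<Sum>l=1..N. measure_pmf.prob (SOS b N) {X. X ! l = 0}) / real N"

definition has_return_density :: "(nat \<Rightarrow> real) \<Rightarrow> real \<Rightarrow> real \<Rightarrow> bool" where
  "has_return_density b b0 m \<longleftrightarrow>
     bridge_returns (b(0 := b0)) \<longlonglongrightarrow> m \<and> free_returns (b(0 := b0)) \<longlonglongrightarrow> m"

definition return_density :: "(nat \<Rightarrow> real) \<Rightarrow> real \<Rightarrow> real" where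
  "return_density b b0 = (THE m. has_return_density b b0 m)"

text \<open>Rows and columns are indexed by \<open>p \<ge> 1\<close>; the values at index \<open>0\<close> are irrelevant.\<close>

definition R :: "(nat \<Rightarrow> real) \<Rightarrow> (nat \<Rightarrow> real) \<Rightarrow> nat \<Rightarrow> real" where
  "R b v p = v (p + 1) / (2 * sqrt (b p * b (p + 1))) +
     (if p > 1 then v (p - 1) / (2 * sqrt (b p * b (p - 1))) else 0)"

text \<open>The matrix entry \<open>(R\<^sup>n)\<^sub>i\<^sub>,\<^sub>j\<close>: the \<open>i\<close>-th component of \<open>R\<^sup>n\<close> applied to the \<open>j\<close>-th basis vector.\<close>

definition R_entry :: "(nat \<Rightarrow> real) \<Rightarrow> nat \<Rightarrow> nat \<Rightarrow> nat \<Rightarrow> real" where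
  "R_entry b n i j = (R b ^^ n) (\<lambda>p. of_bool (p = j)) i"

definition rho_star :: "(nat \<Rightarrow> real) \<Rightarrow> real" where
  "rho_star b = (THE \<rho>. \<forall>i\<ge>1. \<forall>j\<ge>1. even (int i - int j) \<longrightarrow>
     (\<lambda>n. root (2 * n) (R_entry b (2 * n) i j)) \<longlonglongrightarrow> \<rho>)"

text \<open>The infimum is taken in the extended reals, where that of the empty set is \<open>\<infinity>\<close>.\<close>

definition w1 :: "(nat \<Rightarrow> real) \<Rightarrow> real \<Rightarrow> ereal" where
  "w1 b \<rho> = Inf {ereal (v 1) | v :: nat \<Rightarrow> real.
     (\<forall>p\<ge>1. v p > 0) \<and> (\<forall>p\<ge>1. R b v p = \<rho> * v p - of_bool (p = 1))}"

definition b0_crit :: "(nat \<Rightarrow> real) \<Rightarrow> ereal" where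
  "b0_crit b = Lim (at_right (rho_star b)) (\<lambda>\<rho>. w1 b \<rho> / ereal (4 * b 1 * \<rho>))"

lemma SOS_paths_le:
  assumes "X \<in> SOS_paths N" "i \<le> N"
  shows "X ! i \<le> i"
  using assms(2)
proof (induction i)
  case 0
  then show ?case using assms(1) by (simp add: SOS_paths_def)
next
  case (Suc i)
  then have "\<bar>int (X ! Suc i) - int (X ! i)\<bar> = 1"
    using assms(1) by (simp add: SOS_paths_def)
  with Suc show ?case by linarith
qed

lemma finite_SOS_paths: "finite (SOS_paths N)"
proof (rule finite_subset)
  show "SOS_paths N \<subseteq> {X. set X \<subseteq> {..N} \<and> length X = Suc N}"
  proof
    fix X assume X: "X \<in> SOS_paths N"
    then have l: "length X = Suc N" by (simp add: SOS_paths_def)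
    have "X ! i \<le> N" if "i < length X" for i
      using SOS_paths_le[OF X, of i] that l by simp
    then have "set X \<subseteq> {..N}" by (auto simp: in_set_conv_nth)
    with l show "X \<in> {X. set X \<subseteq> {..N} \<and> length X = Suc N}" by simp
  qed
qed (rule finite_lists_length_eq, simp)

lemma zigzag_in_SOS_paths: "map (\<lambda>i. i mod 2) [0..<Suc N] \<in> SOS_paths N"
proof -
  have "\<bar>int (Suc i mod 2) - int (i mod 2)\<bar> = 1" for i
    by (cases "even i") (simp_all add: mod_2_eq_odd)
  moreover have "map (\<lambda>i. i mod 2) [0..<Suc N] ! i = i mod 2" if "i \<le> N" for i
    using that by (subst nth_map) (simp_all del: upt_Suc)
  ultimately show ?thesis by (simp add: SOS_paths_def del: upt_Suc)
qed

lemma SOS_weight_pos: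
  assumes "\<And>n. b n > 0" shows "SOS_weight b N X > 0"
  using assms by (simp add: SOS_weight_def prod_pos)

lemma SOS_Z_pos:
  assumes "\<And>n. b n > 0" shows "SOS_Z b N > 0"
  unfolding SOS_Z_def
  using zigzag_in_SOS_paths[of N] by (intro sum_pos finite_SOS_paths SOS_weight_pos assms) auto

lemma pmf_SOS:
  assumes "\<And>n. b n > 0"
  shows "pmf (SOS b N) X = (if X \<in> SOS_paths N then SOS_weight b N X / SOS_Z b N else 0)"
proof -
  let ?f = "\<lambda>X. if X \<in> SOS_paths N then SOS_weight b N X / SOS_Z b N else 0"
  have nn: "0 \<le> ?f X" for X
    using SOS_weight_pos[where b=b, OF assms, where N=N and X=X] SOS_Z_pos[where b=b, OF assms, where N=N] by (simp add: less_imp_le)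
  have "(\<integral>\<^sup>+X. ennreal (?f X) \<partial>count_space UNIV) = (\<Sum>X\<in>SOS_paths N. ennreal (?f X))"
    by (rule nn_integral_count_space'[OF finite_SOS_paths]) (auto split: if_splits)
  also have "\<dots> = ennreal (\<Sum>X\<in>SOS_paths N. ?f X)"
    by (rule sum_ennreal) (rule nn)
  also have "(\<Sum>X\<in>SOS_paths N. ?f X) = SOS_Z b N / SOS_Z b N"
    by (simp only: SOS_Z_def sum_divide_distrib) (rule sum.cong, simp_all)
  also have "\<dots> = 1" using SOS_Z_pos[where b=b, OF assms, where N=N] by simp
  finally have "(\<integral>\<^sup>+X. ennreal (?f X) \<partial>count_space UNIV) = 1" by simp
  then show ?thesis unfolding SOS_def by (intro pmf_embed_pmf nn)
qed

lemma bridge_event_possible: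
  assumes "\<And>n. b n > 0"
  shows "set_pmf (SOS b (2 * N)) \<inter> {X. X ! (2 * N) = 0} \<noteq> {}"
proof -
  let ?X = "map (\<lambda>i. i mod 2) [0..<Suc (2 * N)]"
  have "?X \<in> SOS_paths (2 * N)" by (rule zigzag_in_SOS_paths)
  then have "?X \<in> set_pmf (SOS b (2 * N))"
    using SOS_weight_pos[where b=b, OF assms, where N="2 * N" and X="?X"] SOS_Z_pos[where b=b, OF assms, where N="2 * N"]
    by (simp add: set_pmf_iff pmf_SOS[where b=b, OF assms])
  moreover have "?X ! (2 * N) = 0" by (simp add: nth_append)
  ultimately show ?thesis by blast
qed

lemma return_density_eqI:
  assumes "has_return_density b b0 m" shows "return_density b b0 = m"
  unfolding return_density_def
  using assms by (intro the_equality) (auto simp: has_return_density_def intro: LIMSEQ_unique)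

end

theory Submission
  imports Defs "HOL-Real_Asymp.Real_Asymp"
begin

text \<open>
  Conjugating \<open>R\<close> by \<open>sqrt b\<close> turns it into a weighted nearest-neighbour operator \<open>jac\<close>; the SOS partition
  functions are matrix entries of powers of the same kind of operator on \<open>{0, 1, \<dots>}\<close>, with \<open>b\<^sub>0\<close> as weight
  at the origin. By comparison with positive supersolutions, its growth rate is the \<open>\<rho> > \<rho>\<^sub>*\<close> with
  \<open>G\<^sub>\<rho>(1, 1) / (4 b\<^sub>1 \<rho>) = b\<^sub>0\<close> if there is one, and \<open>\<rho>\<^sub>*\<close> otherwise, where \<open>G\<^sub>\<rho> = (\<rho> - R)\<^sup>-\<^sup>1\<close>. The
  density of returns is the derivative of the logarithm of this growth rate in \<open>- ln b\<^sub>0\<close>.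

  At a finite critical value one has \<open>\<rho>\<^sub>* = 1\<close>, and the density vanishes there iff \<open>G\<^sub>\<rho>(1, 1)\<close> has
  infinite slope at \<open>\<rho> = 1\<close>, that is, iff the recessive solution \<open>G\<^sub>1(p, 1)\<close> is not square summable. It behaves
  like \<open>p powr \<alpha>\<close> with \<open>\<alpha> = (1 - sqrt (1 - 8 w)) / 2\<close>, and \<open>\<alpha> < - 1 / 2\<close> iff \<open>w < - 3 / 8\<close>.
\<close>

section \<open>Nearest-neighbour operators and Green functions\<close>

text \<open>No spectral theory is used; bounds on growth rates come from positivity. A positive
  solution of \<open>jac \<beta> y \<le> \<rho> y\<close> bounds the rate by \<rho>, and the Green
  function is the least nonnegative supersolution with unit source. Extending the bulk Green
  function to the origin, or restricting the pinned one to the bulk, gives the two halves of the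
  implicit equation for \<rho>. Existence of the densities is part of the claim. Convexity of the
  finite-volume free energies in - ln b_0 reduces it to differentiability of the limiting growth
  rate, and with s = 1 / \<rho> the parameter b_0 is a power series in s with nonnegative
  coefficients, to which the inverse function theorem applies. A finite critical value makes the
  Green function converge at the growth rate itself, which forces the rate to be at most 1; b_n -> 1
  gives the other inequality. The power law at criticality is not derived: one-sided comparison with
  powers near p powr (- 1 / 2) suffices, by a maximum principle if w < - 3 / 8 and by a Wronskian
  otherwise. The slope enters through the identity of the sum of \<beta>_p G(p)^2 with \<beta>_0
  times the sum of n + 1 times the return weight at time n.\<close>

lemma fekete_superadditive:
  fixes u :: "nat \<Rightarrow> real"
  assumes super: "\<And>m n. u m + u n \<le> u (m + n)" and bound: "\<And>n. u n \<le> C * real n"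
  obtains L where "(\<lambda>n. u n / real n) \<longlonglongrightarrow> L" "\<And>n. u n \<le> L * real n"
proof -
  define L where "L = (SUP n\<in>{1..}. u n / real n)"
  have bdd: "bdd_above ((\<lambda>n. u n / real n) ` {1..})"
    by (rule bdd_aboveI[of _ C]) (auto simp: field_simps bound)
  have u0: "u 0 \<le> 0" using bound[of 0] by simp
  have le: "u n \<le> L * real n" for n
  proof (cases "n = 0")
    case False
    then have "u n / real n \<le> L" unfolding L_def by (intro cSUP_upper bdd) auto
    then show ?thesis using False by (simp add: field_simps)
  qed (use u0 in simp)
  \<comment> \<open>The correction by \<open>u 0\<close> keeps the case q = 0 true, since
    \<open>u 0\<close> may be negative.\<close>
  have mult: "real q * u k \<le> u (q * k) - u 0" for q k
  proof (induction q)
    case (Suc q)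
    have "real (Suc q) * u k = u k + real q * u k" by (simp add: algebra_simps)
    also have "\<dots> \<le> u k + u (q * k) - u 0" using Suc by simp
    also have "\<dots> \<le> u (Suc q * k) - u 0" using super[of k "q * k"] by simp
    finally show ?case .
  qed simp
  have "(\<lambda>n. u n / real n) \<longlonglongrightarrow> L"
  proof (rule order_tendstoI)
    fix a assume "a < L"
    then obtain k where k: "k \<ge> 1" "a < u k / real k"
      unfolding L_def using less_cSUP_iff[OF _ bdd, of a] by auto
    \<comment> \<open>With n = q k + r, this constant absorbs \<open>u r\<close>, the loss in
      replacing n / k by q, and the correction \<open>u 0\<close>.\<close>
    define B where "B = (\<Sum>r<k. \<bar>u r\<bar>) + \<bar>u k\<bar> - u 0"
    have lower: "real n * (u k / real k) - B \<le> u n" for n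
    proof -
      have r: "n mod k < k" using k by simp
      have "u (n mod k) + u (n div k * k) \<le> u n"
        using super[of "n mod k" "n div k * k"] by simp
      moreover have "\<bar>u (n mod k)\<bar> \<le> (\<Sum>r<k. \<bar>u r\<bar>)"
        using r by (intro member_le_sum) auto
      moreover have "real (n div k) * u k \<ge> real n * (u k / real k) - \<bar>u k\<bar>"
      proof -
        have "real n = real (n div k) * real k + real (n mod k)"
          by (metis of_nat_add of_nat_mult div_mult_mod_eq)
        then have "real n * (u k / real k) = real (n div k) * u k + real (n mod k) / real k * u k"
          using k by (simp add: field_simps)
        moreover have "real (n mod k) / real k * u k \<le> 1 * \<bar>u k\<bar>"
        proof -
          have "real (n mod k) / real k * u k \<le> real (n mod k) / real k * \<bar>u k\<bar>"
            by (intro mult_left_mono) auto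
          also have "\<dots> \<le> 1 * \<bar>u k\<bar>"
            using k r by (intro mult_right_mono) auto
          finally show ?thesis .
        qed
        ultimately show ?thesis by simp
      qed
      ultimately show ?thesis using mult[of "n div k" k] unfolding B_def by linarith
    qed
    have "(\<lambda>n. u k / real k - B / real n) \<longlonglongrightarrow> u k / real k - 0"
      by (intro tendsto_intros real_tendsto_divide_at_top[OF tendsto_const] filterlim_real_sequentially)
    then have "\<forall>\<^sub>F n in sequentially. a < u k / real k - B / real n"
      using k by (intro order_tendstoD(1)) auto
    then show "\<forall>\<^sub>F n in sequentially. a < u n / real n"
      using eventually_gt_at_top[of 0]
    proof eventually_elim
      case (elim n)
      have "u k / real k - B / real n = (real n * (u k / real k) - B) / real n"
        using elim by (simp add: diff_divide_distrib)
      also have "\<dots> \<le> u n / real n"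
        using lower[of n] by (intro divide_right_mono) auto
      finally have "u k / real k - B / real n \<le> u n / real n" .
      then show ?case using elim by simp
    qed
  next
    fix a assume "L < a"
    show "\<forall>\<^sub>F n in sequentially. u n / real n < a"
      using eventually_gt_at_top[of 0]
    proof (rule eventually_mono)
      fix n :: nat assume "0 < n"
      then have "u n / real n \<le> L" using le[of n] by (simp add: field_simps)
      then show "u n / real n < a" using \<open>L < a\<close> by simp
    qed
  qed
  then show thesis using that le by blast
qed

section \<open>The weighted path operator and the growth rate of its powers\<close>

definition jac :: "(nat \<Rightarrow> real) \<Rightarrow> (nat \<Rightarrow> real) \<Rightarrow> nat \<Rightarrow> real" where
  "jac \<beta> x p = (x (Suc p) + (if p = 0 then 0 else x (p - 1))) / (2 * \<beta> p)"

definition entry :: "(nat \<Rightarrow> real) \<Rightarrow> nat \<Rightarrow> nat \<Rightarrow> nat \<Rightarrow> real" where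
  "entry \<beta> n p q = (jac \<beta> ^^ n) (\<lambda>i. of_bool (i = q)) p"

text \<open>Only even times enter: a closed path has even length, so the diagonal entries at odd
  times vanish.\<close>

definition growth :: "(nat \<Rightarrow> real) \<Rightarrow> real" where
  "growth \<beta> = exp (lim (\<lambda>n. ln (entry \<beta> (2 * n) 0 0) / real (2 * n)))"

text \<open>Transience of the path weights after rescaling by \<rho>. For weights bounded below it
  holds at every \<rho> above \<open>growth \<beta>\<close>; whether it still holds at
  \<open>growth \<beta>\<close> itself decides the behaviour at criticality.\<close>

definition transient :: "(nat \<Rightarrow> real) \<Rightarrow> real \<Rightarrow> bool" where
  "transient \<beta> \<rho> \<longleftrightarrow> 0 < \<rho> \<and> summable (\<lambda>n. entry \<beta> n 0 0 / \<rho> ^ n)"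

text \<open>The column at 0 of the resolvent at \<rho>, as a Neumann series. With the shifted bulk
  weights, site 0 is the index 1 of \<open>R\<close>.\<close>

definition green :: "(nat \<Rightarrow> real) \<Rightarrow> real \<Rightarrow> nat \<Rightarrow> real" where
  "green \<beta> \<rho> p = (\<Sum>n. entry \<beta> n p 0 / \<rho> ^ Suc n)"

lemma jac_pow_scale: "(jac \<beta> ^^ n) (\<lambda>p. k * x p) p = k * (jac \<beta> ^^ n) x p"
proof (induction n arbitrary: p)
  case (Suc n)
  have "(jac \<beta> ^^ n) (\<lambda>p. k * x p) = (\<lambda>p. k * (jac \<beta> ^^ n) x p)" using Suc by blast
  then have "(jac \<beta> ^^ Suc n) (\<lambda>p. k * x p) p = jac \<beta> (\<lambda>p. k * (jac \<beta> ^^ n) x p) p"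
    by simp
  then show ?case by (simp add: jac_def[of _ _ p] add_divide_distrib distrib_left)
qed simp

lemma entry_0: "entry \<beta> 0 p q = of_bool (p = q)"
  by (simp add: entry_def)

lemma entry_Suc: "entry \<beta> (Suc n) p q = jac \<beta> (\<lambda>i. entry \<beta> n i q) p"
  by (simp add: entry_def)

lemma entry_eq_0_odd: "odd (n + p + q) \<Longrightarrow> entry \<beta> n p q = 0"
proof (induction n arbitrary: p)
  case 0
  then show ?case by (cases "p = q") (simp_all add: entry_0)
next
  case (Suc n)
  note IH = Suc.IH and Suc.prems
  show ?case
  proof (cases p)
    case 0
    then have "odd (n + Suc p + q)" using \<open>odd (Suc n + p + q)\<close> by simp
    then have "entry \<beta> n (Suc p) q = 0" by (rule IH)
    then show ?thesis using 0 by (simp add: entry_Suc jac_def)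
  next
    case (Suc r)
    then have "odd (n + Suc p + q)" "odd (n + r + q)" using \<open>odd (Suc n + p + q)\<close> by simp_all
    then have "entry \<beta> n (Suc p) q = 0 \<and> entry \<beta> n r q = 0" by (intro conjI IH)
    then show ?thesis using Suc by (simp add: entry_Suc jac_def)
  qed
qed

lemma entry_eq_0_far: "n + q < p \<Longrightarrow> entry \<beta> n p q = 0"
  by (induction n arbitrary: p) (auto simp: entry_0 entry_Suc jac_def)

locale weights =
  fixes \<beta> :: "nat \<Rightarrow> real" and c :: real
  assumes c_pos: "0 < c" and c_le: "\<And>p. c \<le> \<beta> p"
begin

lemma pos: "0 < \<beta> p"
  using c_pos c_le[of p] by simp

lemma jac_mono: "(\<And>p. x p \<le> y p) \<Longrightarrow> jac \<beta> x p \<le> jac \<beta> y p"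
  using pos[of p] unfolding jac_def by (intro divide_right_mono add_mono) auto

lemma jac_pow_mono: "(\<And>p. x p \<le> y p) \<Longrightarrow> (jac \<beta> ^^ n) x p \<le> (jac \<beta> ^^ n) y p"
  by (induction n arbitrary: p) (auto intro: jac_mono)

lemma jac_pow_super:
  assumes "\<And>p. jac \<beta> y p \<le> \<rho> * y p" "0 \<le> \<rho>"
  shows "(jac \<beta> ^^ n) y p \<le> \<rho> ^ n * y p"
proof (induction n arbitrary: p)
  case (Suc n)
  have "(jac \<beta> ^^ Suc n) y p \<le> jac \<beta> (\<lambda>p. \<rho> ^ n * y p) p"
    using Suc by (auto intro: jac_mono)
  also have "\<dots> = \<rho> ^ n * jac \<beta> y p"
    using jac_pow_scale[of 1] by simp
  also have "\<dots> \<le> \<rho> ^ n * (\<rho> * y p)"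
    using assms by (intro mult_left_mono) auto
  finally show ?case by (simp add: mult_ac)
qed simp

lemma entry_nonneg: "0 \<le> entry \<beta> n p q"
proof (induction n arbitrary: p)
  case (Suc n)
  then show ?case using pos[of p] by (auto simp: entry_Suc jac_def)
qed (simp add: entry_0)

lemma jac_pow_ge_entry:
  assumes "\<And>p. 0 \<le> y p"
  shows "entry \<beta> n p q * y q \<le> (jac \<beta> ^^ n) y p"
proof -
  have "y q * entry \<beta> n p q = (jac \<beta> ^^ n) (\<lambda>i. y q * of_bool (i = q)) p"
    by (simp add: entry_def jac_pow_scale)
  also have "\<dots> \<le> (jac \<beta> ^^ n) y p"
    using assms by (intro jac_pow_mono) auto
  finally show ?thesis by (simp add: mult.commute)
qed

text \<open>Concatenation of paths: the product keeps only those paths from p to r that sit at q at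
  time m.\<close>

lemma entry_mult_le: "entry \<beta> m p q * entry \<beta> n q r \<le> entry \<beta> (m + n) p r"
proof -
  have "entry \<beta> m p q * entry \<beta> n q r \<le> (jac \<beta> ^^ m) (\<lambda>i. entry \<beta> n i r) p"
    by (rule jac_pow_ge_entry) (rule entry_nonneg)
  also have "\<dots> = entry \<beta> (m + n) p r"
    by (simp add: entry_def[abs_def] funpow_add)
  finally show ?thesis .
qed

lemma entry_le_super:
  assumes "\<And>p. jac \<beta> y p \<le> \<rho> * y p" "\<And>p. 0 \<le> y p" "0 \<le> \<rho>"
  shows "entry \<beta> n p q * y q \<le> \<rho> ^ n * y p"
  using jac_pow_ge_entry[of y n p q, OF assms(2)] jac_pow_super[OF assms(1,3), of n p] by linarith

lemma entry_le_pow: "entry \<beta> n p q \<le> (1 / c) ^ n"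
proof -
  have "jac \<beta> (\<lambda>_. 1) p \<le> 1 / c * 1" for p
  proof -
    have "jac \<beta> (\<lambda>_. 1) p \<le> 2 / (2 * \<beta> p)"
      unfolding jac_def using pos[of p] by (intro divide_right_mono) auto
    also have "\<dots> \<le> 1 / c" using c_pos c_le[of p] by (simp add: frac_le)
    finally show ?thesis by simp
  qed
  then have "entry \<beta> n p q * 1 \<le> (1 / c) ^ n * 1"
    using c_pos by (intro entry_le_super) auto
  then show ?thesis by simp
qed

lemma entry_up_pos: "0 < entry \<beta> p 0 p"
proof (induction p)
  case (Suc p)
  have "entry \<beta> 1 p (Suc p) > 0" using pos[of p] by (simp add: entry_Suc entry_0 jac_def)
  then show ?case using Suc entry_mult_le[of p 0 p 1 "Suc p"] by (simp add: less_le_trans[rotated])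
qed (simp add: entry_0)

lemma entry_down_pos: "0 < entry \<beta> p p 0"
proof (induction p)
  case (Suc p)
  have "entry \<beta> 1 (Suc p) p > 0" using pos[of "Suc p"] by (simp add: entry_Suc entry_0 jac_def)
  then show ?case using Suc entry_mult_le[of 1 "Suc p" p p 0] by (simp add: less_le_trans[rotated])
qed (simp add: entry_0)

lemma entry_even_pos: "0 < entry \<beta> (2 * n) 0 0"
proof (induction n)
  case (Suc n)
  have "0 < entry \<beta> 1 0 1 * entry \<beta> 1 1 0" using entry_up_pos[of 1] entry_down_pos[of 1] by simp
  also have "\<dots> \<le> entry \<beta> 2 0 0" using entry_mult_le[of 1 0 1 1 0] by (simp add: numeral_2_eq_2)
  finally show ?case using Suc entry_mult_le[of 2 0 0 "2 * n" 0] by (simp add: less_le_trans[rotated])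
qed (simp add: entry_0)

text \<open>Concatenating loops makes the logarithms of the return weights superadditive. Fekete's
  limit is also a supremum, which gives the bound
  \<open>entry \<beta> n 0 0 \<le> growth \<beta> ^ n\<close> with constant 1; every comparison with
  a geometric series rests on it.\<close>

lemma growth_tendsto_ln: "(\<lambda>n. ln (entry \<beta> (2 * n) 0 0) / real (2 * n)) \<longlonglongrightarrow> ln (growth \<beta>)" (is ?lim)
  and entry_le_growth: "entry \<beta> n 0 0 \<le> growth \<beta> ^ n"
proof -
  define u where "u n = ln (entry \<beta> (2 * n) 0 0)" for n
  have "u m + u n \<le> u (m + n)" for m n
  proof -
    have "u m + u n = ln (entry \<beta> (2 * m) 0 0 * entry \<beta> (2 * n) 0 0)"
      unfolding u_def by (simp add: ln_mult_pos entry_even_pos)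
    also have "\<dots> \<le> u (m + n)"
      unfolding u_def using entry_mult_le[of "2 * m" 0 0 "2 * n" 0]
        entry_even_pos[of m] entry_even_pos[of n] entry_even_pos[of "m + n"]
      by (subst ln_le_cancel_iff) (simp_all add: distrib_left)
    finally show ?thesis .
  qed
  moreover have "u n \<le> 2 * ln (1 / c) * real n" for n
  proof -
    have "u n \<le> ln ((1 / c) ^ (2 * n))"
      unfolding u_def using entry_le_pow[of "2 * n" 0 0] c_pos
      by (subst ln_le_cancel_iff) (simp_all add: entry_even_pos)
    also have "\<dots> = 2 * ln (1 / c) * real n" using c_pos by (simp add: ln_realpow)
    finally show ?thesis .
  qed
  ultimately obtain L where L: "(\<lambda>n. u n / real n) \<longlonglongrightarrow> L" "\<And>n. u n \<le> L * real n"
    using fekete_superadditive by blast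
  have "(\<lambda>n. u n / real n / 2) \<longlonglongrightarrow> L / 2" by (intro tendsto_intros L) simp
  then have lim: "(\<lambda>n. ln (entry \<beta> (2 * n) 0 0) / real (2 * n)) \<longlonglongrightarrow> L / 2"
    by (simp add: u_def mult.commute)
  then have g: "growth \<beta> = exp (L / 2)" by (simp add: growth_def limI)
  then show ?lim using lim by simp
  show "entry \<beta> n 0 0 \<le> growth \<beta> ^ n"
  proof (cases "even n")
    case True
    then obtain k where k: "n = 2 * k" by blast
    have "entry \<beta> n 0 0 = exp (u k)" by (simp add: u_def k entry_even_pos)
    also have "\<dots> \<le> exp (L * real k)" using L(2) by simp
    also have "\<dots> = growth \<beta> ^ n" by (simp add: g k exp_of_nat_mult[symmetric])
    finally show ?thesis .
  qed (simp add: entry_eq_0_odd growth_def)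
qed

lemma growth_pos: "0 < growth \<beta>"
  by (simp add: growth_def)

lemma growth_le:
  assumes "0 < \<rho>" and "\<And>n. entry \<beta> n 0 0 \<le> C * \<rho> ^ n"
  shows "growth \<beta> \<le> \<rho>"
proof -
  have C: "0 < C" using assms(2)[of 0] by (simp add: entry_0)
  have "(\<lambda>n. ln C / real (2 * n) + ln \<rho>) \<longlonglongrightarrow> 0 + ln \<rho>"
    by (intro tendsto_intros real_tendsto_divide_at_top[OF tendsto_const]
         filterlim_compose[OF filterlim_real_sequentially] mult_nat_left_at_top) auto
  moreover have "\<forall>\<^sub>F n in sequentially. ln (entry \<beta> (2 * n) 0 0) / real (2 * n) \<le> ln C / real (2 * n) + ln \<rho>"
    using eventually_gt_at_top[of 0]
  proof eventually_elim
    case (elim n)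
    have "ln (entry \<beta> (2 * n) 0 0) \<le> ln (C * \<rho> ^ (2 * n))"
      using assms C by (subst ln_le_cancel_iff) (simp_all add: entry_even_pos)
    also have "\<dots> = ln C + real (2 * n) * ln \<rho>"
      using C assms by (simp add: ln_mult_pos ln_realpow)
    finally show ?case using elim by (simp add: field_simps)
  qed
  ultimately have "ln (growth \<beta>) \<le> 0 + ln \<rho>"
    using growth_tendsto_ln by (intro tendsto_le[OF sequentially_bot])
  then show ?thesis using assms(1) growth_pos by simp
qed

lemma growth_le_super:
  assumes "0 < \<rho>" "\<And>p. jac \<beta> y p \<le> \<rho> * y p" "\<And>p. 0 < y p"
  shows "growth \<beta> \<le> \<rho>"
proof (rule growth_le[OF assms(1), of 1])
  fix n
  have "entry \<beta> n 0 0 * y 0 \<le> \<rho> ^ n * y 0"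
    using assms by (intro entry_le_super) (auto intro: less_imp_le)
  then show "entry \<beta> n 0 0 \<le> 1 * \<rho> ^ n" using assms(3)[of 0] by simp
qed

lemma transient_above_growth:
  assumes "growth \<beta> < \<rho>"
  shows "transient \<beta> \<rho>"
proof -
  have \<rho>: "0 < \<rho>" using assms growth_pos by simp
  have "summable (\<lambda>n. (growth \<beta> / \<rho>) ^ n)"
    using assms growth_pos \<rho> by (intro summable_geometric) simp
  then have "summable (\<lambda>n. entry \<beta> n 0 0 / \<rho> ^ n)"
    by (rule summable_comparison_test'[where N=0]) (use \<rho> entry_le_growth in
       \<open>auto simp: power_divide entry_nonneg intro!: divide_right_mono\<close>)
  then show ?thesis using \<rho> by (simp add: transient_def)
qed

section \<open>The Green function: equation, minimality and comparison\<close>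

lemma green_summable:
  assumes "transient \<beta> \<rho>"
  shows "summable (\<lambda>n. entry \<beta> n p 0 / \<rho> ^ Suc n)"
proof -
  have \<rho>: "0 < \<rho>" and s: "summable (\<lambda>n. entry \<beta> n 0 0 / \<rho> ^ n)"
    using assms by (auto simp: transient_def)
  have "summable (\<lambda>n. entry \<beta> (n + p) 0 0 / \<rho> ^ (n + p))"
    using s by (subst summable_iff_shift)
  then have s': "summable (\<lambda>n. \<rho> ^ p / (entry \<beta> p 0 p * \<rho>) * (entry \<beta> (n + p) 0 0 / \<rho> ^ (n + p)))"
    by (rule summable_mult)
  show ?thesis
  proof (rule summable_comparison_test'[OF s', of 0])
    fix n
    \<comment> \<open>A path from p to 0, preceded by the direct climb from 0 to p, is a loop at 0;
      this bounds the series at p by the shifted series at 0.\<close>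
    have "entry \<beta> n p 0 * entry \<beta> p 0 p \<le> entry \<beta> (n + p) 0 0"
      using entry_mult_le[of p 0 p n 0] by (simp add: add.commute mult.commute)
    then have "entry \<beta> n p 0 \<le> entry \<beta> (n + p) 0 0 / entry \<beta> p 0 p"
      by (simp add: pos_le_divide_eq entry_up_pos)
    then have "entry \<beta> n p 0 / \<rho> ^ Suc n \<le> entry \<beta> (n + p) 0 0 / entry \<beta> p 0 p / \<rho> ^ Suc n"
      using \<rho> by (intro divide_right_mono) auto
    also have "\<dots> = \<rho> ^ p / (entry \<beta> p 0 p * \<rho>) * (entry \<beta> (n + p) 0 0 / \<rho> ^ (n + p))"
      using \<rho> by (simp add: power_add)
    finally show "norm (entry \<beta> n p 0 / \<rho> ^ Suc n)
        \<le> \<rho> ^ p / (entry \<beta> p 0 p * \<rho>) * (entry \<beta> (n + p) 0 0 / \<rho> ^ (n + p))"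
      using \<rho> by (simp add: entry_nonneg)
  qed
qed

lemma green_pos:
  assumes "transient \<beta> \<rho>"
  shows "0 < green \<beta> \<rho> p"
  unfolding green_def using assms entry_down_pos[of p]
  by (intro suminf_pos2[OF green_summable, of _ _ p]) (auto simp: entry_nonneg transient_def)

lemma green_eq:
  assumes "transient \<beta> \<rho>"
  shows "jac \<beta> (green \<beta> \<rho>) p = \<rho> * green \<beta> \<rho> p - of_bool (p = 0)"
proof -
  have \<rho>: "0 < \<rho>" using assms by (simp add: transient_def)
  have sums: "(\<lambda>n. entry \<beta> n p 0 / \<rho> ^ Suc n) sums green \<beta> \<rho> p" for p
    unfolding green_def by (intro summable_sums green_summable assms)
  have "(\<lambda>n. jac \<beta> (\<lambda>p. entry \<beta> n p 0 / \<rho> ^ Suc n) p) sums jac \<beta> (green \<beta> \<rho>) p"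
    unfolding jac_def by (intro sums_divide sums_add) (use sums sums_zero in \<open>auto simp del: power_Suc\<close>)
  moreover have "jac \<beta> (\<lambda>p. entry \<beta> n p 0 / \<rho> ^ Suc n) p = entry \<beta> (Suc n) p 0 / \<rho> ^ Suc n" for n
    by (simp add: entry_Suc jac_def add_divide_distrib mult_ac)
  ultimately have 1: "(\<lambda>n. entry \<beta> (Suc n) p 0 / \<rho> ^ Suc n) sums jac \<beta> (green \<beta> \<rho>) p" by simp
  have "(\<lambda>n. \<rho> * (entry \<beta> n p 0 / \<rho> ^ Suc n)) sums (\<rho> * green \<beta> \<rho> p)"
    by (intro sums_mult sums)
  moreover have "\<rho> * (entry \<beta> n p 0 / \<rho> ^ Suc n) = entry \<beta> n p 0 / \<rho> ^ n" for n
    using \<rho> by simp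
  ultimately have "(\<lambda>n. entry \<beta> n p 0 / \<rho> ^ n) sums (\<rho> * green \<beta> \<rho> p)" by simp
  then have "(\<lambda>n. entry \<beta> (Suc n) p 0 / \<rho> ^ Suc n) sums (\<rho> * green \<beta> \<rho> p - of_bool (p = 0))"
    by (subst sums_Suc_iff) (simp add: entry_0)
  with 1 show ?thesis by (rule sums_unique2)
qed

text \<open>The partial sums S_N are the iterates of S -> (\<delta>_0 + \<open>jac\<close> S) /
  \<rho> started at 0. The map is monotone, so k S_N never overtakes a nonnegative supersolution
  with source k.\<close>

lemma green_partial_le:
  assumes "0 < \<rho>" and "\<And>p. 0 \<le> x p" and k: "\<And>p. jac \<beta> x p + k * of_bool (p = 0) \<le> \<rho> * x p"
  shows "k * (\<Sum>n<N. entry \<beta> n p 0 / \<rho> ^ Suc n) \<le> x p"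
proof (induction N arbitrary: p)
  case (Suc N)
  let ?S = "\<lambda>N p. k * (\<Sum>n<N. entry \<beta> n p 0 / \<rho> ^ Suc n)"
  have "\<rho> * ?S (Suc N) p = k * of_bool (p = 0) + k * (\<Sum>n<N. entry \<beta> (Suc n) p 0 / \<rho> ^ Suc n)"
    using assms(1) by (subst sum.lessThan_Suc_shift)
      (simp add: entry_0 sum_distrib_left sum_divide_distrib distrib_left mult_ac)
  also have "k * (\<Sum>n<N. entry \<beta> (Suc n) p 0 / \<rho> ^ Suc n) = jac \<beta> (?S N) p"
    unfolding entry_Suc jac_def
    by (cases "p = 0") (simp_all add: sum_distrib_left sum_divide_distrib sum.distrib[symmetric]
          distrib_left add_divide_distrib mult_ac)
  also have "\<dots> \<le> jac \<beta> x p" using Suc by (rule jac_mono)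
  finally have "\<rho> * ?S (Suc N) p \<le> \<rho> * x p" using k[of p] by simp
  then show ?case using assms(1) by simp
qed (use assms in simp)

text \<open>Minimality of the Green function. Transience is part of the conclusion: the uniform
  bound on the partial sums produces it from any nonnegative supersolution with a genuine source at
  0.\<close>

lemma transient_if_strict_super:
  assumes "0 < \<rho>" "\<And>p. 0 \<le> x p" "0 < k" "\<And>p. jac \<beta> x p + k * of_bool (p = 0) \<le> \<rho> * x p"
  shows "transient \<beta> \<rho>" "k * green \<beta> \<rho> p \<le> x p"
proof -
  have le: "(\<Sum>n<N. entry \<beta> n p 0 / \<rho> ^ Suc n) \<le> x p / k" for N p
    using green_partial_le[OF assms(1,2,4), where N=N and p=p] assms(3) by (simp add: field_simps)
  have s: "summable (\<lambda>n. entry \<beta> n p 0 / \<rho> ^ Suc n)" for p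
    using assms(1) le by (intro summableI_nonneg_bounded) (auto simp: entry_nonneg)
  have "summable (\<lambda>n. \<rho> * (entry \<beta> n 0 0 / \<rho> ^ Suc n))"
    by (intro summable_mult s)
  moreover have "\<rho> * (entry \<beta> n 0 0 / \<rho> ^ Suc n) = entry \<beta> n 0 0 / \<rho> ^ n" for n
    using assms(1) by simp
  ultimately show "transient \<beta> \<rho>" using assms(1) by (simp add: transient_def)
  have "green \<beta> \<rho> p \<le> x p / k"
    unfolding green_def by (rule suminf_le_const[OF s]) (use le in auto)
  then show "k * green \<beta> \<rho> p \<le> x p" using assms(3) by (simp add: field_simps)
qed

text \<open>A maximum principle. The constant makes C y dominate on the finite set where y need not
  be a supersolution; outside it the bound passes from one partial sum to the next. The iteration
  starts at 0, so no condition at infinity is required of y.\<close>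

lemma green_le_super_outside:
  assumes tr: "transient \<beta> \<rho>" and y: "\<And>p. 0 < y p" and super: "\<And>p. P < p \<Longrightarrow> jac \<beta> y p \<le> \<rho> * y p"
  obtains C where "0 < C" "\<And>p. green \<beta> \<rho> p \<le> C * y p"
proof -
  have \<rho>: "0 < \<rho>" using tr by (simp add: transient_def)
  define C where "C = (\<Sum>p\<le>P. green \<beta> \<rho> p / y p)"
  have C: "0 < C" unfolding C_def by (intro sum_pos) (auto simp: green_pos tr y)
  have inside: "green \<beta> \<rho> p \<le> C * y p" if "p \<le> P" for p
  proof -
    have "green \<beta> \<rho> p / y p \<le> C" unfolding C_def
      using that by (intro member_le_sum) (auto simp: green_pos tr y less_imp_le)
    then show ?thesis using y[of p] by (simp add: field_simps)
  qed
  have part: "(\<Sum>n<N. entry \<beta> n p 0 / \<rho> ^ Suc n) \<le> C * y p" for N p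
  proof (induction N arbitrary: p)
    case 0
    then show ?case using C y[of p] by simp
  next
    case (Suc N)
    show ?case
    proof (cases "p \<le> P")
      case True
      have "(\<Sum>n<Suc N. entry \<beta> n p 0 / \<rho> ^ Suc n) \<le> green \<beta> \<rho> p"
        unfolding green_def using \<rho> by (intro sum_le_suminf green_summable tr) (auto simp: entry_nonneg)
      then show ?thesis using inside[OF True] by simp
    next
      case False
      let ?S = "\<lambda>N p. (\<Sum>n<N. entry \<beta> n p 0 / \<rho> ^ Suc n)"
      have "\<rho> * ?S (Suc N) p = (\<Sum>n<N. entry \<beta> (Suc n) p 0 / \<rho> ^ Suc n)"
        using \<rho> False by (subst sum.lessThan_Suc_shift)
          (simp add: entry_0 sum_distrib_left)
      also have "(\<Sum>n<N. entry \<beta> (Suc n) p 0 / \<rho> ^ Suc n) = jac \<beta> (?S N) p"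
        unfolding entry_Suc jac_def
        by (simp add: sum_distrib_left sum_divide_distrib sum.distrib[symmetric]
              distrib_left add_divide_distrib mult_ac)
      also have "\<dots> \<le> jac \<beta> (\<lambda>p. C * y p) p" using Suc by (rule jac_mono)
      also have "\<dots> = C * jac \<beta> y p" using jac_pow_scale[of 1] by simp
      also have "\<dots> \<le> C * (\<rho> * y p)" using super[of p] False C by (intro mult_left_mono) auto
      finally have "\<rho> * ?S (Suc N) p \<le> \<rho> * (C * y p)" by (simp add: mult_ac)
      then show ?thesis using \<rho> by simp
    qed
  qed
  have "green \<beta> \<rho> p \<le> C * y p" for p
    unfolding green_def by (rule suminf_le_const[OF green_summable[OF tr]]) (use part in auto)
  with C show thesis by (rule that)
qed

text \<open>The operator is self-adjoint for the weights \<beta>. On a truncated sum there remains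
  half the discrete Wronskian at the cut, which vanishes when both functions are 0 just beyond
  it.\<close>

lemma jac_symmetric:
  assumes "x (Suc M) = 0" "y (Suc M) = 0"
  shows "(\<Sum>p\<le>M. \<beta> p * jac \<beta> x p * y p) = (\<Sum>p\<le>M. \<beta> p * x p * jac \<beta> y p)"
proof -
  have "(\<Sum>p\<le>K. \<beta> p * jac \<beta> x p * y p) - (\<Sum>p\<le>K. \<beta> p * x p * jac \<beta> y p)
      = (x (Suc K) * y K - x K * y (Suc K)) / 2" for K
  proof (induction K)
    case 0
    then show ?case using pos[of 0] by (simp add: jac_def field_simps)
  next
    case (Suc K)
    have "\<beta> (Suc K) * jac \<beta> x (Suc K) * y (Suc K) - \<beta> (Suc K) * x (Suc K) * jac \<beta> y (Suc K)
        = ((x (Suc (Suc K)) + x K) * y (Suc K) - x (Suc K) * (y (Suc (Suc K)) + y K)) / 2"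
      using pos[of "Suc K"] by (simp add: jac_def field_simps)
    then show ?case using Suc by (simp add: field_simps)
  qed
  from this[of M] show ?thesis using assms by simp
qed

text \<open>Self-adjointness moves the powers from one factor to the other one at a time. The bound
  m + n \<le> M places the cut out of reach of every path involved.\<close>

lemma entry_inner_product:
  "m + n \<le> M \<Longrightarrow> (\<Sum>p\<le>M. \<beta> p * entry \<beta> m p 0 * entry \<beta> n p 0) = \<beta> 0 * entry \<beta> (m + n) 0 0"
proof (induction m arbitrary: n)
  case 0
  have "(\<Sum>p\<le>M. \<beta> p * entry \<beta> 0 p 0 * entry \<beta> n p 0) = (\<Sum>p\<in>{0}. \<beta> p * entry \<beta> n p 0)"
    by (intro sum.mono_neutral_cong_right) (auto simp: entry_0)
  then show ?case by simp
next
  case (Suc m)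
  have "(\<Sum>p\<le>M. \<beta> p * entry \<beta> (Suc m) p 0 * entry \<beta> n p 0)
      = (\<Sum>p\<le>M. \<beta> p * entry \<beta> m p 0 * entry \<beta> (Suc n) p 0)"
    unfolding entry_Suc using Suc.prems by (intro jac_symmetric) (auto simp: entry_eq_0_far)
  also have "\<dots> = \<beta> 0 * entry \<beta> (m + Suc n) 0 0" using Suc.prems by (intro Suc.IH) simp
  finally show ?case by simp
qed

end

section \<open>Growth rates and the critical value\<close>

lemma (in weights) entry_root_tendsto:
  assumes "even (i + j)" "0 < K"
  shows "(\<lambda>n. root (2 * n) (K * entry \<beta> (2 * n) i j)) \<longlonglongrightarrow> growth \<beta>"
proof -
  obtain k where k: "i + j = 2 * k" using assms by blast
  define A where "A = K * (entry \<beta> i i 0 * entry \<beta> j 0 j)"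
  define B where "B = K * growth \<beta> ^ (2 * k) / (entry \<beta> i 0 i * entry \<beta> j j 0)"
  have AB: "0 < A" "0 < B"
    using assms growth_pos by (auto simp: A_def B_def entry_up_pos entry_down_pos)
  let ?e = "\<lambda>n. K * entry \<beta> (2 * (n + k)) i j"
  have lower: "A * entry \<beta> (2 * n) 0 0 \<le> ?e n" for n
  proof -
    have "entry \<beta> i i 0 * entry \<beta> (2 * n) 0 0 * entry \<beta> j 0 j \<le> entry \<beta> (i + 2 * n) i 0 * entry \<beta> j 0 j"
      by (intro mult_right_mono entry_mult_le entry_nonneg)
    also have "\<dots> \<le> entry \<beta> (i + 2 * n + j) i j" by (rule entry_mult_le)
    also have "i + 2 * n + j = 2 * (n + k)" using k by simp
    finally show ?thesis using assms(2) by (simp add: A_def mult_ac)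
  qed
  have pos: "0 < ?e n" for n
    using lower[of n] AB entry_even_pos[of n] by (simp add: less_le_trans[rotated])
  have upper: "?e n \<le> B * growth \<beta> ^ (2 * (n + k))" for n
  proof -
    have "entry \<beta> i 0 i * entry \<beta> (2 * (n + k)) i j * entry \<beta> j j 0
        \<le> entry \<beta> (i + 2 * (n + k)) 0 j * entry \<beta> j j 0"
      by (intro mult_right_mono entry_mult_le entry_nonneg)
    also have "\<dots> \<le> entry \<beta> (i + 2 * (n + k) + j) 0 0" by (rule entry_mult_le)
    also have "\<dots> \<le> growth \<beta> ^ (i + 2 * (n + k) + j)" by (rule entry_le_growth)
    also have "i + 2 * (n + k) + j = 2 * k + 2 * (n + k)" using k by simp
    finally have "entry \<beta> (2 * (n + k)) i j * (entry \<beta> i 0 i * entry \<beta> j j 0)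
        \<le> growth \<beta> ^ (2 * k) * growth \<beta> ^ (2 * (n + k))"
      by (simp only: mult_ac power_add)
    then have "entry \<beta> (2 * (n + k)) i j
        \<le> growth \<beta> ^ (2 * k) * growth \<beta> ^ (2 * (n + k)) / (entry \<beta> i 0 i * entry \<beta> j j 0)"
      using entry_up_pos[of i] entry_down_pos[of j] by (subst pos_le_divide_eq) simp_all
    then have "K * entry \<beta> (2 * (n + k)) i j
        \<le> K * (growth \<beta> ^ (2 * k) * growth \<beta> ^ (2 * (n + k)) / (entry \<beta> i 0 i * entry \<beta> j j 0))"
      using assms(2) by (intro mult_left_mono) auto
    then show ?thesis by (simp add: B_def)
  qed
  have inv0: "(\<lambda>n. a / (2 * (real n + real k))) \<longlonglongrightarrow> 0" for a :: real
    by real_asymp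
  have "(\<lambda>n. real n / (real n + real k)) \<longlonglongrightarrow> 1" by real_asymp
  then have low_lim: "(\<lambda>n. ln A / (2 * (real n + real k))
      + ln (entry \<beta> (2 * n) 0 0) / real (2 * n) * (real n / (real n + real k))) \<longlonglongrightarrow> 0 + ln (growth \<beta>) * 1"
    by (intro tendsto_intros inv0 growth_tendsto_ln)
  have up_lim: "(\<lambda>n. ln B / (2 * (real n + real k)) + ln (growth \<beta>)) \<longlonglongrightarrow> 0 + ln (growth \<beta>)"
    by (intro tendsto_intros inv0)
  have "(\<lambda>n. ln (?e n) / real (2 * (n + k))) \<longlonglongrightarrow> ln (growth \<beta>)"
  proof (rule tendsto_sandwich)
    show "\<forall>\<^sub>F n in sequentially. ln A / (2 * (real n + real k))
      + ln (entry \<beta> (2 * n) 0 0) / real (2 * n) * (real n / (real n + real k)) \<le> ln (?e n) / real (2 * (n + k))"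
      using eventually_gt_at_top[of 0]
    proof eventually_elim
      case (elim n)
      have "ln A + ln (entry \<beta> (2 * n) 0 0) = ln (A * entry \<beta> (2 * n) 0 0)"
        using AB by (simp add: ln_mult_pos entry_even_pos)
      also have "\<dots> \<le> ln (?e n)"
        using lower[of n] pos[of n] AB entry_even_pos[of n] by (subst ln_le_cancel_iff) simp_all
      finally have "(ln A + ln (entry \<beta> (2 * n) 0 0)) / real (2 * (n + k)) \<le> ln (?e n) / real (2 * (n + k))"
        by (intro divide_right_mono) auto
      then show ?case using elim by (simp add: add_divide_distrib)
    qed
    show "\<forall>\<^sub>F n in sequentially. ln (?e n) / real (2 * (n + k)) \<le> ln B / (2 * (real n + real k)) + ln (growth \<beta>)"
      using eventually_gt_at_top[of 0]
    proof eventually_elim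
      case (elim n)
      have "ln (?e n) \<le> ln (B * growth \<beta> ^ (2 * (n + k)))"
        using upper[of n] pos[of n] AB growth_pos by (subst ln_le_cancel_iff) simp_all
      also have "\<dots> = ln B + real (2 * (n + k)) * ln (growth \<beta>)"
        using AB growth_pos by (simp add: ln_mult_pos ln_realpow del: mult_Suc_right)
      finally have "ln (?e n) / real (2 * (n + k)) \<le> (ln B + real (2 * (n + k)) * ln (growth \<beta>)) / real (2 * (n + k))"
        by (intro divide_right_mono) auto
      then show ?case using elim by (simp add: add_divide_distrib)
    qed
  qed (use low_lim up_lim in simp_all)
  then have "(\<lambda>n. exp (ln (?e n) / real (2 * (n + k)))) \<longlonglongrightarrow> exp (ln (growth \<beta>))"
    by (rule tendsto_exp)
  moreover have "\<forall>\<^sub>F n in sequentially. exp (ln (?e n) / real (2 * (n + k))) = root (2 * (n + k)) (?e n)"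
    using eventually_gt_at_top[of 0]
  proof eventually_elim
    case (elim n)
    then show ?case using pos[of n]
      by (subst root_powr_inverse) (auto simp: powr_def)
  qed
  ultimately have "(\<lambda>n. root (2 * (n + k)) (?e n)) \<longlonglongrightarrow> growth \<beta>"
    using growth_pos by (simp add: filterlim_cong[OF refl refl])
  then show ?thesis by (rule LIMSEQ_offset[where k=k])
qed

text \<open>The factor sqrt (b p) trades the symmetric normalization of \<open>R\<close> for
  division by the weight of the current site. Indices drop by one, so that the bulk {1, 2, ...}
  becomes {0, 1, ...}.\<close>

lemma R_pow_conj:
  fixes b :: "nat \<Rightarrow> real"
  assumes b: "\<And>n. n \<ge> 1 \<Longrightarrow> b n > 0" and v: "\<And>p. p \<ge> 1 \<Longrightarrow> v p = sqrt (b p) * x (p - 1)" and "p \<ge> 1"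
  shows "(R b ^^ n) v p = sqrt (b p) * (jac (\<lambda>p. b (Suc p)) ^^ n) x (p - 1)"
  using \<open>p \<ge> 1\<close>
proof (induction n arbitrary: p)
  case 0
  then show ?case by (simp add: v)
next
  case (Suc n)
  let ?y = "(jac (\<lambda>p. b (Suc p)) ^^ n) x"
  obtain q where q: "p = Suc q" using Suc.prems by (cases p) auto
  have 1: "(R b ^^ n) v (Suc p) = sqrt (b (Suc p)) * ?y p" using Suc.IH[of "Suc p"] by simp
  have 2: "q \<noteq> 0 \<Longrightarrow> (R b ^^ n) v q = sqrt (b q) * ?y (q - 1)" using Suc.IH[of q] by simp
  have bp: "0 < b p" "0 < b (Suc p)" "q \<noteq> 0 \<Longrightarrow> 0 < b q" using b Suc.prems by auto
  have A: "sqrt (b (Suc p)) * ?y p / (2 * sqrt (b p * b (Suc p))) = sqrt (b p) * (?y p / (2 * b p))"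
    using bp by (simp add: real_sqrt_mult field_simps)
  have B: "sqrt (b q) * ?y (q - 1) / (2 * sqrt (b p * b q)) = sqrt (b p) * (?y (q - 1) / (2 * b p))" if "q \<noteq> 0"
    using bp(1) bp(3)[OF that] by (simp add: real_sqrt_mult field_simps)
  have "(R b ^^ Suc n) v p = (R b ^^ n) v (p + 1) / (2 * sqrt (b p * b (p + 1))) +
     (if p > 1 then (R b ^^ n) v (p - 1) / (2 * sqrt (b p * b (p - 1))) else 0)"
    by (simp add: R_def)
  also have "\<dots> = sqrt (b p) * (?y p / (2 * b p)) + (if q = 0 then 0 else sqrt (b p) * (?y (q - 1) / (2 * b p)))"
    using 1 2 A B by (cases "q = 0") (simp_all add: q)
  also have "\<dots> = sqrt (b p) * (jac (\<lambda>p. b (Suc p)) ^^ Suc n) x (p - 1)"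
    by (simp add: q jac_def add_divide_distrib distrib_left)
  finally show ?case .
qed

lemma R_entry_eq:
  fixes b :: "nat \<Rightarrow> real"
  assumes b: "\<And>n. n \<ge> 1 \<Longrightarrow> b n > 0" and "i \<ge> 1" "j \<ge> 1"
  shows "R_entry b n i j = sqrt (b i) / sqrt (b j) * entry (\<lambda>p. b (Suc p)) n (i - 1) (j - 1)"
proof -
  have "R_entry b n i j = sqrt (b i) *
      (jac (\<lambda>p. b (Suc p)) ^^ n) (\<lambda>q. 1 / sqrt (b j) * of_bool (q = j - 1)) (i - 1)"
    unfolding R_entry_def using b[OF \<open>j \<ge> 1\<close>] assms(2,3) by (intro R_pow_conj b) (auto simp: of_bool_def)
  also have "\<dots> = sqrt (b i) * (1 / sqrt (b j) * entry (\<lambda>p. b (Suc p)) n (i - 1) (j - 1))"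
    unfolding entry_def by (subst jac_pow_scale) (rule refl)
  finally show ?thesis by simp
qed

text \<open>The weight at an added site left of 0 that makes \<rho> an eigenvalue. An eigenfunction
  equal to G in the bulk must take the value 2 \<beta>_0 at the added site in order to feed in a
  unit source; the eigenvalue equation there then reads \<rho> (2 \<beta>_0) = G(0) / (2
  b_0).\<close>

definition pinning :: "(nat \<Rightarrow> real) \<Rightarrow> real \<Rightarrow> real" where
  "pinning \<beta> \<rho> = green \<beta> \<rho> 0 / (4 * \<beta> 0 * \<rho>)"

context weights
begin

lemma pinning_antimono:
  assumes tr: "transient \<beta> \<rho>" and "\<rho> \<le> \<rho>'"
  shows "pinning \<beta> \<rho>' \<le> pinning \<beta> \<rho>"
proof -
  have \<rho>: "0 < \<rho>" and s: "summable (\<lambda>n. entry \<beta> n 0 0 / \<rho> ^ n)"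
    using tr by (auto simp: transient_def)
  have "summable (\<lambda>n. entry \<beta> n 0 0 / \<rho>' ^ n)"
    by (rule summable_comparison_test'[OF s, of 0])
       (use \<rho> assms(2) in \<open>auto simp: entry_nonneg intro!: divide_left_mono power_mono\<close>)
  then have tr': "transient \<beta> \<rho>'" using \<rho> assms(2) by (simp add: transient_def)
  have "green \<beta> \<rho>' 0 \<le> green \<beta> \<rho> 0"
    unfolding green_def
    by (intro suminf_le green_summable tr tr' divide_left_mono power_mono)
       (use \<rho> assms(2) in \<open>auto simp: entry_nonneg\<close>)
  then show ?thesis unfolding pinning_def
    using \<rho> assms(2) pos[of 0] green_pos[OF tr, of 0] by (intro frac_le) auto
qed

lemma pinning_pos:
  assumes tr: "transient \<beta> \<rho>"
  shows "0 < pinning \<beta> \<rho>"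
  using tr pos[of 0] green_pos[OF tr, of 0] by (simp add: pinning_def transient_def)

end

locale bulk_weights =
  fixes b :: "nat \<Rightarrow> real" and c :: real
  assumes lower_pos: "0 < c" and lower_le: "\<And>p. p \<ge> 1 \<Longrightarrow> c \<le> b p"
begin

abbreviation "\<beta> \<equiv> \<lambda>p. b (Suc p)"

sublocale weights \<beta> c
  using lower_pos lower_le by unfold_locales auto

lemma b_pos: "p \<ge> 1 \<Longrightarrow> 0 < b p"
  using lower_pos lower_le[of p] by simp

lemma rho_star_eq: "rho_star b = growth \<beta>"
proof -
  have lim: "(\<lambda>n. root (2 * n) (R_entry b (2 * n) i j)) \<longlonglongrightarrow> growth \<beta>"
    if "i \<ge> 1" "j \<ge> 1" "even (int i - int j)" for i j
  proof -
    have "even (i - 1 + (j - 1))"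
    proof -
      have "int (i - 1 + (j - 1)) = int i - int j + 2 * (int j - 1)" using that by simp
      then have "even (int (i - 1 + (j - 1)))" using that by simp
      then show ?thesis by (simp only: even_of_nat)
    qed
    then have "(\<lambda>n. root (2 * n) (sqrt (b i) / sqrt (b j) * entry \<beta> (2 * n) (i - 1) (j - 1)))
        \<longlonglongrightarrow> growth \<beta>"
      using that b_pos by (intro entry_root_tendsto) auto
    then show ?thesis using R_entry_eq[of b i j] b_pos that by simp
  qed
  show ?thesis unfolding rho_star_def
  proof (rule the_equality)
    fix \<rho> assume "\<forall>i\<ge>1. \<forall>j\<ge>1. even (int i - int j) \<longrightarrow>
        (\<lambda>n. root (2 * n) (R_entry b (2 * n) i j)) \<longlonglongrightarrow> \<rho>"
    then have "(\<lambda>n. root (2 * n) (R_entry b (2 * n) 1 1)) \<longlonglongrightarrow> \<rho>" by simp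
    then show "\<rho> = growth \<beta>" using lim[of 1 1] by (intro LIMSEQ_unique) auto
  qed (use lim in blast)
qed

text \<open>The conjugated Green function is one of the competitors in the infimum, and its
  minimality bounds all others from below. The factor 1 / sqrt (b 1) matches the sources on the two
  sides of the conjugation.\<close>

lemma w1_eq:
  assumes tr: "transient \<beta> \<rho>"
  shows "w1 b \<rho> = ereal (green \<beta> \<rho> 0)"
proof (rule antisym)
  have b1: "0 < b 1" using b_pos by simp
  define v where "v p = sqrt (b p) * (1 / sqrt (b 1) * green \<beta> \<rho> (p - 1))" for p
  have "R b v p = \<rho> * v p - of_bool (p = 1)" if "p \<ge> 1" for p
  proof -
    have "R b v p = sqrt (b p) * jac \<beta> (\<lambda>q. 1 / sqrt (b 1) * green \<beta> \<rho> q) (p - 1)"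
      using R_pow_conj[of b v "\<lambda>q. 1 / sqrt (b 1) * green \<beta> \<rho> q" p 1] b_pos that by (simp add: v_def)
    also have "jac \<beta> (\<lambda>q. 1 / sqrt (b 1) * green \<beta> \<rho> q) (p - 1)
        = 1 / sqrt (b 1) * (\<rho> * green \<beta> \<rho> (p - 1) - of_bool (p - 1 = 0))"
      using jac_pow_scale[of 1 \<beta> "1 / sqrt (b 1)" "green \<beta> \<rho>" "p - 1"] by (simp add: green_eq[OF tr])
    finally have R: "R b v p = sqrt (b p) * (1 / sqrt (b 1) * (\<rho> * green \<beta> \<rho> (p - 1) - of_bool (p - 1 = 0)))" .
    show ?thesis
    proof (cases "p = 1")
      case True
      then show ?thesis unfolding R using b1 by (simp add: v_def)
    next
      case False
      then have "p - 1 \<noteq> 0" using that by simp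
      then show ?thesis unfolding R using False by (simp add: v_def)
    qed
  qed
  moreover have "v p > 0" if "p \<ge> 1" for p
    using that b_pos[OF that] b1 green_pos[OF tr] by (simp add: v_def)
  moreover have "green \<beta> \<rho> 0 = v 1" using b1 by (simp add: v_def)
  ultimately show "w1 b \<rho> \<le> ereal (green \<beta> \<rho> 0)"
    unfolding w1_def by (intro Inf_lower) blast
  show "ereal (green \<beta> \<rho> 0) \<le> w1 b \<rho>"
    unfolding w1_def
  proof (rule Inf_greatest, clarify)
    fix v :: "nat \<Rightarrow> real"
    assume v: "\<forall>p\<ge>1. v p > 0" and eq: "\<forall>p\<ge>1. R b v p = \<rho> * v p - of_bool (p = 1)"
    define x where "x q = v (Suc q) / sqrt (b (Suc q))" for q
    have vx: "v p = sqrt (b p) * x (p - 1)" if "p \<ge> 1" for p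
      using that b_pos[OF that] by (simp add: x_def)
    have "jac \<beta> x q + 1 / sqrt (b 1) * of_bool (q = 0) \<le> \<rho> * x q" for q
    proof -
      have "sqrt (b (Suc q)) * jac \<beta> x q = \<rho> * (sqrt (b (Suc q)) * x q) - of_bool (q = 0)"
        using R_pow_conj[of b v x "Suc q" 1] b_pos vx eq by simp
      moreover have "0 < sqrt (b (Suc q))" using b_pos by simp
      ultimately show ?thesis by (cases "q = 0") (auto simp: field_simps)
    qed
    moreover have "0 \<le> x q" for q using v b_pos[of "Suc q"] by (simp add: x_def less_imp_le)
    ultimately have "1 / sqrt (b 1) * green \<beta> \<rho> 0 \<le> x 0"
      using b1 tr by (intro transient_if_strict_super(2)) (auto simp: transient_def)
    then have "green \<beta> \<rho> 0 \<le> v 1" using b1 vx[of 1] by (simp add: field_simps)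
    then show "ereal (green \<beta> \<rho> 0) \<le> ereal (v 1)" by simp
  qed
qed

text \<open>\<open>pinning\<close> decreases in \<rho>, so its right limit at the growth rate is a
  supremum. This also shows that the limit in the definition exists in the extended reals.\<close>

lemma b0_crit_eq: "b0_crit b = (SUP \<rho>\<in>{growth \<beta><..}. ereal (pinning \<beta> \<rho>))" (is "_ = ?S")
proof -
  have "((\<lambda>\<rho>. ereal (pinning \<beta> \<rho>)) \<longlongrightarrow> ?S) (at_right (growth \<beta>))"
  proof (rule order_tendstoI)
    fix a assume "a < ?S"
    then obtain \<rho>1 where \<rho>1: "growth \<beta> < \<rho>1" "a < ereal (pinning \<beta> \<rho>1)"
      by (auto simp: less_SUP_iff)
    show "\<forall>\<^sub>F \<rho> in at_right (growth \<beta>). a < ereal (pinning \<beta> \<rho>)"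
      unfolding eventually_at_right_field
    proof (intro exI[of _ \<rho>1] conjI allI impI \<rho>1(1))
      fix \<rho> assume "growth \<beta> < \<rho>" "\<rho> < \<rho>1"
      then have "pinning \<beta> \<rho>1 \<le> pinning \<beta> \<rho>"
        by (intro pinning_antimono transient_above_growth) auto
      then show "a < ereal (pinning \<beta> \<rho>)"
        using \<rho>1(2) by (metis ereal_less_eq(3) less_le_trans)
    qed
  next
    fix a assume a: "?S < a"
    show "\<forall>\<^sub>F \<rho> in at_right (growth \<beta>). ereal (pinning \<beta> \<rho>) < a"
      unfolding eventually_at_right_field
    proof (intro exI[of _ "growth \<beta> + 1"] conjI allI impI)
      fix \<rho> assume "growth \<beta> < \<rho>"
      then have "ereal (pinning \<beta> \<rho>) \<le> ?S" by (intro SUP_upper) auto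
      then show "ereal (pinning \<beta> \<rho>) < a" using a by simp
    qed simp
  qed
  moreover have "\<forall>\<^sub>F \<rho> in at_right (growth \<beta>).
      ereal (pinning \<beta> \<rho>) = w1 b \<rho> / ereal (4 * b 1 * \<rho>)"
    unfolding eventually_at_right_field
  proof (intro exI[of _ "growth \<beta> + 1"] conjI allI impI)
    fix \<rho> assume "growth \<beta> < \<rho>"
    then have tr: "transient \<beta> \<rho>" by (rule transient_above_growth)
    then show "ereal (pinning \<beta> \<rho>) = w1 b \<rho> / ereal (4 * b 1 * \<rho>)"
      using b_pos[of 1] by (simp add: w1_eq pinning_def transient_def)
  qed simp
  ultimately have "((\<lambda>\<rho>. w1 b \<rho> / ereal (4 * b 1 * \<rho>)) \<longlongrightarrow> ?S) (at_right (growth \<beta>))"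
    by (rule Lim_transform_eventually)
  then show ?thesis unfolding b0_crit_def rho_star_eq
    by (intro tendsto_Lim) simp_all
qed

lemma pinned_weights: "0 < s \<Longrightarrow> weights (b(0 := s)) (min s c)"
  using lower_pos lower_le by unfold_locales (auto simp: min_le_iff_disj)

text \<open>Restricting the pinned Green function to the bulk drops a nonnegative contribution from
  the origin, hence leaves a positive supersolution at every rate above the pinned growth
  rate.\<close>

lemma growth_le_pinned:
  assumes "0 < s"
  shows "growth \<beta> \<le> growth (b(0 := s))"
proof (rule dense_ge)
  interpret P: weights "b(0 := s)" "min s c" using assms by (rule pinned_weights)
  fix \<rho> assume "growth (b(0 := s)) < \<rho>"
  then have tr: "transient (b(0 := s)) \<rho>" by (rule P.transient_above_growth)
  let ?g = "green (b(0 := s)) \<rho>"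
  show "growth \<beta> \<le> \<rho>"
  proof (rule growth_le_super)
    show "0 < \<rho>" using tr by (simp add: transient_def)
    show "0 < ?g (Suc p)" for p by (rule P.green_pos[OF tr])
    show "jac \<beta> (\<lambda>p. ?g (Suc p)) p \<le> \<rho> * ?g (Suc p)" for p
    proof -
      have "jac \<beta> (\<lambda>p. ?g (Suc p)) p \<le> jac (b(0 := s)) ?g (Suc p)"
        unfolding jac_def using b_pos[of "Suc p"] P.green_pos[OF tr, of 0]
        by (cases p) (auto intro!: divide_right_mono)
      then show ?thesis by (simp add: P.green_eq[OF tr])
    qed
  qed
qed

text \<open>In the bulk, the pinned Green function g solves the equation with source g(0) / (2 b_1)
  at the first site, so minimality gives g(0) / (2 b_1) G \<le> g(1). The equation at the origin
  turns g(1) into 2 s (\<rho> g(0) - 1), and its unit source makes the inequality strict.\<close>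

lemma pinning_less:
  assumes "0 < s" "growth (b(0 := s)) < \<rho>"
  shows "pinning \<beta> \<rho> < s"
proof -
  interpret P: weights "b(0 := s)" "min s c" using assms(1) by (rule pinned_weights)
  have tr: "transient (b(0 := s)) \<rho>" using assms(2) by (rule P.transient_above_growth)
  then have \<rho>: "0 < \<rho>" by (simp add: transient_def)
  let ?g = "green (b(0 := s)) \<rho>"
  have "jac \<beta> (\<lambda>p. ?g (Suc p)) p + ?g 0 / (2 * b 1) * of_bool (p = 0) \<le> \<rho> * ?g (Suc p)" for p
  proof -
    have "jac \<beta> (\<lambda>p. ?g (Suc p)) p + ?g 0 / (2 * b 1) * of_bool (p = 0) = jac (b(0 := s)) ?g (Suc p)"
      unfolding jac_def by (cases p) (auto simp: add_divide_distrib)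
    then show ?thesis by (simp add: P.green_eq[OF tr])
  qed
  then have "?g 0 / (2 * b 1) * green \<beta> \<rho> 0 \<le> ?g (Suc 0)"
    using \<rho> P.green_pos[OF tr] b_pos[of 1]
    by (intro transient_if_strict_super(2)[where x = "\<lambda>p. ?g (Suc p)"]) (auto intro: less_imp_le)
  also have "?g (Suc 0) = 2 * s * (\<rho> * ?g 0 - 1)"
    using P.green_eq[OF tr, of 0] assms(1) by (simp add: jac_def field_simps)
  also have "\<dots> < 2 * s * (\<rho> * ?g 0)" using assms(1) by simp
  finally have "?g 0 * (green \<beta> \<rho> 0 / (2 * b 1)) < ?g 0 * (2 * s * \<rho>)" by (simp add: mult_ac)
  then have "green \<beta> \<rho> 0 / (2 * b 1) < 2 * s * \<rho>"
    using P.green_pos[OF tr, of 0] by (simp only: mult_less_cancel_left_pos)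
  then show ?thesis using \<rho> b_pos[of 1] by (simp add: pinning_def field_simps)
qed

text \<open>The bulk Green function extends to a positive function that satisfies the eigenvalue
  equation at all bulk sites; at the origin, being a supersolution is exactly
  \<open>pinning \<beta> \<rho> \<le> s\<close>.\<close>

lemma growth_pinned_le:
  assumes tr: "transient \<beta> \<rho>" and le: "pinning \<beta> \<rho> \<le> s"
  shows "growth (b(0 := s)) \<le> \<rho>"
proof -
  have s: "0 < s" using pinning_pos[OF tr] le by simp
  interpret P: weights "b(0 := s)" "min s c" using s by (rule pinned_weights)
  have \<rho>: "0 < \<rho>" using tr by (simp add: transient_def)
  \<comment> \<open>The value 2 b_1 at the origin contributes exactly 1 at the first bulk site and
    so cancels the source of the Green function.\<close>
  define y where "y p = (if p = 0 then 2 * b 1 else green \<beta> \<rho> (p - 1))" for p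
  show ?thesis
  proof (rule P.growth_le_super[OF \<rho>, of y])
    show "0 < y p" for p using b_pos[of 1] green_pos[OF tr] by (simp add: y_def)
    show "jac (b(0 := s)) y p \<le> \<rho> * y p" for p
    proof (cases p)
      case 0
      then show ?thesis using le s \<rho> b_pos[of 1]
        by (simp add: jac_def y_def pinning_def field_simps)
    next
      case (Suc q)
      have "jac (b(0 := s)) y p = jac \<beta> (green \<beta> \<rho>) q + of_bool (q = 0)"
        using b_pos[of 1] by (cases q) (auto simp: Suc jac_def y_def add_divide_distrib)
      then show ?thesis by (simp add: green_eq[OF tr] Suc y_def)
    qed
  qed
qed

lemma growth_pinned_eq:
  assumes "growth \<beta> < \<rho>"
  shows "growth (b(0 := pinning \<beta> \<rho>)) = \<rho>"
proof (rule antisym)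
  have tr: "transient \<beta> \<rho>" using assms by (rule transient_above_growth)
  show "growth (b(0 := pinning \<beta> \<rho>)) \<le> \<rho>" by (rule growth_pinned_le[OF tr]) simp
  show "\<rho> \<le> growth (b(0 := pinning \<beta> \<rho>))"
    using pinning_less[OF pinning_pos[OF tr], of \<rho>] by fastforce
qed

lemma growth_unpinned_eq:
  assumes "0 < s" "b0_crit b \<le> ereal s"
  shows "growth (b(0 := s)) = growth \<beta>"
proof (rule antisym)
  show "growth \<beta> \<le> growth (b(0 := s))" using assms(1) by (rule growth_le_pinned)
  show "growth (b(0 := s)) \<le> growth \<beta>"
  proof (rule dense_ge)
    fix \<rho> assume \<rho>: "growth \<beta> < \<rho>"
    then have "ereal (pinning \<beta> \<rho>) \<le> b0_crit b"
      unfolding b0_crit_eq by (intro SUP_upper) auto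
    then have "pinning \<beta> \<rho> \<le> s" using assms(2) by (metis ereal_less_eq(3) order_trans)
    then show "growth (b(0 := s)) \<le> \<rho>"
      using \<rho> by (intro growth_pinned_le transient_above_growth)
  qed
qed

end

section \<open>Partition functions and free energy\<close>

text \<open>Jensen's inequality: the exponential lies above its tangent at h times the mean m of k.
  It says that the logarithmic moment generating function lies above its tangent at 0, for h of
  either sign.\<close>

lemma tilted_weight_ratio:
  fixes W k :: "'a \<Rightarrow> real"
  assumes "finite S" "S \<noteq> {}" "\<And>X. X \<in> S \<Longrightarrow> 0 < W X"
  shows "h * ((\<Sum>X\<in>S. W X * k X) / (\<Sum>X\<in>S. W X))
    \<le> ln (\<Sum>X\<in>S. W X * exp (h * k X)) - ln (\<Sum>X\<in>S. W X)"
proof -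
  define Q where "Q = (\<Sum>X\<in>S. W X)"
  define m where "m = (\<Sum>X\<in>S. W X * k X) / Q"
  have Q: "0 < Q" unfolding Q_def using assms by (intro sum_pos) auto
  have "exp (h * m) * Q = (\<Sum>X\<in>S. W X * (exp (h * m) * (1 + h * (k X - m))))"
  proof -
    have "(\<Sum>X\<in>S. W X * (exp (h * m) * (1 + h * (k X - m))))
        = exp (h * m) * ((\<Sum>X\<in>S. W X) + h * ((\<Sum>X\<in>S. W X * k X) - m * (\<Sum>X\<in>S. W X)))"
      by (simp add: sum_distrib_left sum_distrib_right sum.distrib sum_subtractf algebra_simps)
    also have "(\<Sum>X\<in>S. W X * k X) - m * (\<Sum>X\<in>S. W X) = 0"
      using Q by (simp add: m_def flip: Q_def)
    finally show ?thesis by (simp add: Q_def)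
  qed
  also have "\<dots> \<le> (\<Sum>X\<in>S. W X * exp (h * k X))"
  proof (intro sum_mono mult_left_mono)
    fix X assume "X \<in> S"
    then show "0 \<le> W X" using assms(3)[of X] by simp
    have "exp (h * m) * (1 + h * (k X - m)) \<le> exp (h * m) * exp (h * (k X - m))"
      by (intro mult_left_mono exp_ge_add_one_self) auto
    then show "exp (h * m) * (1 + h * (k X - m)) \<le> exp (h * k X)"
      by (simp add: algebra_simps flip: exp_add)
  qed
  finally have le: "exp (h * m) * Q \<le> (\<Sum>X\<in>S. W X * exp (h * k X))" .
  have "h * m + ln Q = ln (exp (h * m) * Q)" using Q by (simp add: ln_mult_pos)
  also have "\<dots> \<le> ln (\<Sum>X\<in>S. W X * exp (h * k X))"
    using le Q less_le_trans[OF _ le, of 0] by (subst ln_le_cancel_iff) simp_all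
  finally show ?thesis by (simp add: m_def Q_def)
qed

text \<open>Griffiths' argument: the secant bound transfers the limit of the free energies to that of
  their derivatives, without any convergence assumption on the latter.\<close>
lemma tendsto_secant_derivative:
  fixes F :: "nat \<Rightarrow> real \<Rightarrow> real" and f :: "real \<Rightarrow> real"
  assumes lim: "\<And>h. (\<lambda>N. F N (t + h)) \<longlonglongrightarrow> f (t + h)"
    and secant: "\<And>N h. h * D N \<le> F N (t + h) - F N t"
    and deriv: "(f has_real_derivative f') (at t)"
  shows "D \<longlonglongrightarrow> f'"
proof -
  have q: "((\<lambda>h. (f (t + h) - f t) / h) \<longlongrightarrow> f') (at 0)"
    using deriv by (simp add: DERIV_def)
  have Fq: "(\<lambda>N. (F N (t + h) - F N t) / h) \<longlonglongrightarrow> (f (t + h) - f t) / h" if "h \<noteq> 0" for h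
    using lim[of h] lim[of 0] that by (intro tendsto_intros) auto
  show ?thesis
  proof (rule order_tendstoI)
    fix a assume "f' < a"
    then have "\<forall>\<^sub>F h in at_right 0. (f (t + h) - f t) / h < a"
      using q by (intro order_tendstoD(2)) (auto intro: tendsto_within_subset)
    then have "\<forall>\<^sub>F h in at_right (0::real). 0 < h \<and> (f (t + h) - f t) / h < a"
      by (intro eventually_conj) (auto simp: eventually_at_filter)
    then obtain h where h: "0 < h" "(f (t + h) - f t) / h < a"
      using eventually_happens' trivial_limit_at_right_real by blast
    then have "\<forall>\<^sub>F N in sequentially. (F N (t + h) - F N t) / h < a"
      using Fq[of h] by (intro order_tendstoD(2)) auto
    then show "\<forall>\<^sub>F N in sequentially. D N < a"
    proof (rule eventually_mono)
      fix N assume "(F N (t + h) - F N t) / h < a"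
      moreover have "D N \<le> (F N (t + h) - F N t) / h"
        using secant[of h N] h(1) by (simp add: field_simps)
      ultimately show "D N < a" by simp
    qed
  next
    fix a assume "a < f'"
    then have "\<forall>\<^sub>F h in at_left 0. a < (f (t + h) - f t) / h"
      using q by (intro order_tendstoD(1)) (auto intro: tendsto_within_subset)
    then have "\<forall>\<^sub>F h in at_left (0::real). h < 0 \<and> a < (f (t + h) - f t) / h"
      by (intro eventually_conj) (auto simp: eventually_at_filter)
    then obtain h where h: "h < 0" "a < (f (t + h) - f t) / h"
      using eventually_happens' trivial_limit_at_left_real by blast
    then have "\<forall>\<^sub>F N in sequentially. a < (F N (t + h) - F N t) / h"
      using Fq[of h] by (intro order_tendstoD(1)) auto
    then show "\<forall>\<^sub>F N in sequentially. a < D N"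
    proof (rule eventually_mono)
      fix N assume "a < (F N (t + h) - F N t) / h"
      moreover have "(F N (t + h) - F N t) / h \<le> D N"
        using secant[of h N] h(1) by (simp add: field_simps)
      ultimately show "a < D N" by simp
    qed
  qed
qed

text \<open>Induction on the last step. The power of the operator collects one site factor per step,
  starting from the endpoint, while the configuration has N + 1 sites; the factor of X_0 = 0 is the
  missing 1 / b_0.\<close>

lemma SOS_endpoint_weight:
  "(\<Sum>X | X \<in> SOS_paths N \<and> X ! N = j. SOS_weight b N X) = entry b N j 0 / b 0"
proof (induction N arbitrary: j)
  case 0
  have "{X \<in> SOS_paths 0. X ! 0 = j} = (if j = 0 then {[0]} else {})"
    by (auto simp: SOS_paths_def length_Suc_conv)
  then show ?case by (simp add: SOS_weight_def entry_0 divide_inverse)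
next
  case (Suc N)
  let ?A = "{Y \<in> SOS_paths N. \<bar>int (Y ! N) - int j\<bar> = 1}"
  let ?E = "\<lambda>i. {Y \<in> SOS_paths N. Y ! N = i}"
  have set: "{X \<in> SOS_paths (Suc N). X ! Suc N = j} = (\<lambda>Y. Y @ [j]) ` ?A" (is "?L = ?R")
  proof (intro equalityI subsetI)
    fix X assume "X \<in> ?L"
    then have len: "length X = Suc (Suc N)" and X0: "X ! 0 = 0" and Xj: "X ! Suc N = j"
      and st: "\<And>i. i < Suc N \<Longrightarrow> \<bar>int (X ! Suc i) - int (X ! i)\<bar> = 1"
      by (auto simp: SOS_paths_def)
    have "X = butlast X @ [last X]" using len by (intro append_butlast_last_id[symmetric]) auto
    moreover have "last X = j" using len Xj by (subst last_conv_nth) auto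
    ultimately have "X = butlast X @ [j]" by simp
    moreover have "butlast X \<in> ?A"
      using len X0 st Xj by (auto simp: SOS_paths_def nth_butlast abs_minus_commute)
    ultimately show "X \<in> ?R" by blast
  next
    fix X assume "X \<in> ?R"
    then show "X \<in> ?L"
      by (auto simp: SOS_paths_def nth_append less_Suc_eq abs_minus_commute)
  qed
  have inj: "inj_on (\<lambda>Y. Y @ [j]) ?A" by (auto simp: inj_on_def)
  have weight: "SOS_weight b (Suc N) (Y @ [j]) = SOS_weight b N Y / (2 * b j)" if "Y \<in> ?A" for Y
  proof -
    have len: "length Y = Suc N" using that by (auto simp: SOS_paths_def)
    have "(\<Prod>n = 0..Suc N. inverse (b ((Y @ [j]) ! n))) = (\<Prod>n = 0..N. inverse (b (Y ! n))) * inverse (b j)"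
    proof -
      have last: "(Y @ [j]) ! Suc N = j" by (metis len nth_append_length)
      have "(\<Prod>n = 0..N. inverse (b ((Y @ [j]) ! n))) = (\<Prod>n = 0..N. inverse (b (Y ! n)))"
      proof (rule prod.cong)
        fix n assume "n \<in> {0..N}"
        then have "n < length Y" using len by simp
        then show "inverse (b ((Y @ [j]) ! n)) = inverse (b (Y ! n))" by (simp only: nth_append if_True)
      qed (rule refl)
      then show ?thesis by (simp only: prod.atLeast0_atMost_Suc last)
    qed
    moreover have "1 / 2 ^ Suc N * (P * inverse B) = 1 / 2 ^ N * P / (2 * B)" for P B :: real
      by (cases "B = 0") (simp_all add: field_simps)
    ultimately show ?thesis by (simp only: SOS_weight_def)
  qed
  have "(\<Sum>X | X \<in> SOS_paths (Suc N) \<and> X ! Suc N = j. SOS_weight b (Suc N) X)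
      = (\<Sum>Y\<in>?A. SOS_weight b N Y / (2 * b j))"
    unfolding set by (subst sum.reindex[OF inj]) (auto intro!: sum.cong weight)
  also have "\<dots> = (\<Sum>Y\<in>?A. SOS_weight b N Y) / (2 * b j)" by (simp add: sum_divide_distrib)
  also have "(\<Sum>Y\<in>?A. SOS_weight b N Y)
      = entry b N (Suc j) 0 / b 0 + (if j = 0 then 0 else entry b N (j - 1) 0 / b 0)"
  proof (cases "j = 0")
    case True
    then have "?A = ?E (Suc j)" by auto
    then show ?thesis using True by (simp add: Suc.IH)
  next
    case False
    then have "?A = ?E (Suc j) \<union> ?E (j - 1)" by auto
    moreover have "?E (Suc j) \<inter> ?E (j - 1) = {}" using False by auto
    ultimately have "(\<Sum>Y\<in>?A. SOS_weight b N Y)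
        = (\<Sum>Y\<in>?E (Suc j). SOS_weight b N Y) + (\<Sum>Y\<in>?E (j - 1). SOS_weight b N Y)"
      by (simp add: sum.union_disjoint finite_SOS_paths)
    then show ?thesis using False by (simp add: Suc.IH)
  qed
  finally show ?case by (simp add: entry_Suc jac_def add_divide_distrib mult.commute)
qed

lemma SOS_Z_eq: "SOS_Z b N = (\<Sum>j\<le>N. entry b N j 0 / b 0)"
proof -
  have "SOS_Z b N = (\<Sum>j\<le>N. \<Sum>X | X \<in> SOS_paths N \<and> X ! N = j. SOS_weight b N X)"
    unfolding SOS_Z_def
    by (subst sum.group[where g = "\<lambda>X. X ! N" and T = "{..N}"])
       (auto simp: finite_SOS_paths SOS_paths_le)
  then show ?thesis by (simp add: SOS_endpoint_weight)
qed

context weights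
begin

lemma ln_bridge_partition:
  "(\<lambda>N. ln (\<Sum>X | X \<in> SOS_paths (2 * N) \<and> X ! (2 * N) = 0. SOS_weight \<beta> (2 * N) X) / real (2 * N))
    \<longlonglongrightarrow> ln (growth \<beta>)"
proof -
  have "(\<lambda>N. ln (\<beta> 0) / (2 * real N)) \<longlonglongrightarrow> 0" by real_asymp
  then have "(\<lambda>N. ln (entry \<beta> (2 * N) 0 0) / real (2 * N) - ln (\<beta> 0) / (2 * real N)) \<longlonglongrightarrow> ln (growth \<beta>) - 0"
    by (intro tendsto_intros growth_tendsto_ln)
  moreover have "ln (entry \<beta> (2 * N) 0 0) / real (2 * N) - ln (\<beta> 0) / (2 * real N)
      = ln (entry \<beta> (2 * N) 0 0 / \<beta> 0) / real (2 * N)" for N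
    using entry_even_pos[of N] pos[of 0] by (simp add: ln_div diff_divide_distrib)
  ultimately show ?thesis by (simp add: SOS_endpoint_weight)
qed

text \<open>Freeing the endpoint must not change the rate. Path surgery alone gives constants that
  depend on the endpoint j. Uniformity in j comes from the norm: \<beta>_j times the squared entry
  is at most \<beta>_0 times the return weight at time 2 N. The N + 1 possible endpoints then cost
  only a polynomial factor.\<close>

lemma ln_free_partition: "(\<lambda>N. ln (SOS_Z \<beta> N) / real N) \<longlonglongrightarrow> ln (growth \<beta>)"
proof -
  have nn: "0 \<le> entry \<beta> N j 0 / \<beta> 0" for N j using pos[of 0] by (simp add: entry_nonneg)
  \<comment> \<open>The lower bound uses the single endpoint N mod 2, which has the right parity;
    the minimum covers even N, with constant 1, and odd N, with one additional step.\<close>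
  define K where "K = min 1 (entry \<beta> 1 1 0) / \<beta> 0"
  have K: "0 < K" using pos[of 0] entry_down_pos[of 1] by (simp add: K_def)
  have lower: "K * entry \<beta> (2 * (N div 2)) 0 0 \<le> SOS_Z \<beta> N" for N
  proof -
    have "min 1 (entry \<beta> 1 1 0) * entry \<beta> (2 * (N div 2)) 0 0 \<le> entry \<beta> N (N mod 2) 0"
    proof (cases "even N")
      case True
      have "min 1 (entry \<beta> 1 1 0) * entry \<beta> N 0 0 \<le> 1 * entry \<beta> N 0 0"
        by (intro mult_right_mono entry_nonneg) simp
      then show ?thesis using True by simp
    next
      case False
      have "min 1 (entry \<beta> 1 1 0) * entry \<beta> (N - 1) 0 0 \<le> entry \<beta> 1 1 0 * entry \<beta> (N - 1) 0 0"
        by (intro mult_right_mono entry_nonneg) simp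
      also have "\<dots> \<le> entry \<beta> (1 + (N - 1)) 1 0" by (rule entry_mult_le)
      also have "1 + (N - 1) = N" using False by (cases N) auto
      finally show ?thesis using False by (simp add: odd_iff_mod_2_eq_one flip: minus_mod_eq_mult_div)
    qed
    then have "min 1 (entry \<beta> 1 1 0) * entry \<beta> (2 * (N div 2)) 0 0 / \<beta> 0 \<le> entry \<beta> N (N mod 2) 0 / \<beta> 0"
      using pos[of 0] by (intro divide_right_mono) auto
    also have "\<dots> \<le> (\<Sum>j\<le>N. entry \<beta> N j 0 / \<beta> 0)"
      by (intro member_le_sum) (auto simp: nn)
    finally show ?thesis by (simp add: K_def SOS_Z_eq)
  qed
  define B where "B = sqrt (\<beta> 0 / c) / \<beta> 0"
  have B: "0 < B" using c_pos pos[of 0] by (simp add: B_def)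
  have upper: "SOS_Z \<beta> N \<le> real (Suc N) * B * growth \<beta> ^ N" for N
  proof -
    have "entry \<beta> N j 0 / \<beta> 0 \<le> B * growth \<beta> ^ N" for j
    proof -
      have "entry \<beta> N j 0 \<le> sqrt (\<beta> 0 / c) * growth \<beta> ^ N"
      proof (cases "j \<le> 2 * N")
        case True
        have "\<beta> j * (entry \<beta> N j 0)\<^sup>2 \<le> (\<Sum>p\<le>2 * N. \<beta> p * entry \<beta> N p 0 * entry \<beta> N p 0)"
          using True pos
          by (subst power2_eq_square, subst mult.assoc[symmetric])
             (intro member_le_sum, auto intro!: mult_nonneg_nonneg entry_nonneg simp: less_imp_le)
        also have "\<dots> = \<beta> 0 * entry \<beta> (N + N) 0 0" by (intro entry_inner_product) simp
        also have "\<dots> \<le> \<beta> 0 * growth \<beta> ^ (N + N)"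
          using pos[of 0] by (intro mult_left_mono entry_le_growth) simp
        finally have le: "\<beta> j * (entry \<beta> N j 0)\<^sup>2 \<le> \<beta> 0 * growth \<beta> ^ (N + N)" .
        have "c * (entry \<beta> N j 0)\<^sup>2 \<le> \<beta> j * (entry \<beta> N j 0)\<^sup>2"
          using c_le[of j] by (intro mult_right_mono) auto
        then have "(entry \<beta> N j 0)\<^sup>2 \<le> \<beta> 0 / c * (growth \<beta> ^ N)\<^sup>2"
          using le c_pos by (simp add: field_simps power_add power2_eq_square)
        also have "\<dots> = (sqrt (\<beta> 0 / c) * growth \<beta> ^ N)\<^sup>2"
          using c_pos pos[of 0] by (simp add: power_mult_distrib)
        finally show ?thesis
        proof (rule power2_le_imp_le)
          show "0 \<le> sqrt (\<beta> 0 / c) * growth \<beta> ^ N"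
            using c_pos less_imp_le[OF pos[of 0]] growth_pos
            by (intro mult_nonneg_nonneg real_sqrt_ge_zero divide_nonneg_pos zero_le_power less_imp_le[OF growth_pos])
        qed
      next
        case False
        then show ?thesis using c_pos pos[of 0] growth_pos by (simp add: entry_eq_0_far)
      qed
      then show ?thesis using pos[of 0] by (simp add: B_def divide_right_mono)
    qed
    then have "(\<Sum>j\<le>N. entry \<beta> N j 0 / \<beta> 0) \<le> (\<Sum>j\<le>N. B * growth \<beta> ^ N)" by (intro sum_mono)
    then show ?thesis by (simp add: SOS_Z_eq)
  qed
  have Z: "0 < SOS_Z \<beta> N" for N using pos by (rule SOS_Z_pos)
  have g: "(\<lambda>n. ln (entry \<beta> (2 * (n div 2)) 0 0) / real (2 * (n div 2))) \<longlonglongrightarrow> ln (growth \<beta>)"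
    by (rule filterlim_compose[OF growth_tendsto_ln]) (simp add: filterlim_at_top_div_const_nat)
  have frac: "(\<lambda>n. real (2 * (n div 2)) / real n) \<longlonglongrightarrow> 1"
  proof (rule tendsto_sandwich[where f = "\<lambda>n. 1 - 1 / real n" and h = "\<lambda>n. 1"])
    show "\<forall>\<^sub>F n in sequentially. 1 - 1 / real n \<le> real (2 * (n div 2)) / real n"
      using eventually_gt_at_top[of 0]
    proof eventually_elim
      case (elim n)
      have "n \<le> 2 * (n div 2) + 1" by simp
      then have "real n - 1 \<le> real (2 * (n div 2))" by linarith
      then have "(real n - 1) / real n \<le> real (2 * (n div 2)) / real n"
        by (rule divide_right_mono) simp
      then show ?case using elim by (simp add: diff_divide_distrib)
    qed
    show "\<forall>\<^sub>F n in sequentially. real (2 * (n div 2)) / real n \<le> 1"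
      using eventually_gt_at_top[of 0]
    proof eventually_elim
      case (elim n)
      have "2 * (n div 2) \<le> n" by simp
      then have "real (2 * (n div 2)) \<le> real n" by linarith
      then show ?case using elim by (subst divide_le_eq_1_pos) simp_all
    qed
    show "(\<lambda>n. 1 - 1 / real n) \<longlonglongrightarrow> 1" by real_asymp
  qed simp
  have inv0: "(\<lambda>n. a / real n) \<longlonglongrightarrow> 0" for a :: real by real_asymp
  have low_lim: "(\<lambda>n. ln K / real n + ln (entry \<beta> (2 * (n div 2)) 0 0) / real (2 * (n div 2))
      * (real (2 * (n div 2)) / real n)) \<longlonglongrightarrow> 0 + ln (growth \<beta>) * 1"
    by (intro tendsto_intros g frac inv0)
  have up_lim: "(\<lambda>n. ln (real (Suc n)) / real n + ln B / real n + ln (growth \<beta>)) \<longlonglongrightarrow> 0 + 0 + ln (growth \<beta>)"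
  proof -
    have "(\<lambda>n. ln (real (Suc n)) / real n) \<longlonglongrightarrow> 0" by real_asymp
    then show ?thesis by (intro tendsto_intros inv0)
  qed
  show ?thesis
  proof (rule tendsto_sandwich)
    show "\<forall>\<^sub>F n in sequentially. ln K / real n + ln (entry \<beta> (2 * (n div 2)) 0 0) / real (2 * (n div 2))
      * (real (2 * (n div 2)) / real n) \<le> ln (SOS_Z \<beta> n) / real n"
      using eventually_ge_at_top[of 2]
    proof eventually_elim
      case (elim n)
      have "ln K + ln (entry \<beta> (2 * (n div 2)) 0 0) = ln (K * entry \<beta> (2 * (n div 2)) 0 0)"
        using K by (simp add: ln_mult_pos entry_even_pos)
      also have "\<dots> \<le> ln (SOS_Z \<beta> n)"
        using lower[of n] Z[of n] K entry_even_pos[of "n div 2"] by (subst ln_le_cancel_iff) simp_all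
      finally have "(ln K + ln (entry \<beta> (2 * (n div 2)) 0 0)) / real n \<le> ln (SOS_Z \<beta> n) / real n"
        by (intro divide_right_mono) auto
      moreover have "0 < n div 2" using elim by (simp add: div_greater_zero_iff)
      then have "real (2 * (n div 2)) \<noteq> 0" by (metis of_nat_eq_0_iff mult_eq_0_iff less_irrefl zero_neq_numeral)
      then have "ln (entry \<beta> (2 * (n div 2)) 0 0) / real (2 * (n div 2)) * (real (2 * (n div 2)) / real n)
          = ln (entry \<beta> (2 * (n div 2)) 0 0) / real n"
        by (simp only: times_divide_times_eq mult.commute[of _ "real (2 * (n div 2))"]) (simp del: of_nat_mult)
      ultimately show ?case by (simp only: add_divide_distrib)
    qed
    show "\<forall>\<^sub>F n in sequentially. ln (SOS_Z \<beta> n) / real n \<le> ln (real (Suc n)) / real n + ln B / real n + ln (growth \<beta>)"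
      using eventually_gt_at_top[of 0]
    proof eventually_elim
      case (elim n)
      have "ln (SOS_Z \<beta> n) \<le> ln (real (Suc n) * B * growth \<beta> ^ n)"
        using upper[of n] Z[of n] B growth_pos by (subst ln_le_cancel_iff) (simp_all del: of_nat_Suc)
      also have "\<dots> = ln (real (Suc n)) + ln B + real n * ln (growth \<beta>)"
        using B growth_pos by (simp add: ln_mult_pos ln_realpow del: of_nat_Suc)
      finally have "ln (SOS_Z \<beta> n) / real n \<le> (ln (real (Suc n)) + ln B + real n * ln (growth \<beta>)) / real n"
        by (intro divide_right_mono) auto
      then show ?case using elim by (simp add: add_divide_distrib)
    qed
  qed (use low_lim up_lim in simp_all)
qed

end

section \<open>Visits to the origin as the derivative of the free energy\<close>

definition zeros :: "nat \<Rightarrow> nat list \<Rightarrow> real" where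
  "zeros N X = (\<Sum>n=0..N. of_bool (X ! n = 0))"

text \<open>With b_0 = exp (- t), the parameter t is conjugate to the number of visits, so that
  moving t is an exponential tilt.\<close>

lemma SOS_weight_tilt:
  "SOS_weight (b(0 := exp (- (t + h)))) N X = SOS_weight (b(0 := exp (- t))) N X * exp (h * zeros N X)"
proof -
  have "inverse ((b(0 := exp (- (t + h)))) (X ! n))
      = inverse ((b(0 := exp (- t))) (X ! n)) * exp (h * of_bool (X ! n = 0))" for n
    by (simp add: minus_diff_commute minus_minus flip: exp_minus exp_add)
  then show ?thesis
    by (simp only: SOS_weight_def prod.distrib zeros_def sum_distrib_left exp_sum[OF finite_atLeastAtMost] mult.assoc)
qed

lemma tilt_secant:
  assumes "finite S" "S \<noteq> {}" "\<And>n. 1 \<le> n \<Longrightarrow> 0 < b n"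
  shows "h * ((\<Sum>X\<in>S. SOS_weight (b(0 := exp (- t))) N X * zeros N X) / (\<Sum>X\<in>S. SOS_weight (b(0 := exp (- t))) N X))
    \<le> ln (\<Sum>X\<in>S. SOS_weight (b(0 := exp (- (t + h)))) N X) - ln (\<Sum>X\<in>S. SOS_weight (b(0 := exp (- t))) N X)"
  unfolding SOS_weight_tilt using assms
  by (intro tilted_weight_ratio SOS_weight_pos) (auto simp: Suc_le_eq)

lemma prob_SOS:
  assumes "\<And>n. 0 < b n"
  shows "measure_pmf.prob (SOS b N) A = (\<Sum>X\<in>SOS_paths N \<inter> A. SOS_weight b N X) / SOS_Z b N"
proof -
  have "measure_pmf.prob (SOS b N) A = measure_pmf.prob (SOS b N) (SOS_paths N \<inter> A)"
    by (rule measure_prob_cong_0) (auto simp: pmf_SOS[where b=b, OF assms])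
  also have "\<dots> = (\<Sum>X\<in>SOS_paths N \<inter> A. pmf (SOS b N) X)"
    by (intro measure_measure_pmf_finite) (simp add: finite_SOS_paths)
  also have "\<dots> = (\<Sum>X\<in>SOS_paths N \<inter> A. SOS_weight b N X / SOS_Z b N)"
    by (intro sum.cong) (auto simp: pmf_SOS[where b=b, OF assms])
  finally show ?thesis by (simp add: sum_divide_distrib)
qed

lemma prob_SOS_bridge:
  fixes b :: "nat \<Rightarrow> real" and N :: nat
  assumes b: "\<And>n. 0 < b n"
  defines "S \<equiv> {X \<in> SOS_paths (2 * N). X ! (2 * N) = 0}"
  shows "measure_pmf.prob (SOS_bridge b N) A
    = (\<Sum>X\<in>S \<inter> A. SOS_weight b (2 * N) X) / (\<Sum>X\<in>S. SOS_weight b (2 * N) X)"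
proof -
  let ?p = "SOS b (2 * N)" and ?B = "{X. X ! (2 * N) = 0}"
  have Z: "0 < SOS_Z b (2 * N)" using b by (rule SOS_Z_pos)
  have ne: "measure_pmf.prob ?p ?B \<noteq> 0"
    using bridge_event_possible[where b=b and N=N, OF b] by (simp add: measure_pmf_zero_iff)
  have "measure_pmf.prob (SOS_bridge b N) A
      = measure (uniform_measure (measure_pmf ?p) ?B) A"
    unfolding SOS_bridge_def
    by (subst cond_pmf.rep_eq) (use bridge_event_possible[where b=b and N=N, OF b] in auto)
  also have "\<dots> = measure_pmf.prob ?p (?B \<inter> A) / measure_pmf.prob ?p ?B"
    using ne by (intro measure_uniform_measure) (auto simp: measure_pmf.emeasure_eq_measure)
  also have "\<dots> = (\<Sum>X\<in>S \<inter> A. SOS_weight b (2 * N) X) / (\<Sum>X\<in>S. SOS_weight b (2 * N) X)"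
  proof -
    have "SOS_paths (2 * N) \<inter> ?B = S" "SOS_paths (2 * N) \<inter> (?B \<inter> A) = S \<inter> A" by (auto simp: S_def)
    then show ?thesis using Z by (simp add: prob_SOS[where b=b, OF b])
  qed
  finally show ?thesis .
qed

lemma sum_visits:
  assumes "finite S"
  shows "(\<Sum>l=0..N. (\<Sum>X\<in>S \<inter> {X. X ! l = 0}. W X) / Q) = (\<Sum>X\<in>S. W X * zeros N X) / (Q :: real)"
proof -
  have "(\<Sum>X\<in>S \<inter> {X. X ! l = 0}. W X) = (\<Sum>X\<in>S. W X * of_bool (X ! l = 0))" for l
    by (rule sum.mono_neutral_cong_left) (use assms in auto)
  then have "(\<Sum>l=0..N. (\<Sum>X\<in>S \<inter> {X. X ! l = 0}. W X) / Q)
      = (\<Sum>l=0..N. \<Sum>X\<in>S. W X * of_bool (X ! l = 0)) / Q"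
    by (simp add: sum_divide_distrib)
  also have "\<dots> = (\<Sum>X\<in>S. \<Sum>l=0..N. W X * of_bool (X ! l = 0)) / Q"
    by (subst sum.swap) (rule refl)
  finally show ?thesis by (simp only: zeros_def sum_distrib_left)
qed

text \<open>The subtracted 1 is the visit at time 0, which \<open>zeros\<close> counts and the
  density does not.\<close>

lemma free_returns_eq:
  assumes b: "\<And>n. 0 < b n"
  shows "free_returns b N
    = ((\<Sum>X\<in>SOS_paths N. SOS_weight b N X * zeros N X) / SOS_Z b N - 1) / real N"
proof -
  have Z: "0 < SOS_Z b N" using b by (rule SOS_Z_pos)
  have "SOS_paths N \<inter> {X. X ! 0 = 0} = SOS_paths N" by (auto simp: SOS_paths_def)
  then have p0: "(\<Sum>X\<in>SOS_paths N \<inter> {X. X ! 0 = 0}. SOS_weight b N X) / SOS_Z b N = 1"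
    using Z by (simp add: SOS_Z_def)
  show ?thesis
    using sum_visits[of "SOS_paths N" "SOS_weight b N" "SOS_Z b N" N, OF finite_SOS_paths] p0
    by (simp add: free_returns_def prob_SOS[where b=b, OF b] sum.atLeast_Suc_atMost[of 0 N])
qed

text \<open>Both ends of the bridge are visits counted by \<open>zeros\<close> only, hence the
  subtracted 2; N \<ge> 1 keeps the two ends distinct.\<close>

lemma bridge_returns_eq:
  fixes b :: "nat \<Rightarrow> real" and N :: nat
  assumes b: "\<And>n. 0 < b n" and "N \<ge> 1"
  defines "S \<equiv> {X \<in> SOS_paths (2 * N). X ! (2 * N) = 0}"
  shows "bridge_returns b N = ((\<Sum>X\<in>S. SOS_weight b (2 * N) X * zeros (2 * N) X)
    / (\<Sum>X\<in>S. SOS_weight b (2 * N) X) - 2) / real (2 * N - 1)"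
proof -
  let ?Q = "\<Sum>X\<in>S. SOS_weight b (2 * N) X"
  let ?P = "\<lambda>l. (\<Sum>X\<in>S \<inter> {X. X ! l = 0}. SOS_weight b (2 * N) X) / ?Q"
  have fin: "finite S" by (simp add: S_def finite_SOS_paths)
  have "S \<noteq> {}" using bridge_event_possible[where b=b and N=N, OF b]
    by (auto simp: S_def set_pmf_iff pmf_SOS[where b=b, OF b] split: if_splits)
  then have Q: "0 < ?Q" using fin b by (intro sum_pos SOS_weight_pos) auto
  have "S \<inter> {X. X ! 0 = 0} = S" "S \<inter> {X. X ! (2 * N) = 0} = S" by (auto simp: S_def SOS_paths_def)
  then have ends: "?P 0 = 1" "?P (2 * N) = 1" using Q by auto
  have "(\<Sum>l=0..2 * N. f l) = f 0 + (f (2 * N) + (\<Sum>l=1..2 * N - 1. f l))" for f :: "nat \<Rightarrow> real"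
  proof -
    have "{0..2 * N} = insert 0 (insert (2 * N) {1..2 * N - 1})" using assms(2) by auto
    moreover have "sum f (insert 0 (insert (2 * N) {1..2 * N - 1})) = f 0 + (f (2 * N) + (\<Sum>l=1..2 * N - 1. f l))"
      using assms(2) by (subst sum.insert, simp, simp, subst sum.insert) auto
    ultimately show ?thesis by simp
  qed
  from this[of ?P] have "(\<Sum>l=1..2 * N - 1. ?P l) = (\<Sum>X\<in>S. SOS_weight b (2 * N) X * zeros (2 * N) X) / ?Q - 2"
    using ends sum_visits[OF fin, of "SOS_weight b (2 * N)" ?Q "2 * N"] by simp
  then show ?thesis
    by (simp add: bridge_returns_def prob_SOS_bridge[where b=b, OF b] flip: S_def)
qed

text \<open>Free and bridge measures have the same limiting free energy, so one derivative settles
  both limits. The secant bound holds in finite volume for each measure separately, and the end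
  visits contribute only order 1 / N.\<close>

lemma (in bulk_weights) has_return_densityI:
  assumes "0 < s"
    and deriv: "((\<lambda>t. ln (growth (b(0 := exp (- t))))) has_real_derivative m) (at (- ln s))"
  shows "has_return_density b s m"
proof -
  define t where "t = - ln s"
  have s: "s = exp (- t)" using assms by (simp add: t_def)
  have wts: "weights (b(0 := exp (- u))) (min (exp (- u)) c)" for u by (rule pinned_weights) simp
  have bpos: "0 < (b(0 := exp (- u))) n" for u n using weights.pos[OF wts, of u n] .
  define Sf where "Sf N = SOS_paths N" for N
  define Sb where "Sb N = {X \<in> SOS_paths (2 * N). X ! (2 * N) = 0}" for N
  have fin: "finite (Sf N)" "finite (Sb N)" for N by (auto simp: Sf_def Sb_def finite_SOS_paths)
  have ne: "Sb N \<noteq> {}" "Sf N \<noteq> {}" for N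
    using zigzag_in_SOS_paths[of N] bridge_event_possible[where b="b(0 := s)" and N=N] bpos[of t]
    by (auto simp: Sb_def Sf_def set_pmf_iff s pmf_SOS[where b="b(0 := exp (- t))", OF bpos] split: if_splits)
  define Ef where "Ef N = (\<Sum>X\<in>Sf N. SOS_weight (b(0 := s)) N X * zeros N X)
      / (\<Sum>X\<in>Sf N. SOS_weight (b(0 := s)) N X)" for N
  define Eb where "Eb N = (\<Sum>X\<in>Sb N. SOS_weight (b(0 := s)) (2 * N) X * zeros (2 * N) X)
      / (\<Sum>X\<in>Sb N. SOS_weight (b(0 := s)) (2 * N) X)" for N
  have free: "(\<lambda>N. Ef N / real N) \<longlonglongrightarrow> m"
  proof (rule tendsto_secant_derivative)
    show "((\<lambda>t. ln (growth (b(0 := exp (- t))))) has_real_derivative m) (at t)"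
      using deriv by (simp add: t_def)
    show "(\<lambda>N. ln (\<Sum>X\<in>Sf N. SOS_weight (b(0 := exp (- (t + h)))) N X) / real N)
        \<longlonglongrightarrow> ln (growth (b(0 := exp (- (t + h)))))" for h
      using weights.ln_free_partition[OF wts, of "t + h"] by (simp add: SOS_Z_def Sf_def)
    show "h * (Ef N / real N) \<le> ln (\<Sum>X\<in>Sf N. SOS_weight (b(0 := exp (- (t + h)))) N X) / real N
        - ln (\<Sum>X\<in>Sf N. SOS_weight (b(0 := exp (- t))) N X) / real N" for N h
      using divide_right_mono[OF tilt_secant[of "Sf N" b h t N], of "real N"] fin ne b_pos
      by (simp add: Ef_def s diff_divide_distrib)
  qed
  have bridge: "(\<lambda>N. Eb N / real (2 * N)) \<longlonglongrightarrow> m"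
  proof (rule tendsto_secant_derivative)
    show "((\<lambda>t. ln (growth (b(0 := exp (- t))))) has_real_derivative m) (at t)"
      using deriv by (simp add: t_def)
    show "(\<lambda>N. ln (\<Sum>X\<in>Sb N. SOS_weight (b(0 := exp (- (t + h)))) (2 * N) X) / real (2 * N))
        \<longlonglongrightarrow> ln (growth (b(0 := exp (- (t + h)))))" for h
      using weights.ln_bridge_partition[OF wts, of "t + h"] by (simp add: Sb_def)
    show "h * (Eb N / real (2 * N)) \<le> ln (\<Sum>X\<in>Sb N. SOS_weight (b(0 := exp (- (t + h)))) (2 * N) X) / real (2 * N)
        - ln (\<Sum>X\<in>Sb N. SOS_weight (b(0 := exp (- t))) (2 * N) X) / real (2 * N)" for N h
      using divide_right_mono[OF tilt_secant[of "Sb N" b h t "2 * N"], of "real (2 * N)"] fin ne b_pos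
      by (simp add: Eb_def s diff_divide_distrib)
  qed
  have spos: "\<And>n. 0 < (b(0 := s)) n" using bpos[of t] by (simp add: s)
  have "(\<lambda>N. Ef N / real N - 1 / real N) \<longlonglongrightarrow> m - 0"
    by (intro tendsto_diff free) real_asymp
  moreover have "Ef N / real N - 1 / real N = free_returns (b(0 := s)) N" for N
    by (simp add: free_returns_eq[where b="b(0 := s)", OF spos] Ef_def Sf_def SOS_Z_def diff_divide_distrib)
  ultimately have 1: "free_returns (b(0 := s)) \<longlonglongrightarrow> m" by simp
  \<comment> \<open>The term 1 / N removes the two end visits, and the factor changes the
    normalization from 2 N to 2 N - 1.\<close>
  have "(\<lambda>N. (Eb N / real (2 * N) - 1 / real N) * (2 * real N / (2 * real N - 1))) \<longlonglongrightarrow> (m - 0) * 1"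
    by (intro tendsto_mult tendsto_diff bridge) real_asymp+
  moreover have "\<forall>\<^sub>F N in sequentially. (Eb N / real (2 * N) - 1 / real N) * (2 * real N / (2 * real N - 1))
      = bridge_returns (b(0 := s)) N"
    using eventually_ge_at_top[of 1]
  proof eventually_elim
    case (elim N)
    have "real (2 * N - 1) = 2 * real N - 1" using elim by (simp add: of_nat_diff)
    then have "bridge_returns (b(0 := s)) N = (Eb N - 2) / (2 * real N - 1)"
      using bridge_returns_eq[where b="b(0 := s)" and N=N, OF spos elim] by (simp add: Eb_def Sb_def)
    also have "\<dots> = (Eb N / real (2 * N) - 1 / real N) * (2 * real N / (2 * real N - 1))"
      using elim by (simp add: field_simps)
    finally show ?case by simp
  qed
  ultimately have 2: "bridge_returns (b(0 := s)) \<longlonglongrightarrow> m"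
    by (simp add: Lim_transform_eventually)
  show ?thesis using 1 2 by (simp add: has_return_density_def)
qed

section \<open>The density of returns off criticality\<close>

text \<open>In the variable s = 1 / \<rho>, \<rho> times the resolvent at the origin becomes a power
  series with nonnegative coefficients that converges for s below 1 /
  \<open>growth \<beta>\<close>.\<close>

definition return_series :: "(nat \<Rightarrow> real) \<Rightarrow> real \<Rightarrow> real" where
  "return_series \<beta> s = (\<Sum>n. entry \<beta> n 0 0 * s ^ n)"

definition return_series' :: "(nat \<Rightarrow> real) \<Rightarrow> real \<Rightarrow> real" where
  "return_series' \<beta> s = (\<Sum>n. diffs (\<lambda>n. entry \<beta> n 0 0) n * s ^ n)"

context weights
begin

lemma return_series_summable:
  assumes "\<bar>s\<bar> < 1 / growth \<beta>"
  shows "summable (\<lambda>n. entry \<beta> n 0 0 * s ^ n)"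
proof (rule summable_comparison_test'[of "\<lambda>n. (growth \<beta> * \<bar>s\<bar>) ^ n" 0])
  show "summable (\<lambda>n. (growth \<beta> * \<bar>s\<bar>) ^ n)"
    using assms growth_pos by (intro summable_geometric) (simp add: field_simps abs_mult)
  show "norm (entry \<beta> n 0 0 * s ^ n) \<le> (growth \<beta> * \<bar>s\<bar>) ^ n" for n
    using entry_le_growth[of n] entry_nonneg[of n 0 0]
    by (simp add: abs_mult power_abs power_mult_distrib mult_right_mono)
qed

lemma return_series_deriv:
  assumes "\<bar>s\<bar> < 1 / growth \<beta>"
  shows "(return_series \<beta> has_real_derivative return_series' \<beta> s) (at s)"
proof -
  obtain K where K: "\<bar>s\<bar> < K" "K < 1 / growth \<beta>" using dense assms by blast
  then have "summable (\<lambda>n. entry \<beta> n 0 0 * K ^ n)" by (intro return_series_summable) auto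
  then show ?thesis unfolding return_series_def[abs_def] return_series'_def
    using K by (intro termdiffs_strong[of _ K]) auto
qed

lemma return_series'_summable:
  assumes "\<bar>s\<bar> < 1 / growth \<beta>"
  shows "summable (\<lambda>n. diffs (\<lambda>n. entry \<beta> n 0 0) n * s ^ n)"
proof -
  obtain K where K: "\<bar>s\<bar> < K" "K < 1 / growth \<beta>" using dense assms by blast
  then show ?thesis
    by (intro termdiff_converges[of s "1 / growth \<beta>"]) (use assms return_series_summable in auto)
qed

lemma return_series_ge_1: "\<lbrakk>0 \<le> s; s < 1 / growth \<beta>\<rbrakk> \<Longrightarrow> 1 \<le> return_series \<beta> s"
  using sum_le_suminf[OF return_series_summable[of s], of "{0}"]
  by (simp add: return_series_def entry_nonneg entry_0)

lemma return_series'_nonneg: "\<lbrakk>0 \<le> s; s < 1 / growth \<beta>\<rbrakk> \<Longrightarrow> 0 \<le> return_series' \<beta> s"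
  unfolding return_series'_def by (intro suminf_nonneg return_series'_summable) (auto simp: diffs_def entry_nonneg)

lemma return_series_mono: "\<lbrakk>0 \<le> s; s \<le> s'; s' < 1 / growth \<beta>\<rbrakk> \<Longrightarrow> return_series \<beta> s \<le> return_series \<beta> s'"
  unfolding return_series_def
  by (intro suminf_le return_series_summable mult_left_mono power_mono) (auto simp: entry_nonneg)

lemma green_inverse:
  assumes "0 < s" "s < 1 / growth \<beta>"
  shows "green \<beta> (1 / s) 0 = s * return_series \<beta> s"
proof -
  have "green \<beta> (1 / s) 0 = (\<Sum>n. s * (entry \<beta> n 0 0 * s ^ n))"
    unfolding green_def using assms by (intro suminf_cong) (simp add: power_one_over)
  also have "\<dots> = s * return_series \<beta> s"
    unfolding return_series_def using assms by (intro suminf_mult return_series_summable) auto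
  finally show ?thesis .
qed

end

text \<open>A finite partial sum is continuous at 1 and bounds the series from below. The
  coefficients may have a divergent sum; the power series is then seen to tend to infinity.\<close>

lemma eventually_at_left_suminf_gt:
  fixes a :: "nat \<Rightarrow> real"
  assumes "\<And>n. 0 \<le> a n" and s: "\<And>s. \<lbrakk>0 < s; s < 1\<rbrakk> \<Longrightarrow> summable (\<lambda>n. a n * s ^ n)"
    and K: "K < (\<Sum>n<N. a n)"
  shows "\<forall>\<^sub>F s in at_left 1. K < (\<Sum>n. a n * s ^ n)"
proof -
  have "((\<lambda>s. \<Sum>n<N. a n * s ^ n) \<longlongrightarrow> (\<Sum>n<N. a n * 1 ^ n)) (at_left 1)"
    by (intro tendsto_intros)
  then have "\<forall>\<^sub>F s in at_left 1. K < (\<Sum>n<N. a n * s ^ n)"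
    using K by (intro order_tendstoD(1)) auto
  moreover have "\<forall>\<^sub>F s in at_left (1::real). 0 < s \<and> s < 1"
    unfolding eventually_at_left_field by (intro exI[of _ 0]) auto
  ultimately show ?thesis
  proof eventually_elim
    case (elim s)
    have "(\<Sum>n<N. a n * s ^ n) \<le> (\<Sum>n. a n * s ^ n)"
      using elim assms(1) by (intro sum_le_suminf s) auto
    then show ?case using elim by simp
  qed
qed

text \<open>For nonnegative coefficients Abel's limit theorem follows from monotonicity: partial
  sums bound the limit from below, the full sum bounds it from above.\<close>

lemma tendsto_at_left_suminf:
  fixes a :: "nat \<Rightarrow> real"
  assumes nn: "\<And>n. 0 \<le> a n" and sa: "summable a"
  shows "((\<lambda>s. \<Sum>n. a n * s ^ n) \<longlongrightarrow> (\<Sum>n. a n)) (at_left 1)"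
proof -
  have s: "summable (\<lambda>n. a n * s ^ n)" if "0 < s" "s < 1" for s
    by (rule summable_comparison_test'[OF sa, of 0])
       (use that nn in \<open>auto simp: power_le_one mult_left_le\<close>)
  show ?thesis
  proof (rule order_tendstoI)
    fix K assume "K < (\<Sum>n. a n)"
    then obtain N where "K < (\<Sum>n<N. a n)"
      using order_tendstoD(1)[OF summable_LIMSEQ[OF sa]] eventually_happens'[OF sequentially_bot] by blast
    then show "\<forall>\<^sub>F s in at_left 1. K < (\<Sum>n. a n * s ^ n)"
      using nn s by (intro eventually_at_left_suminf_gt)
  next
    fix K assume K: "(\<Sum>n. a n) < K"
    show "\<forall>\<^sub>F s in at_left 1. (\<Sum>n. a n * s ^ n) < K"
      unfolding eventually_at_left_field
    proof (intro exI[of _ 0] conjI allI impI)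
      fix s :: real assume "0 < s" "s < 1"
      then have "(\<Sum>n. a n * s ^ n) \<le> (\<Sum>n. a n)"
        using nn by (intro suminf_le s sa) (auto simp: power_le_one mult_left_le)
      then show "(\<Sum>n. a n * s ^ n) < K" using K by simp
    qed simp
  qed
qed

context bulk_weights
begin

text \<open>The value of \<open>b\<^sub>0\<close> with growth rate \<open>1 / s\<close>, and the density of returns there.\<close>

definition pin_series :: "real \<Rightarrow> real" where
  "pin_series s = s\<^sup>2 * return_series \<beta> s / (4 * b 1)"

definition contact_density :: "real \<Rightarrow> real" where
  "contact_density s = return_series \<beta> s / (2 * return_series \<beta> s + s * return_series' \<beta> s)"

lemma pin_series_eq_pinning: "\<lbrakk>0 < s; s < 1 / growth \<beta>\<rbrakk> \<Longrightarrow> pin_series s = pinning \<beta> (1 / s)"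
  by (simp add: pin_series_def pinning_def green_inverse power2_eq_square)

lemma pin_series_deriv:
  assumes "\<bar>s\<bar> < 1 / growth \<beta>"
  shows "(pin_series has_real_derivative (2 * s * return_series \<beta> s + s\<^sup>2 * return_series' \<beta> s) / (4 * b 1)) (at s)"
  unfolding pin_series_def[abs_def] using b_pos[of 1]
  by (auto intro!: derivative_eq_intros return_series_deriv[OF assms] simp: field_simps)

lemma pin_series_strict_mono: "\<lbrakk>0 \<le> s; s < s'; s' < 1 / growth \<beta>\<rbrakk> \<Longrightarrow> pin_series s < pin_series s'"
proof -
  assume s: "0 \<le> s" "s < s'" "s' < 1 / growth \<beta>"
  have "s\<^sup>2 * return_series \<beta> s \<le> s\<^sup>2 * return_series \<beta> s'" using s by (intro mult_left_mono return_series_mono) auto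
  also have "\<dots> < s'\<^sup>2 * return_series \<beta> s'"
    using s return_series_ge_1[of s'] by (intro mult_strict_right_mono power_strict_mono) auto
  finally show ?thesis using b_pos[of 1] by (simp add: pin_series_def divide_strict_right_mono)
qed

lemma pin_series_pos: "\<lbrakk>0 < s; s < 1 / growth \<beta>\<rbrakk> \<Longrightarrow> 0 < pin_series s"
  using return_series_ge_1[of s] b_pos[of 1] by (simp add: pin_series_def)

lemma contact_density_pos: "\<lbrakk>0 < s; s < 1 / growth \<beta>\<rbrakk> \<Longrightarrow> 0 < contact_density s"
  using return_series_ge_1[of s] return_series'_nonneg[of s] by (simp add: contact_density_def add_pos_nonneg)

lemma growth_pin_series:
  assumes "0 < s" "s < 1 / growth \<beta>"
  shows "growth (b(0 := pin_series s)) = 1 / s"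
proof -
  have "growth \<beta> < 1 / s" using assms growth_pos by (simp add: field_simps)
  then show ?thesis using growth_pinned_eq assms by (simp add: pin_series_eq_pinning)
qed

text \<open>Intermediate values: the series starts at 0 and, the critical value being the supremum
  of \<open>pinning\<close>, exceeds every smaller number somewhere below 1 /
  \<open>growth \<beta>\<close>.\<close>

lemma pin_series_surj:
  assumes "0 < y" "ereal y < b0_crit b"
  obtains s where "0 < s" "s < 1 / growth \<beta>" "pin_series s = y"
proof -
  obtain \<rho> where \<rho>: "growth \<beta> < \<rho>" "y < pinning \<beta> \<rho>"
    using assms(2) unfolding b0_crit_eq by (auto simp: less_SUP_iff)
  define s1 where "s1 = 1 / \<rho>"
  have s1: "0 < s1" "s1 < 1 / growth \<beta>" using \<rho> growth_pos by (auto simp: s1_def field_simps)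
  have "y < pin_series s1" using \<rho> s1 by (simp add: pin_series_eq_pinning) (simp add: s1_def)
  moreover have "pin_series 0 = 0" by (simp add: pin_series_def)
  moreover have "isCont pin_series x" if "0 \<le> x" "x \<le> s1" for x
    using that s1 by (intro DERIV_isCont[OF pin_series_deriv]) auto
  ultimately obtain s where s: "0 \<le> s" "s \<le> s1" "pin_series s = y"
    using IVT[of pin_series 0 y s1] assms(1) s1 by auto
  then have "s \<noteq> 0" using \<open>pin_series 0 = 0\<close> assms(1) by auto
  then show thesis using s s1 by (intro that[of s]) auto
qed

text \<open>The map sending b_0 to 1 / growth is a local inverse of \<open>pin_series\<close>, whose
  derivative D is positive, so the inverse function theorem applies. The derivative of the log
  growth rate in t = - ln b_0 is therefore \<open>pin_series s / (s * D)\<close>, which simplifies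
  to \<open>contact_density s\<close>.\<close>

lemma has_return_density_pin_series:
  assumes s: "0 < s" "s < 1 / growth \<beta>"
  shows "has_return_density b (pin_series s) (contact_density s)"
proof (rule has_return_densityI)
  show pos: "0 < pin_series s" using s by (rule pin_series_pos)
  define D where "D = (2 * s * return_series \<beta> s + s\<^sup>2 * return_series' \<beta> s) / (4 * b 1)"
  have g: "1 \<le> return_series \<beta> s" "0 \<le> return_series' \<beta> s" using s return_series_ge_1 return_series'_nonneg by auto
  have D: "0 < D" unfolding D_def using g s b_pos[of 1] by (intro divide_pos_pos add_pos_nonneg) auto
  have inv: "((\<lambda>y. 1 / growth (b(0 := y))) has_real_derivative inverse D) (at (pin_series s))"
    unfolding has_field_derivative_def
  proof (rule has_derivative_inverse_strong[where f = pin_series and x = s and S = "{0<..<1 / growth \<beta>}" and f' = "(*) D"])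
    show "(pin_series has_derivative (*) D) (at s)"
      unfolding D_def using s pin_series_deriv[of s] by (simp add: has_field_derivative_def)
    show "continuous_on {0<..<1 / growth \<beta>} pin_series"
      by (intro continuous_at_imp_continuous_on ballI DERIV_isCont[OF pin_series_deriv]) auto
    show "1 / growth (b(0 := pin_series z)) = z" if "z \<in> {0<..<1 / growth \<beta>}" for z
      using that by (simp add: growth_pin_series)
  qed (use D s in auto)
  have e: "exp (- (- ln (pin_series s))) = pin_series s" using pos by simp
  have "((\<lambda>t. ln (1 / growth (b(0 := exp (- t))))) has_real_derivative
      1 / (1 / growth (b(0 := exp (- (- ln (pin_series s)))))) * (inverse D * (- exp (- (- ln (pin_series s)))))) (at (- ln (pin_series s)))"
  proof (rule DERIV_chain2[where f = ln])
    show "(ln has_real_derivative 1 / (1 / growth (b(0 := exp (- (- ln (pin_series s)))))))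
        (at (1 / growth (b(0 := exp (- (- ln (pin_series s)))))))"
      unfolding e using s by (intro DERIV_ln_divide) (simp add: growth_pin_series)
    show "((\<lambda>t. 1 / growth (b(0 := exp (- t)))) has_real_derivative inverse D * - exp (- (- ln (pin_series s))))
        (at (- ln (pin_series s)))"
    proof (rule DERIV_chain2[where f = "\<lambda>y. 1 / growth (b(0 := y))"])
      show "((\<lambda>y. 1 / growth (b(0 := y))) has_real_derivative inverse D) (at (exp (- (- ln (pin_series s)))))"
        unfolding e by (rule inv)
      show "((\<lambda>t. exp (- t)) has_real_derivative - exp (- (- ln (pin_series s)))) (at (- ln (pin_series s)))"
        by (auto intro!: derivative_eq_intros)
    qed
  qed
  then have "((\<lambda>t. - ln (1 / growth (b(0 := exp (- t))))) has_real_derivative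
      - (1 / s * (inverse D * - pin_series s))) (at (- ln (pin_series s)))"
    unfolding e using s by (intro DERIV_minus) (simp add: growth_pin_series)
  moreover have "- (1 / s * (inverse D * - pin_series s)) = contact_density s"
  proof -
    define A where "A = 2 * return_series \<beta> s + s * return_series' \<beta> s"
    have A: "0 < A" unfolding A_def using g s by (intro add_pos_nonneg) auto
    have "D = s * A / (4 * b 1)"
      by (simp add: D_def A_def algebra_simps power2_eq_square)
    then have "- (1 / s * (inverse D * - pin_series s)) = return_series \<beta> s / A"
      using A s b_pos[of 1] by (simp add: pin_series_def field_simps power2_eq_square)
    then show ?thesis by (simp add: contact_density_def A_def)
  qed
  moreover have "- ln (1 / growth (b(0 := exp (- t)))) = ln (growth (b(0 := exp (- t))))" for t
    using weights.growth_pos[OF pinned_weights, of "exp (- t)"] by (simp add: ln_div)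
  ultimately show "((\<lambda>t. ln (growth (b(0 := exp (- t))))) has_real_derivative contact_density s) (at (- ln (pin_series s)))"
    by simp
qed

text \<open>The strict inequality leaves a neighbourhood of parameters on which the growth rate
  keeps its bulk value, so its derivative is 0.\<close>

lemma has_return_density_unpinned:
  assumes "0 < s" "b0_crit b < ereal s"
  shows "has_return_density b s 0"
proof (rule has_return_densityI[OF assms(1)])
  obtain r where r: "b0_crit b < ereal r" "ereal r < ereal s" using ereal_dense2[OF assms(2)] by blast
  have "((\<lambda>t. exp (- t)) \<longlongrightarrow> exp (- (- ln s))) (nhds (- ln s))"
    by (intro tendsto_exp tendsto_minus filterlim_ident)
  then have "\<forall>\<^sub>F t in nhds (- ln s). r < exp (- t)"
    using r assms(1) by (intro order_tendstoD(1)) auto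
  then have "\<forall>\<^sub>F t in nhds (- ln s). ln (growth (b(0 := exp (- t)))) = ln (growth \<beta>)"
  proof eventually_elim
    case (elim t)
    then have "b0_crit b \<le> ereal (exp (- t))"
      using r(1) by (metis ereal_less_eq(3) less_imp_le order_trans)
    then show ?case by (simp add: growth_unpinned_eq)
  qed
  then show "((\<lambda>t. ln (growth (b(0 := exp (- t))))) has_real_derivative 0) (at (- ln s))"
    by (subst DERIV_cong_ev[OF refl _ refl]) (auto intro: DERIV_const)
qed

text \<open>Change of variable y = \<open>pin_series s\<close>. Since this map is strictly
  increasing and reaches every value below the critical one, parameters y close below the critical
  value come from s close below 1 / \<open>growth \<beta>\<close>.\<close>

lemma return_density_tendsto:
  assumes fin: "b0_crit b < \<infinity>" and lim: "(contact_density \<longlongrightarrow> L) (at_left (1 / growth \<beta>))"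
  shows "(return_density b \<longlongrightarrow> L) (at_left (real_of_ereal (b0_crit b)))"
proof (rule topological_tendstoI)
  have g: "0 < 1 / growth \<beta>" using growth_pos by simp
  have pin_series_le: "ereal (pin_series s) \<le> b0_crit b" if "0 < s" "s < 1 / growth \<beta>" for s
    unfolding b0_crit_eq using that growth_pos
    by (intro SUP_upper2[of "1 / s"]) (auto simp: pin_series_eq_pinning field_simps)
  obtain s0 where s0: "0 < s0" "s0 < 1 / growth \<beta>" using dense g by blast
  have "\<bar>b0_crit b\<bar> \<noteq> \<infinity>" using fin pin_series_le[OF s0] by auto
  then obtain bc where bc: "b0_crit b = ereal bc" by (cases "b0_crit b") auto
  fix S assume "open S" "L \<in> S"
  then have "\<forall>\<^sub>F s in at_left (1 / growth \<beta>). contact_density s \<in> S" using topological_tendstoD[OF lim] by blast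
  then obtain a where a: "a < 1 / growth \<beta>" "\<And>s. a < s \<Longrightarrow> s < 1 / growth \<beta> \<Longrightarrow> contact_density s \<in> S"
    unfolding eventually_at_left_field by blast
  define s1 where "s1 = max a s0"
  have s1: "0 < s1" "s1 < 1 / growth \<beta>" "a \<le> s1" using a s0 by (auto simp: s1_def)
  then obtain s2 where s2: "s1 < s2" "s2 < 1 / growth \<beta>" using dense by blast
  have "pin_series s1 < bc"
    using pin_series_strict_mono[of s1 s2] pin_series_le[of s2] s1 s2 by (simp add: bc)
  then show "\<forall>\<^sub>F y in at_left (real_of_ereal (b0_crit b)). return_density b y \<in> S"
    unfolding eventually_at_left_field bc real_of_ereal.simps
  proof (intro exI[of _ "pin_series s1"] conjI allI impI)
    fix y assume y: "pin_series s1 < y" "y < bc"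
    then have "0 < y" using pin_series_pos[of s1] s1 by simp
    then obtain s where s: "0 < s" "s < 1 / growth \<beta>" "pin_series s = y"
      using pin_series_surj[of y] y by (auto simp: bc)
    have "s1 < s"
    proof (rule ccontr)
      assume "\<not> s1 < s"
      then have "pin_series s \<le> pin_series s1" using pin_series_strict_mono[of s s1] s s1 by (cases "s = s1") auto
      then show False using s y by simp
    qed
    then have "contact_density s \<in> S" using a(2)[of s] s s1 by simp
    then show "return_density b y \<in> S"
      using return_density_eqI[OF has_return_density_pin_series[of s]] s by simp
  qed simp
qed

end

section \<open>The Green function at criticality\<close>

text \<open>The discrete Wronskian of a positive solution and a subsolution is nondecreasing; if the solution
  vanishes at infinity and the subsolution stays bounded, it tends to \<open>0\<close>.\<close>
lemma wronskian_nonpos: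
  fixes x y :: "nat \<Rightarrow> real"
  assumes pos: "\<And>p. 0 < x p" and x0: "x \<longlonglongrightarrow> 0" and bdd: "\<And>p. \<bar>y p\<bar> \<le> B"
    and sol: "\<And>p. P \<le> p \<Longrightarrow> x (Suc (Suc p)) + x p = q p * x (Suc p)"
    and sub: "\<And>p. P \<le> p \<Longrightarrow> q p * y (Suc p) \<le> y (Suc (Suc p)) + y p"
    and "P \<le> p"
  shows "x p * y (Suc p) \<le> x (Suc p) * y p"
proof -
  define W where "W p = x p * y (Suc p) - x (Suc p) * y p" for p
  have incr: "W r \<le> W (Suc r)" if "P \<le> r" for r
  proof -
    have "q r * y (Suc r) * x (Suc r) \<le> (y (Suc (Suc r)) + y r) * x (Suc r)"
      using sub[OF that] pos[of "Suc r"] by (intro mult_right_mono) auto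
    moreover have "(x (Suc (Suc r)) + x r) * y (Suc r) = q r * x (Suc r) * y (Suc r)"
      using sol[OF that] by simp
    ultimately show ?thesis by (simp add: W_def algebra_simps)
  qed
  have mono: "W p \<le> W r" if "p \<le> r" for r
    using that
  proof (induction r rule: dec_induct)
    case (step r)
    then show ?case using incr[of r] assms(6) by simp
  qed simp
  have upper: "W r \<le> B * (x r + x (Suc r))" for r
  proof -
    have "y (Suc r) \<le> B" "- y r \<le> B" using bdd[of r] bdd[of "Suc r"] by linarith+
    then have "x r * y (Suc r) \<le> x r * B" "x (Suc r) * (- y r) \<le> x (Suc r) * B"
      using less_imp_le[OF pos] by (blast intro: mult_left_mono)+
    then show ?thesis by (simp add: W_def algebra_simps)
  qed
  have "(\<lambda>r. B * (x r + x (Suc r))) \<longlonglongrightarrow> B * (0 + 0)"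
    by (intro tendsto_intros x0 LIMSEQ_Suc)
  then have "W p \<le> B * (0 + 0)"
    by (rule LIMSEQ_le_const) (use mono upper in \<open>blast intro: order_trans\<close>)
  then show ?thesis by (simp add: W_def)
qed

text \<open>The solution regular at the origin, normalized to 1 there: the orthogonal polynomials of
  the operator. Being a polynomial in \<rho>, each value depends continuously on the
  eigenvalue.\<close>

fun eigensol :: "(nat \<Rightarrow> real) \<Rightarrow> real \<Rightarrow> nat \<Rightarrow> real" where
  "eigensol \<beta> \<rho> 0 = 1"
| "eigensol \<beta> \<rho> (Suc 0) = 2 * \<rho> * \<beta> 0"
| "eigensol \<beta> \<rho> (Suc (Suc p)) = 2 * \<rho> * \<beta> (Suc p) * eigensol \<beta> \<rho> (Suc p) - eigensol \<beta> \<rho> p"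

lemma isCont_eigensol: "isCont (\<lambda>\<rho>. eigensol \<beta> \<rho> p) x"
  by (induction p rule: induct_nat_012) (auto intro!: continuous_intros)

context weights
begin

lemma jac_eigensol: "jac \<beta> (eigensol \<beta> \<rho>) p = \<rho> * eigensol \<beta> \<rho> p"
  using pos[of p] by (cases p) (simp_all add: jac_def field_simps)

lemma green_rec:
  assumes "transient \<beta> \<rho>"
  shows "green \<beta> \<rho> (Suc (Suc p)) + green \<beta> \<rho> p = 2 * \<rho> * \<beta> (Suc p) * green \<beta> \<rho> (Suc p)"
  using green_eq[OF assms, of "Suc p"] pos[of "Suc p"] by (simp add: jac_def field_simps)

lemma jac_super_iff:
  "jac \<beta> y (Suc p) \<le> \<rho> * y (Suc p) \<longleftrightarrow> y (Suc (Suc p)) + y p \<le> 2 * \<rho> * \<beta> (Suc p) * y (Suc p)"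
  using pos[of "Suc p"] by (simp add: jac_def field_simps)

text \<open>Riccati argument. Below 1 the ratio r of successive Green function values satisfies r' +
  1 / r < 2 - 2 d far out, where r' is the next ratio. As r + 1 / r \<ge> 2, each step lowers the
  ratio by at least 2 d, which contradicts positivity.\<close>

lemma growth_ge_1:
  assumes "\<beta> \<longlonglongrightarrow> 1"
  shows "1 \<le> growth \<beta>"
proof (rule ccontr)
  assume "\<not> 1 \<le> growth \<beta>"
  define \<rho> where "\<rho> = (growth \<beta> + 1) / 2"
  have \<rho>: "growth \<beta> < \<rho>" "0 < \<rho>" "\<rho> < 1"
    using \<open>\<not> 1 \<le> growth \<beta>\<close> growth_pos by (auto simp: \<rho>_def)
  then have tr: "transient \<beta> \<rho>" by (intro transient_above_growth)
  define d where "d = (1 - \<rho>) / 2"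
  have d: "0 < d" "\<rho> * 1 < 1 - d" using \<rho> by (auto simp: d_def field_simps)
  have "(\<lambda>p. \<rho> * \<beta> p) \<longlonglongrightarrow> \<rho> * 1" by (intro tendsto_intros assms)
  then have "\<forall>\<^sub>F p in sequentially. \<rho> * \<beta> p < 1 - d" using d(2) by (rule order_tendstoD(2))
  then obtain P where P: "\<And>p. P \<le> p \<Longrightarrow> \<rho> * \<beta> p < 1 - d"
    unfolding eventually_sequentially by blast
  let ?g = "green \<beta> \<rho>"
  define r where "r p = ?g (Suc p) / ?g p" for p
  have g: "0 < ?g p" for p by (rule green_pos[OF tr])
  have r: "0 < r p" for p by (simp add: r_def g)
  have step: "r (Suc p) \<le> r p - 2 * d" if "P \<le> p" for p
  proof -
    have "r (Suc p) + 1 / r p = 2 * (\<rho> * \<beta> (Suc p))"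
      using green_rec[OF tr, of p] g[of "Suc p"] g[of p] by (simp add: r_def field_simps)
    moreover have "2 \<le> r p + 1 / r p"
    proof -
      have "0 \<le> (r p - 1)\<^sup>2 / r p" using r[of p] by simp
      also have "\<dots> = r p + 1 / r p - 2" using r[of p] by (simp add: field_simps power2_eq_square)
      finally show ?thesis by simp
    qed
    ultimately show ?thesis using P[of "Suc p"] that by linarith
  qed
  have "r (P + n) \<le> r P - 2 * d * real n" for n
  proof (induction n)
    case (Suc n)
    then show ?case using step[of "P + n"] by (simp add: algebra_simps)
  qed simp
  moreover obtain n where "r P < real n * (2 * d)" using reals_Archimedean3[of "2 * d"] d by auto
  ultimately show False using r[of "P + n"] by (metis diff_gt_0_iff_gt less_le_trans mult.commute not_less_iff_gr_or_eq)
qed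

lemma green_tendsto_0:
  assumes lim: "\<beta> \<longlonglongrightarrow> 1" and tr: "transient \<beta> \<rho>" and "1 < \<rho>"
  shows "green \<beta> \<rho> \<longlonglongrightarrow> 0"
proof -
  define d where "d = (\<rho> - 1) / 2"
  have d: "0 < d" "1 + d < \<rho> * 1" using assms by (auto simp: d_def field_simps)
  have "(\<lambda>p. \<rho> * \<beta> p) \<longlonglongrightarrow> \<rho> * 1" by (intro tendsto_intros lim)
  then have "\<forall>\<^sub>F p in sequentially. 1 + d < \<rho> * \<beta> p" using d(2) by (rule order_tendstoD(1))
  then obtain P where P: "\<And>p. P \<le> p \<Longrightarrow> 1 + d < \<rho> * \<beta> p"
    unfolding eventually_sequentially by blast
  \<comment> \<open>Powers of \<theta> form a supersolution when \<theta> + 1 / \<theta> \<le> 2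
    \<rho> \<beta>_p. Here 1 / \<theta> = 1 + 2 d and \<theta> < 1, so the left side is below 2 + 2
    d.\<close>
  define \<theta> where "\<theta> = 1 / (1 + 2 * d)"
  have \<theta>: "0 < \<theta>" "\<theta> < 1" using d by (auto simp: \<theta>_def)
  have super: "jac \<beta> (\<lambda>p. \<theta> ^ p) p \<le> \<rho> * \<theta> ^ p" if "P < p" for p
  proof (cases p)
    case (Suc q)
    have "\<theta>\<^sup>2 + 1 \<le> 2 * (\<rho> * \<beta> (Suc q)) * \<theta>"
    proof -
      have "(1 + 2 * d) * \<theta> = 1" using d by (simp add: \<theta>_def)
      then have "\<theta>\<^sup>2 + 1 = (\<theta> + (1 + 2 * d)) * \<theta>" by (simp add: power2_eq_square distrib_right)
      also have "\<dots> \<le> (2 * (\<rho> * \<beta> (Suc q))) * \<theta>"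
        using \<theta> P[of "Suc q"] that Suc by (intro mult_right_mono) auto
      finally show ?thesis .
    qed
    then have "\<theta> ^ q * (\<theta>\<^sup>2 + 1) \<le> \<theta> ^ q * (2 * (\<rho> * \<beta> (Suc q)) * \<theta>)"
      using \<theta> by (intro mult_left_mono) auto
    then show ?thesis unfolding Suc jac_super_iff by (simp add: power2_eq_square algebra_simps)
  qed (use that in simp)
  obtain C where C: "\<And>p. green \<beta> \<rho> p \<le> C * \<theta> ^ p"
    by (rule green_le_super_outside[OF tr, of "\<lambda>p. \<theta> ^ p" P]) (use \<theta> super in auto)
  show ?thesis
  proof (rule tendsto_sandwich[where f = "\<lambda>_. 0"])
    show "(\<lambda>p. C * \<theta> ^ p) \<longlonglongrightarrow> 0"
      using \<theta> by (intro tendsto_mult_right_zero LIMSEQ_realpow_zero) auto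
  qed (use C green_pos[OF tr] in \<open>auto intro!: always_eventually simp: less_imp_le\<close>)
qed

text \<open>Above \<open>1\<close>, the solution regular at the origin would otherwise still be positive for some smaller
  eigenvalue: once it increases beyond the index where \<open>\<rho> \<beta> p \<ge> 1\<close>, it increases forever.\<close>
lemma growth_le_1:
  assumes lim: "\<beta> \<longlonglongrightarrow> 1" and tr: "transient \<beta> (growth \<beta>)"
  shows "growth \<beta> \<le> 1"
proof (rule ccontr)
  assume "\<not> growth \<beta> \<le> 1"
  then have gr: "1 < growth \<beta>" by simp
  let ?g = "green \<beta> (growth \<beta>)" and ?h = "eigensol \<beta> (growth \<beta>)"
  have g: "0 < ?g p" for p by (rule green_pos[OF tr])
  \<comment> \<open>The Wronskian of two solutions is constant off the origin, and the source of
    \<open>?g\<close> fixes its value. It yields the positivity of \<open>?h\<close> now and the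
    contradiction at the end.\<close>
  have W: "?g p * ?h (Suc p) - ?g (Suc p) * ?h p = 2 * \<beta> 0" for p
  proof (induction p)
    case 0
    then show ?case using green_eq[OF tr, of 0] pos[of 0] by (simp add: jac_def field_simps)
  next
    case (Suc p)
    have "?g (Suc (Suc p)) = 2 * growth \<beta> * \<beta> (Suc p) * ?g (Suc p) - ?g p"
      using green_rec[OF tr, of p] by simp
    then have "?g (Suc p) * ?h (Suc (Suc p)) - ?g (Suc (Suc p)) * ?h (Suc p) = ?g p * ?h (Suc p) - ?g (Suc p) * ?h p"
      by (simp only: eigensol.simps) (simp add: algebra_simps)
    then show ?case using Suc by simp
  qed
  have h: "0 < ?h p" for p
  proof (induction p)
    case (Suc p)
    have "0 < 2 * \<beta> 0 + ?g (Suc p) * ?h p" using pos[of 0] g[of "Suc p"] Suc by (simp add: add_pos_pos)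
    then have "0 < ?g p * ?h (Suc p)" using W[of p] by simp
    then show ?case using g[of p] by (simp add: zero_less_mult_iff)
  qed simp
  \<comment> \<open>An eigenvalue strictly between 1 and the growth rate: beyond P the coefficient
    exceeds 1 for all eigenvalues above it, so the index P serves while the eigenvalue is
    lowered.\<close>
  define \<rho>1 where "\<rho>1 = (1 + growth \<beta>) / 2"
  have \<rho>1: "1 < \<rho>1" "\<rho>1 < growth \<beta>" using gr by (auto simp: \<rho>1_def)
  have "(\<lambda>p. \<rho>1 * \<beta> p) \<longlonglongrightarrow> \<rho>1 * 1" by (intro tendsto_intros lim)
  then have "\<forall>\<^sub>F p in sequentially. 1 < \<rho>1 * \<beta> p" by (rule order_tendstoD(1)) (use \<rho>1 in simp)
  then obtain P where P: "\<And>p. P \<le> p \<Longrightarrow> 1 < \<rho>1 * \<beta> p"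
    unfolding eventually_sequentially by blast
  have decr: "?h (Suc p) \<le> ?h p" if "P \<le> p" for p
  proof (rule ccontr)
    assume "\<not> ?h (Suc p) \<le> ?h p"
    then have inc: "0 < ?h (Suc p) - ?h p" by simp
    have "\<forall>\<^sub>F \<rho> in at_left (growth \<beta>). 0 < eigensol \<beta> \<rho> q" for q
      using isCont_eigensol[where \<beta> = \<beta> and p = q and x = "growth \<beta>"] h[of q]
      by (intro order_tendstoD(1)[of _ "?h q"]) (auto simp: isCont_def intro: tendsto_within_subset)
    then have "\<forall>\<^sub>F \<rho> in at_left (growth \<beta>). \<forall>q\<in>{..p}. 0 < eigensol \<beta> \<rho> q"
      by (intro eventually_ball_finite) auto
    moreover have "\<forall>\<^sub>F \<rho> in at_left (growth \<beta>). 0 < eigensol \<beta> \<rho> (Suc p) - eigensol \<beta> \<rho> p"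
    proof (rule order_tendstoD(1)[OF _ inc])
      have "isCont (\<lambda>\<rho>. eigensol \<beta> \<rho> (Suc p) - eigensol \<beta> \<rho> p) (growth \<beta>)"
        by (intro continuous_intros isCont_eigensol)
      then show "((\<lambda>\<rho>. eigensol \<beta> \<rho> (Suc p) - eigensol \<beta> \<rho> p) \<longlongrightarrow> ?h (Suc p) - ?h p) (at_left (growth \<beta>))"
        by (auto simp: isCont_def intro: tendsto_within_subset)
    qed
    moreover have "\<forall>\<^sub>F \<rho> in at_left (growth \<beta>). \<rho>1 < \<rho> \<and> \<rho> < growth \<beta>"
      unfolding eventually_at_left_field using \<rho>1 by blast
    ultimately have "\<forall>\<^sub>F \<rho> in at_left (growth \<beta>). (\<forall>q\<in>{..p}. 0 < eigensol \<beta> \<rho> q) \<and>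
        0 < eigensol \<beta> \<rho> (Suc p) - eigensol \<beta> \<rho> p \<and> \<rho>1 < \<rho> \<and> \<rho> < growth \<beta>"
      by eventually_elim auto
    then obtain \<rho> where \<rho>: "\<And>q. q \<le> p \<Longrightarrow> 0 < eigensol \<beta> \<rho> q"
        "eigensol \<beta> \<rho> p < eigensol \<beta> \<rho> (Suc p)" "\<rho>1 < \<rho>" "\<rho> < growth \<beta>"
      using eventually_happens' trivial_limit_at_left_real by fastforce
    have inc: "0 < eigensol \<beta> \<rho> q \<and> eigensol \<beta> \<rho> q < eigensol \<beta> \<rho> (Suc q)" if "p \<le> q" for q
      using that
    proof (induction q rule: dec_induct)
      case base
      then show ?case using \<rho> by simp
    next
      case (step q)
      have "1 < \<rho>1 * \<beta> (Suc q)" using P[of "Suc q"] step \<open>P \<le> p\<close> by simp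
      also have "\<dots> < \<rho> * \<beta> (Suc q)" using \<rho>(3) pos[of "Suc q"] by simp
      finally have "2 * eigensol \<beta> \<rho> (Suc q) \<le> 2 * (\<rho> * \<beta> (Suc q)) * eigensol \<beta> \<rho> (Suc q)"
        using step.IH by (intro mult_right_mono) auto
      moreover have "eigensol \<beta> \<rho> (Suc (Suc q)) = 2 * (\<rho> * \<beta> (Suc q)) * eigensol \<beta> \<rho> (Suc q) - eigensol \<beta> \<rho> q"
        by (simp add: mult_ac)
      ultimately show ?case using step.IH by linarith
    qed
    have "0 < eigensol \<beta> \<rho> q" for q using \<rho>(1)[of q] inc[of q] by (cases "q \<le> p") auto
    then have "growth \<beta> \<le> \<rho>"
      using \<rho>(3) \<rho>1 by (intro growth_le_super[of _ "eigensol \<beta> \<rho>"]) (auto simp: jac_eigensol)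
    then show False using \<rho>(4) by simp
  qed
  have tail: "?h (P + n) \<le> ?h P" for n
  proof (induction n)
    case (Suc n)
    then show ?case using decr[of "P + n"] by simp
  qed simp
  have "\<bar>?h p\<bar> \<le> (\<Sum>q\<le>P. ?h q)" for p
  proof (cases "p \<le> P")
    case True
    then show ?thesis using h by (auto simp: less_imp_le abs_of_pos intro!: member_le_sum)
  next
    case False
    then have "?h p \<le> ?h P" using tail[of "p - P"] by simp
    also have "\<dots> \<le> (\<Sum>q\<le>P. ?h q)" using h by (auto simp: less_imp_le intro!: member_le_sum)
    finally show ?thesis using h[of p] by simp
  qed
  \<comment> \<open>\<open>?h\<close> is bounded and \<open>?g\<close> decays, so the Wronskian
    would be nonpositive, whereas it equals 2 \<beta>_0.\<close>
  then have "?g 0 * ?h (Suc 0) \<le> ?g (Suc 0) * ?h 0"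
    by (intro wronskian_nonpos[where P = 0 and q = "\<lambda>p. 2 * growth \<beta> * \<beta> (Suc p)"] green_tendsto_0 lim tr gr)
       (auto simp: g green_rec[OF tr])
  then show False using W[of 0] pos[of 0] by simp
qed

text \<open>Expanding \<beta>_p G(p)^2 and summing over p, with self-adjointness, gives \<beta>_0
  times the sum over i, j of the return weights at time i + j, where time n occurs n + 1 times.
  Truncated for this direction, the triangle i + j \<le> N is enlarged to the square i, j \<le>
  N.\<close>

lemma summable_green_square_imp:
  assumes tr: "transient \<beta> 1" and s: "summable (\<lambda>p. (green \<beta> 1 p)\<^sup>2)" and C: "\<And>p. \<beta> p \<le> C"
  shows "summable (\<lambda>n. real (Suc n) * entry \<beta> n 0 0)"
proof (rule summableI_nonneg_bounded)
  fix N
  have "\<beta> 0 * (\<Sum>n<N. real (Suc n) * entry \<beta> n 0 0) \<le> \<beta> 0 * (\<Sum>n\<le>N. real (Suc n) * entry \<beta> n 0 0)"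
    using pos[of 0] by (intro mult_left_mono sum_mono2) (auto simp: entry_nonneg)
  also have "\<dots> = (\<Sum>n\<le>N. \<Sum>k\<le>n. \<beta> 0 * entry \<beta> (k + (n - k)) 0 0)"
    by (simp add: sum_distrib_left mult_ac)
  also have "\<dots> = (\<Sum>n\<le>N. \<Sum>k\<le>n. \<Sum>p\<le>N. \<beta> p * entry \<beta> k p 0 * entry \<beta> (n - k) p 0)"
    by (intro sum.cong refl entry_inner_product[symmetric]) auto
  also have "\<dots> = (\<Sum>(i, j)\<in>{(i, j). i + j \<le> N}. \<Sum>p\<le>N. \<beta> p * entry \<beta> i p 0 * entry \<beta> j p 0)"
    by (rule sum.triangle_reindex_eq[symmetric])
  also have "\<dots> \<le> (\<Sum>(i, j)\<in>{..N} \<times> {..N}. \<Sum>p\<le>N. \<beta> p * entry \<beta> i p 0 * entry \<beta> j p 0)"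
    using pos by (intro sum_mono2) (auto intro!: sum_nonneg mult_nonneg_nonneg simp: entry_nonneg less_imp_le)
  also have "\<dots> = (\<Sum>i\<le>N. \<Sum>j\<le>N. \<Sum>p\<le>N. \<beta> p * entry \<beta> i p 0 * entry \<beta> j p 0)"
    by (rule sum.cartesian_product[symmetric])
  also have "\<dots> = (\<Sum>i\<le>N. \<Sum>p\<le>N. \<Sum>j\<le>N. \<beta> p * entry \<beta> i p 0 * entry \<beta> j p 0)"
    by (intro sum.cong refl sum.swap)
  also have "\<dots> = (\<Sum>p\<le>N. \<Sum>i\<le>N. \<Sum>j\<le>N. \<beta> p * entry \<beta> i p 0 * entry \<beta> j p 0)"
    by (rule sum.swap)
  also have "\<dots> = (\<Sum>p\<le>N. \<beta> p * (\<Sum>i\<le>N. entry \<beta> i p 0)\<^sup>2)"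
    by (simp add: power2_eq_square sum_product sum_distrib_left mult_ac)
  also have "\<dots> \<le> (\<Sum>p\<le>N. C * (green \<beta> 1 p)\<^sup>2)"
  proof (intro sum_mono mult_mono power_mono)
    fix p
    show "(\<Sum>i\<le>N. entry \<beta> i p 0) \<le> green \<beta> 1 p"
      unfolding green_def using sum_le_suminf[OF green_summable[OF tr, of p], of "{..N}"]
      by (simp add: entry_nonneg)
  qed (use C pos less_le_trans[OF pos C] in \<open>auto intro!: sum_nonneg simp: entry_nonneg less_imp_le\<close>)
  also have "\<dots> = C * (\<Sum>p\<le>N. (green \<beta> 1 p)\<^sup>2)" by (simp add: sum_distrib_left)
  also have "\<dots> \<le> C * (\<Sum>p. (green \<beta> 1 p)\<^sup>2)"
    using less_le_trans[OF pos C] by (intro mult_left_mono sum_le_suminf s) (auto simp: less_imp_le)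
  finally show "(\<Sum>n<N. real (Suc n) * entry \<beta> n 0 0) \<le> C * (\<Sum>p. (green \<beta> 1 p)\<^sup>2) / \<beta> 0"
    using pos[of 0] by (simp add: field_simps)
qed (simp add: entry_nonneg)

text \<open>The same identity with the opposite inclusion: the square i, j \<le> K lies in the
  triangle i + j \<le> 2 K. Afterwards K tends to infinity with the range of p fixed.\<close>

lemma summable_green_square:
  assumes tr: "transient \<beta> 1" and s: "summable (\<lambda>n. real (Suc n) * entry \<beta> n 0 0)"
  shows "summable (\<lambda>p. (green \<beta> 1 p)\<^sup>2)"
proof (rule summableI_nonneg_bounded)
  fix P
  have part: "(\<Sum>p<P. c * (\<Sum>i\<le>K. entry \<beta> i p 0)\<^sup>2) \<le> \<beta> 0 * (\<Sum>n. real (Suc n) * entry \<beta> n 0 0)" for K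
  proof -
    define M where "M = max P (2 * K)"
    have "(\<Sum>p<P. c * (\<Sum>i\<le>K. entry \<beta> i p 0)\<^sup>2) \<le> (\<Sum>p<P. \<beta> p * (\<Sum>i\<le>K. entry \<beta> i p 0)\<^sup>2)"
      using c_le by (intro sum_mono mult_right_mono) auto
    also have "\<dots> \<le> (\<Sum>p\<le>M. \<beta> p * (\<Sum>i\<le>K. entry \<beta> i p 0)\<^sup>2)"
      using pos by (intro sum_mono2) (auto simp: M_def less_imp_le)
    also have "\<dots> = (\<Sum>p\<le>M. \<Sum>i\<le>K. \<Sum>j\<le>K. \<beta> p * entry \<beta> i p 0 * entry \<beta> j p 0)"
      by (simp add: power2_eq_square sum_product sum_distrib_left mult_ac)
    also have "\<dots> = (\<Sum>i\<le>K. \<Sum>p\<le>M. \<Sum>j\<le>K. \<beta> p * entry \<beta> i p 0 * entry \<beta> j p 0)"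
      by (rule sum.swap)
    also have "\<dots> = (\<Sum>i\<le>K. \<Sum>j\<le>K. \<Sum>p\<le>M. \<beta> p * entry \<beta> i p 0 * entry \<beta> j p 0)"
      by (intro sum.cong refl sum.swap)
    also have "\<dots> = (\<Sum>i\<le>K. \<Sum>j\<le>K. \<beta> 0 * entry \<beta> (i + j) 0 0)"
      by (intro sum.cong refl entry_inner_product) (auto simp: M_def)
    also have "\<dots> = (\<Sum>(i, j)\<in>{..K} \<times> {..K}. \<beta> 0 * entry \<beta> (i + j) 0 0)"
      by (rule sum.cartesian_product)
    also have "\<dots> \<le> (\<Sum>(i, j)\<in>{(i, j). i + j \<le> 2 * K}. \<beta> 0 * entry \<beta> (i + j) 0 0)"
    proof (rule sum_mono2)
      show "finite {(i, j). i + j \<le> 2 * K}"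
        by (rule finite_subset[of _ "{..2 * K} \<times> {..2 * K}"]) auto
    qed (use pos[of 0] in \<open>auto intro!: mult_nonneg_nonneg simp: entry_nonneg\<close>)
    also have "\<dots> = (\<Sum>n\<le>2 * K. \<Sum>i\<le>n. \<beta> 0 * entry \<beta> (i + (n - i)) 0 0)"
      by (rule sum.triangle_reindex_eq)
    also have "\<dots> = \<beta> 0 * (\<Sum>n\<le>2 * K. real (Suc n) * entry \<beta> n 0 0)"
      by (simp add: sum_distrib_left mult_ac)
    also have "\<dots> \<le> \<beta> 0 * (\<Sum>n. real (Suc n) * entry \<beta> n 0 0)"
      using pos[of 0] by (intro mult_left_mono sum_le_suminf s) (auto simp: entry_nonneg)
    finally show ?thesis .
  qed
  have "(\<lambda>K. \<Sum>i\<le>K. entry \<beta> i p 0) \<longlonglongrightarrow> green \<beta> 1 p" for p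
    using summable_LIMSEQ'[OF green_summable[OF tr, of p]] by (simp add: green_def)
  then have "(\<lambda>K. \<Sum>p<P. c * (\<Sum>i\<le>K. entry \<beta> i p 0)\<^sup>2) \<longlonglongrightarrow> (\<Sum>p<P. c * (green \<beta> 1 p)\<^sup>2)"
    by (intro tendsto_intros)
  then have "(\<Sum>p<P. c * (green \<beta> 1 p)\<^sup>2) \<le> \<beta> 0 * (\<Sum>n. real (Suc n) * entry \<beta> n 0 0)"
    by (rule LIMSEQ_le_const2) (use part in blast)
  then show "(\<Sum>p<P. (green \<beta> 1 p)\<^sup>2) \<le> \<beta> 0 * (\<Sum>n. real (Suc n) * entry \<beta> n 0 0) / c"
    using c_pos by (simp add: field_simps sum_distrib_left)
qed simp

end

text \<open>A finite critical value bounds the Green functions above the growth rate. Each partial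
  sum is continuous in \<rho>, so its bound survives at the growth rate itself.\<close>

lemma (in bulk_weights) transient_growth:
  assumes "b0_crit b < \<infinity>"
  shows "transient \<beta> (growth \<beta>)"
proof -
  have le: "ereal (pinning \<beta> \<rho>) \<le> b0_crit b" if "growth \<beta> < \<rho>" for \<rho>
    unfolding b0_crit_eq using that by (intro SUP_upper) auto
  have "\<bar>b0_crit b\<bar> \<noteq> \<infinity>" using assms le[of "growth \<beta> + 1"] by auto
  then obtain bc where bc: "b0_crit b = ereal bc" by (cases "b0_crit b") auto
  have part: "(\<Sum>n<N. entry \<beta> n 0 0 / \<rho> ^ Suc n) \<le> bc * (4 * b 1 * \<rho>)" if "growth \<beta> < \<rho>" for N \<rho>
  proof -
    have tr: "transient \<beta> \<rho>" using that by (rule transient_above_growth)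
    then have \<rho>: "0 < \<rho>" by (simp add: transient_def)
    have "(\<Sum>n<N. entry \<beta> n 0 0 / \<rho> ^ Suc n) \<le> green \<beta> \<rho> 0"
      unfolding green_def using \<rho> by (intro sum_le_suminf green_summable tr) (auto simp: entry_nonneg)
    also have "\<dots> \<le> bc * (4 * b 1 * \<rho>)"
      using le[OF that] \<rho> b_pos[of 1] by (simp add: bc pinning_def pos_divide_le_eq)
    finally show ?thesis .
  qed
  have g: "0 < growth \<beta>" by (rule growth_pos)
  have part_g: "(\<Sum>n<N. entry \<beta> n 0 0 / growth \<beta> ^ Suc n) \<le> bc * (4 * b 1 * growth \<beta>)" for N
  proof (rule tendsto_le[OF trivial_limit_at_right_real])
    show "((\<lambda>\<rho>. bc * (4 * b 1 * \<rho>)) \<longlongrightarrow> bc * (4 * b 1 * growth \<beta>)) (at_right (growth \<beta>))"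
      by (intro tendsto_intros)
    show "((\<lambda>\<rho>. \<Sum>n<N. entry \<beta> n 0 0 / \<rho> ^ Suc n) \<longlongrightarrow> (\<Sum>n<N. entry \<beta> n 0 0 / growth \<beta> ^ Suc n)) (at_right (growth \<beta>))"
      using g by (intro tendsto_intros) auto
    show "\<forall>\<^sub>F \<rho> in at_right (growth \<beta>). (\<Sum>n<N. entry \<beta> n 0 0 / \<rho> ^ Suc n) \<le> bc * (4 * b 1 * \<rho>)"
      unfolding eventually_at_right_field using part by (intro exI[of _ "growth \<beta> + 1"]) auto
  qed
  have "summable (\<lambda>n. entry \<beta> n 0 0 / growth \<beta> ^ Suc n)"
    by (rule summableI_nonneg_bounded) (use g part_g in \<open>auto simp: entry_nonneg\<close>)
  then have "summable (\<lambda>n. growth \<beta> * (entry \<beta> n 0 0 / growth \<beta> ^ Suc n))" by (rule summable_mult)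
  then show ?thesis using g by (simp add: transient_def)
qed

section \<open>Perturbations of inverse-square type\<close>

lemma second_difference_powr:
  "(\<lambda>n. (real n)\<^sup>2 * ((1 + 1 / real n) powr (- \<kappa>) + (1 - 1 / real n) powr (- \<kappa>) - 2))
    \<longlonglongrightarrow> \<kappa> * (\<kappa> + 1)"
proof -
  have "(\<lambda>n. (real n)\<^sup>2 * ((1 + 1 / real n) powr (- \<kappa>) + (1 - 1 / real n) powr (- \<kappa>) - 2))
    \<longlonglongrightarrow> - (\<kappa> * (- \<kappa> - 1))"
    by real_asymp
  then show ?thesis by (simp add: algebra_simps)
qed

text \<open>Homogeneity pulls out the power of n; the factor n^2 is inserted and divided out again
  to exhibit the expression whose limit is \<kappa> (\<kappa> + 1).\<close>

lemma second_difference_powr_eq: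
  assumes "2 \<le> n"
  shows "(real n + 1) powr (- \<kappa>) + (real n - 1) powr (- \<kappa>) = (2 + (real n)\<^sup>2 *
    ((1 + 1 / real n) powr (- \<kappa>) + (1 - 1 / real n) powr (- \<kappa>) - 2) / (real n)\<^sup>2) * real n powr (- \<kappa>)"
proof -
  have "real n + 1 = (1 + 1 / real n) * real n" "real n - 1 = (1 - 1 / real n) * real n"
    using assms by (simp_all add: field_simps)
  then have powr: "(real n + 1) powr (- \<kappa>) = (1 + 1 / real n) powr (- \<kappa>) * real n powr (- \<kappa>)"
    "(real n - 1) powr (- \<kappa>) = (1 - 1 / real n) powr (- \<kappa>) * real n powr (- \<kappa>)"
    using assms by (simp_all add: powr_mult)
  have "(real n)\<^sup>2 * z / (real n)\<^sup>2 = z" for z using assms by simp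
  then show ?thesis unfolding powr by (simp only:) (simp add: algebra_simps)
qed

lemma eventually_second_difference_powr_le:
  assumes "\<kappa> * (\<kappa> + 1) < K"
  shows "\<forall>\<^sub>F n in sequentially. (real n + 1) powr (- \<kappa>) + (real n - 1) powr (- \<kappa>)
    \<le> (2 + K / (real n)\<^sup>2) * real n powr (- \<kappa>)"
  using order_tendstoD(2)[OF second_difference_powr assms] eventually_ge_at_top[of 2]
proof eventually_elim
  case (elim n)
  show ?case unfolding second_difference_powr_eq[OF elim(2)]
    using elim(1) by (intro mult_right_mono add_left_mono divide_right_mono) auto
qed

lemma eventually_second_difference_powr_ge:
  assumes "K < \<kappa> * (\<kappa> + 1)"
  shows "\<forall>\<^sub>F n in sequentially. (2 + K / (real n)\<^sup>2) * real n powr (- \<kappa>)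
    \<le> (real n + 1) powr (- \<kappa>) + (real n - 1) powr (- \<kappa>)"
  using order_tendstoD(1)[OF second_difference_powr assms] eventually_ge_at_top[of 2]
proof eventually_elim
  case (elim n)
  show ?case unfolding second_difference_powr_eq[OF elim(2)]
    using elim(1) by (intro mult_right_mono add_left_mono divide_right_mono) auto
qed

locale inverse_square_weights = bulk_weights +
  fixes w \<zeta> C :: real
  assumes zeta: "0 < \<zeta>" and C: "0 < C"
    and asymp: "\<forall>\<^sub>F n in sequentially. \<bar>b n - (1 - w / (real n)\<^sup>2)\<bar> \<le> C / real n powr (2 + \<zeta>)"
begin

lemma b_tendsto: "b \<longlonglongrightarrow> 1"
proof -
  have "(\<lambda>n. C / real n powr (2 + \<zeta>)) \<longlonglongrightarrow> 0" using zeta C by real_asymp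
  then have "(\<lambda>n. b n - (1 - w / (real n)\<^sup>2)) \<longlonglongrightarrow> 0"
    by (rule Lim_null_comparison[rotated]) (use asymp in simp)
  moreover have "(\<lambda>n. 1 - w / (real n)\<^sup>2) \<longlonglongrightarrow> 1" by real_asymp
  ultimately have "(\<lambda>n. (b n - (1 - w / (real n)\<^sup>2)) + (1 - w / (real n)\<^sup>2)) \<longlonglongrightarrow> 0 + 1"
    by (rule tendsto_add)
  then show ?thesis by simp
qed

lemma beta_tendsto: "\<beta> \<longlonglongrightarrow> 1"
  using LIMSEQ_Suc[OF b_tendsto] .

lemma transient_1:
  assumes "b0_crit b < \<infinity>"
  shows "growth \<beta> = 1" "transient \<beta> 1"
proof -
  have tr: "transient \<beta> (growth \<beta>)" by (rule transient_growth[OF assms])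
  show "growth \<beta> = 1"
    using growth_ge_1[OF beta_tendsto] growth_le_1[OF beta_tendsto tr] by simp
  with tr show "transient \<beta> 1" by simp
qed

text \<open>The power n powr (- \<kappa>) is a supersolution far out once \<kappa> (\<kappa> + 1) <
  - 2 w. At \<kappa> = 1 / 2 the left side is 3 / 4, so w < - 3 / 8 leaves room for some \<kappa> >
  1 / 2, whose square is summable.\<close>

lemma summable_green_square_strong:
  assumes tr: "transient \<beta> 1" and w: "w < - 3 / 8"
  shows "summable (\<lambda>p. (green \<beta> 1 p)\<^sup>2)"
proof -
  define g where "g = - 2 * w - 3 / 4"
  have g: "0 < g" using w by (simp add: g_def)
  \<comment> \<open>The gap g is shared out: raising \<kappa> above 1 / 2 costs 2 \<epsilon> +
    \<epsilon>^2 \<le> 3 \<epsilon> \<le> g / 2, below the 3 g / 4 included in K, and the remaining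
    g / 4 pays for the error term of b.\<close>
  define \<epsilon> where "\<epsilon> = min 1 (g / 6)"
  have \<epsilon>: "0 < \<epsilon>" "\<epsilon> \<le> 1" "\<epsilon> \<le> g / 6" using g by (auto simp: \<epsilon>_def)
  define \<kappa> where "\<kappa> = 1 / 2 + \<epsilon>"
  define K where "K = 3 / 4 + 3 / 4 * g"
  have "\<epsilon> * \<epsilon> \<le> \<epsilon>" using \<epsilon> by (simp add: mult_left_le)
  moreover have "\<kappa> * (\<kappa> + 1) = 3 / 4 + 2 * \<epsilon> + \<epsilon> * \<epsilon>" by (simp add: \<kappa>_def field_simps)
  ultimately have K: "\<kappa> * (\<kappa> + 1) < K" using \<epsilon> g unfolding K_def by linarith
  have "(\<lambda>n. 2 * C / real n powr \<zeta>) \<longlonglongrightarrow> 0" using zeta C by real_asymp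
  then have "\<forall>\<^sub>F n in sequentially. 2 * C / real n powr \<zeta> < g / 4"
    by (rule order_tendstoD(2)) (use g in simp)
  then have "\<forall>\<^sub>F n in sequentially. (real n + 1) powr (- \<kappa>) + (real n - 1) powr (- \<kappa>)
      \<le> 2 * b n * real n powr (- \<kappa>)"
    using asymp eventually_second_difference_powr_le[OF K] eventually_gt_at_top[of 0]
  proof eventually_elim
    case (elim n)
    have "2 * C / real n powr (2 + \<zeta>) = 2 * C / real n powr \<zeta> / (real n)\<^sup>2"
      using elim by (simp add: powr_add)
    also have "\<dots> \<le> g / 4 / (real n)\<^sup>2" using elim by (intro divide_right_mono) auto
    finally have "2 * (C / real n powr (2 + \<zeta>)) \<le> g / 4 / (real n)\<^sup>2" by simp
    moreover have "K / (real n)\<^sup>2 = - 2 * (w / (real n)\<^sup>2) - g / 4 / (real n)\<^sup>2"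
    proof -
      have "K = - 2 * w - g / 4" by (simp add: K_def g_def field_simps)
      then show ?thesis by (simp add: diff_divide_distrib)
    qed
    ultimately have "2 + K / (real n)\<^sup>2 \<le> 2 * b n" using elim(2) by linarith
    then have "(2 + K / (real n)\<^sup>2) * real n powr (- \<kappa>) \<le> 2 * b n * real n powr (- \<kappa>)"
      by (intro mult_right_mono) auto
    then show ?case using elim(3) by linarith
  qed
  then obtain N where N: "\<And>n. N \<le> n \<Longrightarrow> (real n + 1) powr (- \<kappa>) + (real n - 1) powr (- \<kappa>)
      \<le> 2 * b n * real n powr (- \<kappa>)"
    unfolding eventually_sequentially by blast
  define y where "y p = real (Suc p) powr (- \<kappa>)" for p
  have super: "jac \<beta> y p \<le> 1 * y p" if "N < p" for p
  proof (cases p)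
    case (Suc q)
    have "real (Suc (Suc (Suc q))) = real (Suc (Suc q)) + 1" "real (Suc q) = real (Suc (Suc q)) - 1" by auto
    then have "y (Suc (Suc q)) + y q \<le> 2 * 1 * \<beta> (Suc q) * y (Suc q)"
      unfolding y_def using N[of "Suc (Suc q)"] that Suc by simp
    then show ?thesis unfolding Suc jac_super_iff .
  qed (use that in simp)
  obtain A where A: "0 < A" "\<And>p. green \<beta> 1 p \<le> A * y p"
    by (rule green_le_super_outside[OF tr, of y N]) (use super in \<open>auto simp: y_def\<close>)
  have "summable (\<lambda>n. real n powr (- 2 * \<kappa>))" using \<epsilon> by (simp add: summable_real_powr_iff \<kappa>_def)
  then have "summable (\<lambda>p. real (Suc p) powr (- 2 * \<kappa>))" by (subst summable_Suc_iff)
  then have "summable (\<lambda>p. A\<^sup>2 * real (Suc p) powr (- 2 * \<kappa>))" by (rule summable_mult)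
  then show ?thesis
  proof (rule summable_comparison_test'[where N = 0])
    fix p
    have "(green \<beta> 1 p)\<^sup>2 \<le> (A * y p)\<^sup>2"
      using A(2) green_pos[OF tr, of p] by (intro power_mono) (auto simp: less_imp_le)
    also have "\<dots> = A\<^sup>2 * real (Suc p) powr (- 2 * \<kappa>)"
      by (simp add: y_def power_mult_distrib power2_eq_square flip: powr_add)
    finally show "norm ((green \<beta> 1 p)\<^sup>2) \<le> A\<^sup>2 * real (Suc p) powr (- 2 * \<kappa>)" by simp
  qed
qed

text \<open>The exponent \<open>- 1 / 2\<close> is exact for \<open>w = - 3 / 8\<close>; the strict gain from the second power in \<open>f\<close> absorbs
  the error term of \<open>b\<close>.\<close>
lemma not_summable_green_square:
  assumes tr: "transient \<beta> 1" and w: "- 3 / 8 \<le> w"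
  shows "\<not> summable (\<lambda>p. (green \<beta> 1 p)\<^sup>2)"
proof
  assume s: "summable (\<lambda>p. (green \<beta> 1 p)\<^sup>2)"
  \<comment> \<open>Relative to n powr (- \<kappa> - 2), the error term of b acting on n powr (- 1 /
    2) is smaller by n powr \<delta>, while the second power gains a constant larger than \<delta>;
    hence the split of \<zeta> into two halves.\<close>
  define \<delta> where "\<delta> = \<zeta> / 2"
  have \<delta>: "0 < \<delta>" using zeta by (simp add: \<delta>_def)
  define \<kappa> where "\<kappa> = 1 / 2 + \<delta>"
  define f where "f x = x powr (- 1 / 2) + x powr (- \<kappa>)" for x :: real
  have "\<kappa> * (\<kappa> + 1) = 3 / 4 + 2 * \<delta> + \<delta> * \<delta>" by (simp add: \<kappa>_def field_simps)
  then have K: "3 / 4 + \<delta> < \<kappa> * (\<kappa> + 1)" using \<delta> by (simp add: add_pos_pos)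
  \<comment> \<open>There is no slack in the coefficient 3 / 4; the inequality holds because the
    next term of the expansion, of relative order n^(-4), is positive.\<close>
  have half: "\<forall>\<^sub>F n in sequentially. (2 + 3 / 4 / (real n)\<^sup>2) * real n powr (- 1 / 2)
      \<le> (real n + 1) powr (- 1 / 2) + (real n - 1) powr (- 1 / 2)"
    by real_asymp
  have big: "\<forall>\<^sub>F n in sequentially. 4 * C / \<delta> \<le> real n powr \<delta>" using \<delta> by real_asymp
  have "\<forall>\<^sub>F n in sequentially. 2 * b n * f (real n) \<le> f (real n + 1) + f (real n - 1)"
    using asymp half big eventually_second_difference_powr_ge[OF K] eventually_gt_at_top[of 0]
  proof eventually_elim
    case (elim n)
    let ?n = "real n"
    have n: "1 \<le> ?n" using elim by simp
    have "?n powr (- \<kappa>) \<le> ?n powr (- 1 / 2)" using n \<delta> by (intro powr_mono) (auto simp: \<kappa>_def)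
    then have f: "f ?n \<le> 2 * ?n powr (- 1 / 2)" "0 \<le> f ?n" by (auto simp: f_def)
    have "2 * (C / ?n powr (2 + \<zeta>)) * f ?n \<le> 2 * (C / ?n powr (2 + \<zeta>)) * (2 * ?n powr (- 1 / 2))"
      using f C by (intro mult_left_mono) auto
    also have "\<dots> = 4 * C * ?n powr (- 1 / 2 - (2 + \<zeta>))"
      by (simp only: powr_diff) simp
    also have "\<dots> \<le> (\<delta> * ?n powr \<delta>) * ?n powr (- 1 / 2 - (2 + \<zeta>))"
      using elim(3) \<delta> by (intro mult_right_mono) (auto simp: field_simps)
    also have "\<dots> = \<delta> * ?n powr (\<delta> + (- 1 / 2 - (2 + \<zeta>)))"
      by (simp add: powr_add)
    also have "\<delta> + (- 1 / 2 - (2 + \<zeta>)) = - \<kappa> - 2" by (simp add: \<kappa>_def \<delta>_def)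
    also have "\<delta> * ?n powr (- \<kappa> - 2) = \<delta> / ?n\<^sup>2 * ?n powr (- \<kappa>)"
      using n by (simp add: powr_diff)
    finally have err: "2 * (C / ?n powr (2 + \<zeta>)) * f ?n \<le> \<delta> / ?n\<^sup>2 * ?n powr (- \<kappa>)" .
    have "(- w) / ?n\<^sup>2 \<le> 3 / 8 / ?n\<^sup>2" using w by (intro divide_right_mono) auto
    then have "- (w / ?n\<^sup>2) \<le> 3 / 8 / ?n\<^sup>2" by simp
    then have "2 * b n \<le> 2 + 3 / 4 / ?n\<^sup>2 + 2 * (C / ?n powr (2 + \<zeta>))"
      using elim(1) by linarith
    then have "2 * b n * f ?n \<le> (2 + 3 / 4 / ?n\<^sup>2 + 2 * (C / ?n powr (2 + \<zeta>))) * f ?n"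
      using f by (intro mult_right_mono) auto
    also have "\<dots> = (2 + 3 / 4 / ?n\<^sup>2) * f ?n + 2 * (C / ?n powr (2 + \<zeta>)) * f ?n"
      by (rule distrib_right)
    also have "\<dots> \<le> (2 + 3 / 4 / ?n\<^sup>2) * f ?n + \<delta> / ?n\<^sup>2 * ?n powr (- \<kappa>)" using err by simp
    also have "\<dots> = (2 + 3 / 4 / ?n\<^sup>2) * ?n powr (- 1 / 2) + (2 + (3 / 4 + \<delta>) / ?n\<^sup>2) * ?n powr (- \<kappa>)"
      by (simp add: f_def add_divide_distrib algebra_simps)
    also have "\<dots> \<le> f (?n + 1) + f (?n - 1)" using elim(2,4) by (simp add: f_def)
    finally show ?case .
  qed
  then obtain N where N: "\<And>n. N \<le> n \<Longrightarrow> 2 * b n * f (real n) \<le> f (real n + 1) + f (real n - 1)"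
    unfolding eventually_sequentially by blast
  define y where "y p = f (real (Suc p))" for p
  let ?g = "green \<beta> 1"
  have g: "0 < ?g p" for p by (rule green_pos[OF tr])
  have y: "0 < y p" for p by (simp add: y_def f_def add_pos_pos)
  have bdd: "\<bar>y p\<bar> \<le> 2" for p
  proof -
    have le1: "real (Suc p) powr a \<le> 1" if "a \<le> 0" for a
      using powr_mono[OF that, of "real (Suc p)"] by simp
    have "y p \<le> 1 + 1" unfolding y_def f_def using \<delta> by (intro add_mono le1) (auto simp: \<kappa>_def)
    then show ?thesis using y[of p] by simp
  qed
  have sub: "2 * \<beta> (Suc p) * y (Suc p) \<le> y (Suc (Suc p)) + y p" if "N \<le> p" for p
  proof -
    have "real (Suc (Suc (Suc p))) = real (Suc (Suc p)) + 1" "real (Suc p) = real (Suc (Suc p)) - 1" by auto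
    then show ?thesis unfolding y_def using N[of "Suc (Suc p)"] that by simp
  qed
  \<comment> \<open>The assumed square summability supplies the decay of the Green function that the
    Wronskian bound asks for.\<close>
  have "(\<lambda>p. sqrt ((?g p)\<^sup>2)) \<longlonglongrightarrow> sqrt 0"
    by (intro tendsto_real_sqrt summable_LIMSEQ_zero s)
  then have g0: "?g \<longlonglongrightarrow> 0" using g by (simp add: less_imp_le)
  have W: "?g p * y (Suc p) \<le> ?g (Suc p) * y p" if "N \<le> p" for p
    using that
    by (intro wronskian_nonpos[where x = ?g and y = y and B = 2 and P = N and q = "\<lambda>p. 2 * \<beta> (Suc p)"] g g0 bdd sub)
       (use green_rec[OF tr] in \<open>auto simp: mult_ac\<close>)
  \<comment> \<open>The Wronskian inequality says that y / \<open>?g\<close> is nonincreasing from N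
    on. Its value at N therefore bounds \<open>?g\<close> below by a multiple of p powr (- 1 / 2),
    whose squares form the harmonic series.\<close>
  define A where "A = y N / ?g N"
  have ratio: "y p / ?g p \<le> A" if "N \<le> p" for p
    using that
  proof (induction p rule: dec_induct)
    case (step p)
    have "y (Suc p) / ?g (Suc p) \<le> y p / ?g p"
      using W[of p] step g[of p] g[of "Suc p"] by (simp add: field_simps)
    then show ?case using step by simp
  qed (simp add: A_def)
  have "summable (\<lambda>p. A\<^sup>2 * (?g p)\<^sup>2)" by (intro summable_mult s)
  then have "summable (\<lambda>p. 1 / real (Suc p))"
  proof (rule summable_comparison_test'[where N = N])
    fix p assume "N \<le> p"
    have "1 / real (Suc p) = (real (Suc p) powr (- 1 / 2))\<^sup>2"
      by (simp add: power2_eq_square powr_minus_divide flip: powr_add)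
    also have "\<dots> \<le> (y p)\<^sup>2" by (intro power_mono) (auto simp: y_def f_def)
    also have "\<dots> \<le> (A * ?g p)\<^sup>2"
      using ratio[OF \<open>N \<le> p\<close>] g[of p] y[of p] by (intro power_mono) (auto simp: field_simps less_imp_le)
    finally show "norm (1 / real (Suc p)) \<le> A\<^sup>2 * (?g p)\<^sup>2" by (simp add: power_mult_distrib)
  qed
  then have "summable (\<lambda>n. 1 / real n)" by (subst (asm) summable_Suc_iff)
  then show False using not_summable_harmonic[where 'a = real] by (simp add: inverse_eq_divide)
qed

end

section \<open>The density of returns at criticality\<close>

context inverse_square_weights
begin

text \<open>The numerator stays below its finite value at s = 1, while failure of square summability
  makes the derivative series in the denominator tend to infinity.\<close>

lemma contact_density_tendsto_0:
  assumes fin: "b0_crit b < \<infinity>" and w: "- 3 / 8 \<le> w"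
  shows "(contact_density \<longlongrightarrow> 0) (at_left 1)"
proof -
  have g1: "growth \<beta> = 1" and tr: "transient \<beta> 1" using transient_1[OF fin] by auto
  define a where "a = diffs (\<lambda>n. entry \<beta> n 0 0)"
  have ann: "0 \<le> a n" for n by (simp add: a_def diffs_def entry_nonneg)
  have se: "summable (\<lambda>n. entry \<beta> n 0 0)" using tr by (simp add: transient_def)
  have not_s: "\<not> summable a"
  proof
    assume "summable a"
    \<comment> \<open>\<open>diffs\<close> pairs n + 1 with the entry at n + 1; reindexing and
      adding the summable entries pairs n + 1 with the entry at n.\<close>
    then have "summable (\<lambda>n. real (Suc n) * entry \<beta> (Suc n) 0 0)" by (simp add: a_def diffs_def)
    then have "summable (\<lambda>n. real n * entry \<beta> n 0 0)" by (subst (asm) summable_Suc_iff)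
    then have "summable (\<lambda>n. real n * entry \<beta> n 0 0 + entry \<beta> n 0 0)" using se by (rule summable_add)
    then have "summable (\<lambda>n. real (Suc n) * entry \<beta> n 0 0)" by (simp add: algebra_simps)
    then show False using summable_green_square[OF tr] not_summable_green_square[OF tr w] by blast
  qed
  define G where "G = (\<Sum>n. entry \<beta> n 0 0)"
  have pos_lt: "\<forall>\<^sub>F s in at_left (1::real). 1 / 2 < s \<and> s < 1"
    unfolding eventually_at_left_field by (intro exI[of _ "1 / 2"]) auto
  show ?thesis
  proof (rule tendstoI)
    fix e :: real assume e: "0 < e"
    \<comment> \<open>The factor 2 compensates for s, which is only known to exceed 1 / 2.\<close>
    have "\<exists>N. 2 * G / e < (\<Sum>n<N. a n)"
    proof (rule ccontr)
      assume "\<nexists>N. 2 * G / e < (\<Sum>n<N. a n)"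
      then have "summable a" using ann by (intro summableI_nonneg_bounded[where x = "2 * G / e"]) (auto simp: not_less)
      then show False using not_s by simp
    qed
    then obtain N where N: "2 * G / e < (\<Sum>n<N. a n)" by blast
    have "\<forall>\<^sub>F s in at_left 1. 2 * G / e < (\<Sum>n. a n * s ^ n)"
      by (rule eventually_at_left_suminf_gt[OF ann _ N]) (use return_series'_summable g1 in \<open>auto simp: a_def\<close>)
    then have "\<forall>\<^sub>F s in at_left 1. 2 * G / e < return_series' \<beta> s" by (simp add: return_series'_def a_def)
    with pos_lt show "\<forall>\<^sub>F s in at_left 1. dist (contact_density s) 0 < e"
    proof eventually_elim
      case (elim s)
      then have s: "0 < s" "s < 1 / growth \<beta>" by (auto simp: g1)
      have return_series: "1 \<le> return_series \<beta> s" using return_series_ge_1 s by simp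
      have "return_series \<beta> s \<le> G"
        unfolding return_series_def G_def using s g1
        by (intro suminf_le se return_series_summable) (auto simp: entry_nonneg mult_left_le power_le_one)
      also have "2 * G < return_series' \<beta> s * e" using elim e by (simp add: pos_divide_less_eq)
      then have "G < 1 / 2 * return_series' \<beta> s * e" by simp
      also have "\<dots> \<le> s * return_series' \<beta> s * e"
        using elim e return_series'_nonneg[of s] s by (intro mult_right_mono) auto
      also have "\<dots> \<le> (2 * return_series \<beta> s + s * return_series' \<beta> s) * e"
        using e return_series by (intro mult_right_mono) auto
      finally have "return_series \<beta> s < e * (2 * return_series \<beta> s + s * return_series' \<beta> s)" by (simp add: mult.commute)
      moreover have "0 < 2 * return_series \<beta> s + s * return_series' \<beta> s"
        using return_series return_series'_nonneg[of s] s by (intro add_pos_nonneg) auto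
      ultimately have "contact_density s < e" unfolding contact_density_def by (simp add: pos_divide_less_eq)
      then show ?case using contact_density_pos[OF s] by simp
    qed
  qed
qed

text \<open>Square summability makes the return series and its derivative series converge at s = 1,
  so the density tends to the quotient of their values. The values of \<beta> are bounded because
  they tend to 1.\<close>

lemma contact_density_tendsto_pos:
  assumes fin: "b0_crit b < \<infinity>" and w: "w < - 3 / 8"
  obtains L where "0 < L" "(contact_density \<longlongrightarrow> L) (at_left 1)"
proof -
  have g1: "growth \<beta> = 1" and tr: "transient \<beta> 1" using transient_1[OF fin] by auto
  obtain P where P: "\<And>p. P \<le> p \<Longrightarrow> \<beta> p < 2"
    using order_tendstoD(2)[OF beta_tendsto, of 2] unfolding eventually_sequentially by auto
  have bd: "\<beta> p \<le> (\<Sum>q\<le>P. \<beta> q) + 2" for p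
  proof (cases "p \<le> P")
    case True
    then have "\<beta> p \<le> (\<Sum>q\<le>P. \<beta> q)" using pos by (intro member_le_sum) (auto simp: less_imp_le)
    then show ?thesis by simp
  next
    case False
    moreover have "0 \<le> (\<Sum>q\<le>P. \<beta> q)" using pos by (intro sum_nonneg) (auto simp: less_imp_le)
    ultimately show ?thesis using P[of p] by simp
  qed
  define a where "a = diffs (\<lambda>n. entry \<beta> n 0 0)"
  have ann: "0 \<le> a n" for n by (simp add: a_def diffs_def entry_nonneg)
  have se: "summable (\<lambda>n. entry \<beta> n 0 0)" using tr by (simp add: transient_def)
  have "summable (\<lambda>n. real (Suc n) * entry \<beta> n 0 0)"
    by (rule summable_green_square_imp[OF tr summable_green_square_strong[OF tr w] bd])
  then have "summable (\<lambda>n. real (Suc n) * entry \<beta> n 0 0 - entry \<beta> n 0 0)" using se by (rule summable_diff)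
  then have "summable (\<lambda>n. real n * entry \<beta> n 0 0)" by (simp add: algebra_simps)
  then have "summable (\<lambda>n. real (Suc n) * entry \<beta> (Suc n) 0 0)" by (subst summable_Suc_iff)
  then have sa: "summable a" by (simp add: a_def diffs_def)
  define G where "G = (\<Sum>n. entry \<beta> n 0 0)"
  define G' where "G' = (\<Sum>n. a n)"
  have lim: "(return_series \<beta> \<longlongrightarrow> G) (at_left 1)" "(return_series' \<beta> \<longlongrightarrow> G') (at_left 1)"
    unfolding return_series_def[abs_def] return_series'_def[abs_def] G_def G'_def
    using tendsto_at_left_suminf[OF _ se] tendsto_at_left_suminf[OF ann sa]
    by (auto simp: a_def entry_nonneg)
  have "1 \<le> G" unfolding G_def using sum_le_suminf[OF se, of "{0}"] by (simp add: entry_nonneg entry_0)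
  moreover have "0 \<le> G'" unfolding G'_def by (intro suminf_nonneg sa ann)
  ultimately have den: "0 < 2 * G + 1 * G'" by simp
  have "(contact_density \<longlongrightarrow> G / (2 * G + 1 * G')) (at_left 1)"
    unfolding contact_density_def[abs_def] using den by (intro tendsto_intros lim) auto
  moreover have "0 < G / (2 * G + 1 * G')" using den \<open>1 \<le> G\<close> by (intro divide_pos_pos) auto
  ultimately show thesis by (rule that[rotated])
qed

end

theorem theorem3:
  fixes b :: "nat \<Rightarrow> real" and w \<zeta> :: real
  assumes "\<And>n. n \<ge> 1 \<Longrightarrow> b n > 0"
    and "\<zeta> > 0"
    and "(\<lambda>n. b n - (1 - w / real n ^ 2)) \<in> O(\<lambda>n. 1 / real n powr (2 + \<zeta>))"
  shows "(\<forall>b0>0. ereal b0 < b0_crit b \<longrightarrow> (\<exists>m>0. has_return_density b b0 m)) \<and>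
    (b0_crit b < \<infinity> \<longrightarrow> (\<forall>b0>0. b0_crit b < ereal b0 \<longrightarrow> has_return_density b b0 0)) \<and>
    (b0_crit b < \<infinity> \<and> - 3 / 8 \<le> w \<and> w < 1 / 8 \<longrightarrow>
      (return_density b \<longlongrightarrow> 0) (at_left (real_of_ereal (b0_crit b)))) \<and>
    (b0_crit b < \<infinity> \<and> w < - 3 / 8 \<longrightarrow>
      (\<exists>L>0. (return_density b \<longlongrightarrow> L) (at_left (real_of_ereal (b0_crit b)))))"
proof -
  obtain C where C: "0 < C" "\<forall>\<^sub>F n in sequentially. norm (b n - (1 - w / real n ^ 2)) \<le> C * norm (1 / real n powr (2 + \<zeta>))"
    using landau_o.bigE[OF assms(3)] by blast
  then have asymp: "\<forall>\<^sub>F n in sequentially. \<bar>b n - (1 - w / (real n)\<^sup>2)\<bar> \<le> C / real n powr (2 + \<zeta>)"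
    by simp
  have "(\<lambda>n. 1 - w / (real n)\<^sup>2 - C / real n powr (2 + \<zeta>)) \<longlonglongrightarrow> 1" using assms(2) by real_asymp
  then have "\<forall>\<^sub>F n in sequentially. 1 / 2 < 1 - w / (real n)\<^sup>2 - C / real n powr (2 + \<zeta>)"
    by (rule order_tendstoD(1)) simp
  with asymp have "\<forall>\<^sub>F n in sequentially. 1 / 2 < b n"
    by eventually_elim linarith
  then obtain N where N: "\<And>n. N \<le> n \<Longrightarrow> 1 / 2 < b n" unfolding eventually_sequentially by blast
  \<comment> \<open>The asymptotics bound b below by 1 / 2 only from N on; the finitely many earlier
    values are positive by assumption.\<close>
  define c where "c = Min (insert (1 / 2) (b ` {1..N}))"
  interpret inverse_square_weights b c w \<zeta> C
  proof unfold_locales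
    show "0 < c" unfolding c_def using assms(1) by (subst Min_gr_iff) auto
    show "c \<le> b p" if "1 \<le> p" for p
    proof (cases "p \<le> N")
      case True
      then show ?thesis unfolding c_def using that by (intro Min_le) auto
    next
      case False
      have "c \<le> 1 / 2" unfolding c_def by (intro Min_le) auto
      then show ?thesis using N[of p] False by simp
    qed
  qed (use assms(2) C(1) asymp in auto)
  have 1: "\<exists>m>0. has_return_density b b0 m" if "0 < b0" "ereal b0 < b0_crit b" for b0
  proof -
    obtain s where "0 < s" "s < 1 / growth \<beta>" "pin_series s = b0" using pin_series_surj[OF \<open>0 < b0\<close> \<open>ereal b0 < b0_crit b\<close>] by blast
    then show ?thesis using has_return_density_pin_series contact_density_pos by blast
  qed
  have lim: "(return_density b \<longlongrightarrow> L) (at_left (real_of_ereal (b0_crit b)))"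
    if "b0_crit b < \<infinity>" "(contact_density \<longlongrightarrow> L) (at_left 1)" for L
    using return_density_tendsto[OF that(1)] that by (simp add: transient_1(1))
  show ?thesis
  proof (intro conjI impI allI)
    show "\<exists>L>0. (return_density b \<longlongrightarrow> L) (at_left (real_of_ereal (b0_crit b)))"
      if "b0_crit b < \<infinity> \<and> w < - 3 / 8"
      using contact_density_tendsto_pos lim that by metis
  qed (use 1 has_return_density_unpinned lim contact_density_tendsto_0 in auto)
qed

end
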